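(* Let $\mathsf n,t\ge 1$ be integers and $N=2^{\mathsf n}$. Let $\mathcal P_{\mathsf n}=\{\mathbf 1_2,\sigma^x,\sigma^y,\sigma^z\}^{\otimes \mathsf n}\setminus\{\mathbf 1_{N}\}$ be the set of all non-identity $\mathsf n$-qubit Pauli operators. Then \[ \Big\| \mathbb E_{\theta\sim(-\pi,\pi)}\mathbb E_{P\sim\mathcal P_{\mathsf n}}\big(e^{\mathrm i\frac\theta2 P}\otimes e^{-\mathrm i\frac\theta2\bar P}\big)^{\otimes t}-\mathbb E_{U\sim \mathrm{SU}(N)}(U\otimes\bar U)^{\otimes t}\Big\|\le 1-\frac1{4t}-\frac1{4^{\mathsf n}-1}. \] Moreover, for every finite-dimensional unitary representation $\rho$ of $\mathrm{SU}(N)$, \[ \Big\|\mathbb E_{\theta\sim(-2\pi,2\pi)}\mathbb E_{P\sim\mathcal P_{\mathsf n}}\rho\big(e^{\mathrm i\frac\theta2 P}\big)-\mathbb E_{U\sim\mathrm{SU}(N)}\rho(U)\Big\|\le 1-\frac1{4^{\mathsf n}-1}. \]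
   Context: $\sigma^x,\sigma^y,\sigma^z$ are the Pauli matrices. The norm is the operator norm (largest singular value). $\bar U$ denotes entrywise complex conjugate. $P$ is uniform on $\mathcal P_{\mathsf n}$, $\theta$ uniform on the indicated interval, independent of $P$, and $U$ is Haar-distributed on $\mathrm{SU}(N)$. *)

theory Defs
  imports "HOL-Probability.Probability" "Jordan_Normal_Form.Determinant"
begin

definition mconj :: "complex mat \<Rightarrow> complex mat" where
  "mconj A = map_mat cnj A"

definition madj :: "complex mat \<Rightarrow> complex mat" where
  "madj A = transpose_mat (mconj A)"

definition unitary_mat :: "nat \<Rightarrow> complex mat \<Rightarrow> bool" where
  "unitary_mat d U \<longleftrightarrow> U \<in> carrier_mat d d \<and> U * madj U = 1\<^sub>m d \<and> madj U * U = 1\<^sub>m d"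

definition SU :: "nat \<Rightarrow> complex mat set" where
  "SU N = {U. unitary_mat N U \<and> det U = 1}"

definition kron :: "complex mat \<Rightarrow> complex mat \<Rightarrow> complex mat" where
  "kron A B = mat (dim_row A * dim_row B) (dim_col A * dim_col B)
     (\<lambda>(i,j). A $$ (i div dim_row B, j div dim_col B) * B $$ (i mod dim_row B, j mod dim_col B))"

fun kron_pow :: "complex mat \<Rightarrow> nat \<Rightarrow> complex mat" where
  "kron_pow A 0 = 1\<^sub>m 1"
| "kron_pow A (Suc t) = kron A (kron_pow A t)"

definition mexp :: "complex mat \<Rightarrow> complex mat" where
  "mexp A = mat (dim_row A) (dim_col A) (\<lambda>(i,j). (\<Sum>k. (A ^\<^sub>m k) $$ (i,j) / of_nat (fact k)))"

definition vnorm :: "complex vec \<Rightarrow> real" where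
  "vnorm v = sqrt (\<Sum>i<dim_vec v. (cmod (vec_index v i))\<^sup>2)"

definition op_norm :: "complex mat \<Rightarrow> real" where
  "op_norm A = Sup {vnorm (mult_mat_vec A v) | v. v \<in> carrier_vec (dim_col A) \<and> vnorm v \<le> 1}"

definition sigma_x :: "complex mat" where
  "sigma_x = mat_of_rows_list 2 [[0, 1], [1, 0]]"
definition sigma_y :: "complex mat" where
  "sigma_y = mat_of_rows_list 2 [[0, -\<i>], [\<i>, 0]]"
definition sigma_z :: "complex mat" where
  "sigma_z = mat_of_rows_list 2 [[1, 0], [0, -1]]"

definition pauli1 :: "nat \<Rightarrow> complex mat" where
  "pauli1 k = (if k = 0 then 1\<^sub>m 2 else if k = 1 then sigma_x else if k = 2 then sigma_y else sigma_z)"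

fun pauli_string :: "nat list \<Rightarrow> complex mat" where
  "pauli_string [] = 1\<^sub>m 1"
| "pauli_string (k # ks) = kron (pauli1 k) (pauli_string ks)"

definition Paulis :: "nat \<Rightarrow> complex mat set" where
  "Paulis n = {pauli_string ks | ks. length ks = n \<and> set ks \<subseteq> {0..<4}} - {1\<^sub>m (2^n)}"

text \<open>Borel sigma-algebra of SU(N) (subspace topology of C^(N x N)), generated by the
  preimages of open sets under the (continuous) entry maps.\<close>
definition SU_sets :: "nat \<Rightarrow> complex mat set set" where
  "SU_sets N = sigma_sets (SU N)
     {{U \<in> SU N. U $$ (i,j) \<in> B} | i j B. i < N \<and> j < N \<and> open B}"

definition haar_SU :: "nat \<Rightarrow> complex mat measure \<Rightarrow> bool" where
  "haar_SU N \<mu> \<longleftrightarrow> prob_space \<mu> \<and> space \<mu> = SU N \<and> sets \<mu> = SU_sets N \<and>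
     (\<forall>V \<in> SU N. \<forall>A \<in> sets \<mu>. emeasure \<mu> ((\<lambda>U. V * U) ` A) = emeasure \<mu> A)"

definition mat_expect :: "nat \<Rightarrow> 'a measure \<Rightarrow> ('a \<Rightarrow> complex mat) \<Rightarrow> complex mat" where
  "mat_expect d \<mu> f = mat d d (\<lambda>(i,j). integral\<^sup>L \<mu> (\<lambda>x. f x $$ (i,j)))"

definition theta_pauli_expect ::
    "nat \<Rightarrow> real \<Rightarrow> real \<Rightarrow> complex mat set \<Rightarrow> (real \<Rightarrow> complex mat \<Rightarrow> complex mat) \<Rightarrow> complex mat" where
  "theta_pauli_expect d a b S f = mat d d (\<lambda>(i,j).
     (1 / complex_of_real (b - a)) *
       integral {a..b} (\<lambda>\<theta>. (1 / of_nat (card S)) * (\<Sum>P\<in>S. f \<theta> P $$ (i,j))))"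

definition unitary_rep :: "nat \<Rightarrow> nat \<Rightarrow> (complex mat \<Rightarrow> complex mat) \<Rightarrow> bool" where
  "unitary_rep N d \<rho> \<longleftrightarrow>
     (\<forall>U \<in> SU N. unitary_mat d (\<rho> U)) \<and>
     (\<forall>U \<in> SU N. \<forall>V \<in> SU N. \<rho> (U * V) = \<rho> U * \<rho> V) \<and>
     (\<forall>U \<in> SU N. \<forall>e > 0. \<exists>\<delta> > 0. \<forall>V \<in> SU N.
        op_norm (U - V) < \<delta> \<longrightarrow> op_norm (\<rho> U - \<rho> V) < e)"

end

theory Submission
  imports Defs "Jordan_Normal_Form.Spectral_Radius"
begin

text \<open>
  Let \<open>\<rho>\<close> be a unitary representation, let \<open>X\<^sub>P\<close> be the derivative at \<open>0\<close> of
  \<open>\<theta> \<mapsto> \<rho> (exp (\<i> \<theta> P / 2))\<close>, and let \<open>C = - (\<Sum>P. X\<^sub>P\<^sup>2)\<close>. Averaging \<open>\<theta>\<close> over a full period gives the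
  projection \<open>\<Pi>\<^sub>P\<close> onto the kernel of \<open>X\<^sub>P\<close>, and the Haar average is the projection onto the kernel
  of \<open>C\<close>, because products of Pauli rotations are dense in \<open>SU(N)\<close> (Trotter formula). The operator
  \<open>C\<close> commutes with every \<open>X\<^sub>P\<close>. If \<open>g |X\<^sub>P v|\<^sup>2 \<le> \<langle>C v, v\<rangle>\<close> for all \<open>P\<close> and \<open>v\<close>, then on each eigenspace
  of \<open>C\<close> with a positive eigenvalue \<open>(\<Sum>P. 1 - \<Pi>\<^sub>P) \<ge> g\<close>, so the norm in question is at most
  \<open>1 - g / (4\<^sup>n - 1)\<close>. For every representation \<open>g = 1\<close> works, since \<open>C \<ge> - X\<^sub>P\<^sup>2\<close>. For the tensor power,
  the Paulis that anticommute with \<open>P\<close> come in pairs that form \<open>su(2)\<close> triples with \<open>P\<close>; hence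
  \<open>C \<ge> k\<^sup>2 + 4\<^sup>n |k| / 4\<close> on the eigenvectors of \<open>X\<^sub>P\<close> with eigenvalue \<open>\<i> k\<close>, and \<open>|k| \<le> t\<close>, so that
  \<open>g = 1 + 4\<^sup>n / (4 t)\<close> works.
\<close>

text \<open>A representation is only assumed to be continuous on the group, so everything
  infinitesimal has to be produced first. Differentiability of the rotation subgroups comes from
  integrating them over a short interval. The commutation relations come from writing a conjugated
  rotation as a product of three rotations (Euler angles), applying \<rho> to this identity inside
  the group, and differentiating. So only derivatives along Pauli operators and their negatives ever
  occur.

  The interval (-pi, pi) is a full period for the tensor power because the rotations by pi and -pi
  differ by a sign, which cancels between U and its conjugate; a general representation needs (-2
  pi, 2 pi). The bound |k| \<le> t holds since the entries of the rotated tensor power are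
  trigonometric polynomials of degree at most t. With K for the number of Pauli operators, at least
  (K + 1) / 2 of them anticommute with a given P, and g = 1 + (K + 1) / (4 t) gives g / K \<ge> 1 /
  K + 1 / (4 t), which yields the stated bound as K \<le> 4^n - 1.\<close>

unbundle no vec_syntax

section \<open>Complex matrices and the spectral theorem\<close>

lemma square_mult_carrier [simp]:
  "A \<in> carrier_mat d d \<Longrightarrow> B \<in> carrier_mat d d \<Longrightarrow> A * B \<in> carrier_mat d d"
  by simp

lemma square_mult_vec_carrier [simp]:
  "A \<in> carrier_mat d d \<Longrightarrow> v \<in> carrier_vec d \<Longrightarrow> A *\<^sub>v v \<in> carrier_vec d"
  by simp

text \<open>Conjugate-linear in the second argument. The range of summation is read off
  \<open>w\<close> alone, so the rules below fix a common dimension by carrier hypotheses.\<close>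

definition ip :: "complex vec \<Rightarrow> complex vec \<Rightarrow> complex" where
  "ip v w = (\<Sum>i<dim_vec w. v $ i * cnj (w $ i))"

lemma ip_add_left:
  "\<lbrakk>u \<in> carrier_vec d; v \<in> carrier_vec d; w \<in> carrier_vec d\<rbrakk> \<Longrightarrow> ip (u + v) w = ip u w + ip v w"
  by (auto simp: ip_def sum.distrib distrib_left distrib_right)

lemma ip_smult_left: "\<lbrakk>v \<in> carrier_vec d; w \<in> carrier_vec d\<rbrakk> \<Longrightarrow> ip (c \<cdot>\<^sub>v v) w = c * ip v w"
  by (auto simp: ip_def sum_distrib_left ac_simps)

lemma ip_commute: "\<lbrakk>v \<in> carrier_vec d; w \<in> carrier_vec d\<rbrakk> \<Longrightarrow> ip w v = cnj (ip v w)"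
  by (auto simp: ip_def ac_simps)

lemma ip_add_right:
  "\<lbrakk>u \<in> carrier_vec d; v \<in> carrier_vec d; w \<in> carrier_vec d\<rbrakk> \<Longrightarrow> ip w (u + v) = ip w u + ip w v"
  by (auto simp: ip_def sum.distrib distrib_left distrib_right)

lemma ip_smult_right: "\<lbrakk>v \<in> carrier_vec d; w \<in> carrier_vec d\<rbrakk> \<Longrightarrow> ip w (c \<cdot>\<^sub>v v) = cnj c * ip w v"
  by (auto simp: ip_def sum_distrib_left ac_simps)

lemma ip_diff_left:
  "\<lbrakk>u \<in> carrier_vec d; v \<in> carrier_vec d; w \<in> carrier_vec d\<rbrakk> \<Longrightarrow> ip (u - v) w = ip u w - ip v w"
  by (auto simp: ip_def sum_subtractf left_diff_distrib right_diff_distrib)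

lemma ip_diff_right:
  "\<lbrakk>u \<in> carrier_vec d; v \<in> carrier_vec d; w \<in> carrier_vec d\<rbrakk> \<Longrightarrow> ip w (u - v) = ip w u - ip w v"
  by (auto simp: ip_def sum_subtractf left_diff_distrib right_diff_distrib)

lemma ip_zero_left [simp]: "w \<in> carrier_vec d \<Longrightarrow> ip (0\<^sub>v d) w = 0"
  by (auto simp: ip_def)

lemma vnorm_nonneg [simp]: "vnorm v \<ge> 0"
  by (simp add: vnorm_def sum_nonneg)

lemma vnorm_sq: "(vnorm v)\<^sup>2 = (\<Sum>i<dim_vec v. (cmod (v $ i))\<^sup>2)"
  by (simp add: vnorm_def sum_nonneg)

lemma ip_self: "ip v v = complex_of_real ((vnorm v)\<^sup>2)"
  by (simp only: ip_def vnorm_sq of_real_sum complex_norm_square)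

lemma vnorm_zero [simp]: "vnorm (0\<^sub>v d) = 0"
  by (simp add: vnorm_def)

lemma vnorm_eq_0_iff: "vnorm v = 0 \<longleftrightarrow> v = 0\<^sub>v (dim_vec v)"
proof
  assume "vnorm v = 0"
  then have "(\<Sum>i<dim_vec v. (cmod (v $ i))\<^sup>2) = 0"
    using vnorm_sq[of v] by simp
  then have "\<forall>i<dim_vec v. v $ i = 0"
    by (subst (asm) sum_nonneg_eq_0_iff) auto
  then show "v = 0\<^sub>v (dim_vec v)" by auto
qed (metis vnorm_zero)

lemma vnorm_unit_vec: "j < d \<Longrightarrow> vnorm (unit_vec d j) = 1"
  by (simp add: vnorm_def if_distrib[of cmod] if_distrib[of "\<lambda>x. x\<^sup>2"] sum.delta' cong: if_cong)

lemma vnorm_L2: "vnorm v = L2_set (\<lambda>i. cmod (v $ i)) {..<dim_vec v}"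
  by (simp add: vnorm_def L2_set_def)

lemma vnorm_smult: "vnorm (c \<cdot>\<^sub>v v) = cmod c * vnorm v"
  by (simp add: vnorm_def norm_mult power_mult_distrib sum_distrib_left[symmetric] real_sqrt_mult)

lemma vnorm_triangle:
  assumes "v \<in> carrier_vec d" "w \<in> carrier_vec d"
  shows "vnorm (v + w) \<le> vnorm v + vnorm w"
proof -
  have "vnorm (v + w) \<le> L2_set (\<lambda>i. cmod (v $ i) + cmod (w $ i)) {..<d}"
    using assms unfolding vnorm_L2 by (auto intro!: L2_set_mono simp: norm_triangle_ineq)
  also have "\<dots> \<le> vnorm v + vnorm w"
    using assms unfolding vnorm_L2 by (auto intro!: L2_set_triangle_ineq)
  finally show ?thesis .
qed

lemma cmod_index_le_vnorm: "i < dim_vec v \<Longrightarrow> cmod (v $ i) \<le> vnorm v"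
  unfolding vnorm_L2 by (rule member_le_L2_set) auto

section \<open>Adjoints and unitary matrices\<close>

lemma madj_carrier [simp]: "A \<in> carrier_mat m n \<Longrightarrow> madj A \<in> carrier_mat n m"
  by (simp add: madj_def mconj_def)

lemma madj_index [simp]: "i < dim_col A \<Longrightarrow> j < dim_row A \<Longrightarrow> madj A $$ (i,j) = cnj (A $$ (j,i))"
  by (simp add: madj_def mconj_def)

lemma madj_dim [simp]: "dim_row (madj A) = dim_col A" "dim_col (madj A) = dim_row A"
  by (simp_all add: madj_def mconj_def)

lemma madj_madj [simp]: "madj (madj A) = A"
  by (auto intro!: eq_matI)

lemma madj_mult:
  assumes "A \<in> carrier_mat a b" "B \<in> carrier_mat b c"
  shows "madj (A * B) = madj B * madj A"
  using assms by (auto intro!: eq_matI sum.cong simp: scalar_prod_def mult.commute)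

lemma madj_one [simp]: "madj (1\<^sub>m d) = 1\<^sub>m d"
  by (auto intro!: eq_matI)

lemma madj_smult: "madj (c \<cdot>\<^sub>m A) = cnj c \<cdot>\<^sub>m madj A"
  by (auto intro!: eq_matI)

lemma madj_add: "A \<in> carrier_mat a b \<Longrightarrow> B \<in> carrier_mat a b \<Longrightarrow> madj (A + B) = madj A + madj B"
  by (auto intro!: eq_matI)

lemma ip_madj:
  assumes "A \<in> carrier_mat a b" "v \<in> carrier_vec b" "w \<in> carrier_vec a"
  shows "ip (A *\<^sub>v v) w = ip v (madj A *\<^sub>v w)"
proof -
  have "ip (A *\<^sub>v v) w = (\<Sum>i<a. \<Sum>j<b. A $$ (i,j) * v $ j * cnj (w $ i))"
    using assms by (auto simp: ip_def scalar_prod_def sum_distrib_right atLeast0LessThan intro!: sum.cong)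
  also have "\<dots> = (\<Sum>j<b. \<Sum>i<a. A $$ (i,j) * v $ j * cnj (w $ i))"
    by (rule sum.swap)
  also have "\<dots> = ip v (madj A *\<^sub>v w)"
    using assms by (auto simp: ip_def scalar_prod_def sum_distrib_left atLeast0LessThan ac_simps intro!: sum.cong)
  finally show ?thesis .
qed

lemma unitary_matD:
  assumes "unitary_mat d U"
  shows "U \<in> carrier_mat d d" "madj U \<in> carrier_mat d d" "U * madj U = 1\<^sub>m d" "madj U * U = 1\<^sub>m d"
  using assms by (auto simp: unitary_mat_def)

lemma unitary_mat_one: "unitary_mat d (1\<^sub>m d)"
  by (simp add: unitary_mat_def)

lemma unitary_mat_madj: "unitary_mat d U \<Longrightarrow> unitary_mat d (madj U)"
  by (auto simp: unitary_mat_def)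

text \<open>Serves to multiply conjugates such as \<open>W * X * madj W\<close> and
  \<open>W * Y * madj W\<close>, where the inner unitaries cancel.\<close>

lemma mult_cancel_mid:
  fixes A :: "complex mat"
  assumes "A \<in> carrier_mat a d" "B \<in> carrier_mat d d" "C \<in> carrier_mat d d" "D \<in> carrier_mat d b"
    and "B * C = 1\<^sub>m d"
  shows "(A * B) * (C * D) = A * D"
proof -
  have "(A * B) * (C * D) = A * ((B * C) * D)"
    using assms(1-4) by (simp add: assoc_mult_mat[of _ _ d _ d _ b] assoc_mult_mat[of _ _ d _ d _ d])
  then show ?thesis by (simp only: assms(5) left_mult_one_mat[OF assms(4)])
qed

lemma unitary_mat_mult:
  assumes "unitary_mat d U" "unitary_mat d V"
  shows "unitary_mat d (U * V)"
  using assms mult_cancel_mid[of U d d V "madj V" "madj U" d]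
    mult_cancel_mid[of "madj V" d d "madj U" U V d]
  by (auto simp: unitary_mat_def madj_mult[of U d d V d])

lemma unitary_ip:
  assumes "unitary_mat d U" "v \<in> carrier_vec d" "w \<in> carrier_vec d"
  shows "ip (U *\<^sub>v v) (U *\<^sub>v w) = ip v w"
proof -
  have "madj U *\<^sub>v (U *\<^sub>v w) = w"
    using assms unitary_matD[OF assms(1)] by (metis assoc_mult_mat_vec one_mult_mat_vec)
  then show ?thesis
    using ip_madj[of U d d v "U *\<^sub>v w"] assms unitary_matD[OF assms(1)] by simp
qed

lemma unitary_vnorm:
  assumes "unitary_mat d U" "v \<in> carrier_vec d"
  shows "vnorm (U *\<^sub>v v) = vnorm v"
proof -
  have "complex_of_real ((vnorm (U *\<^sub>v v))\<^sup>2) = of_real ((vnorm v)\<^sup>2)"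
    using unitary_ip[OF assms assms(2)] by (simp only: ip_self)
  then show ?thesis by (simp only: of_real_eq_iff power2_eq_iff_nonneg[OF vnorm_nonneg vnorm_nonneg])
qed

text \<open>The reflection in the hyperplane orthogonal to \<open>w - e_0\<close>, with
  \<open>e_0\<close> the first unit vector, maps \<open>e_0\<close> to \<open>w\<close>. A Hermitian
  matrix has a real entry at \<open>(0,0)\<close>, hence the condition on \<open>w $ 0\<close>.
  Being Hermitian and unitary, \<open>H\<close> is its own inverse.\<close>

lemma householder:
  fixes w :: "complex vec"
  assumes w: "w \<in> carrier_vec (Suc m)" and nw: "vnorm w = 1" and im: "Im (w $ 0) = 0"
  shows "\<exists>H. unitary_mat (Suc m) H \<and> madj H = H \<and> (\<forall>i<Suc m. H $$ (i,0) = w $ i)"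
proof -
  let ?n = "Suc m"
  define u where "u i = w $ i - (if i = 0 then 1 else 0)" for i
  define s where "s = (\<Sum>i<?n. u i * cnj (u i))"
  have w0: "cnj (w $ 0) = w $ 0" using im by (simp add: complex_eq_iff)
  have one: "(\<Sum>i<?n. w $ i * cnj (w $ i)) = 1"
    using ip_self[of w] nw w by (simp add: ip_def)
  have s: "s = 2 - 2 * w $ 0"
    using one w0 unfolding s_def u_def sum.lessThan_Suc_shift by (simp add: algebra_simps)
  show ?thesis
  proof (cases "s = 0")
    \<comment> \<open>Here \<open>w\<close> is the first unit vector and the reflection degenerates
      to the identity.\<close>
    case True
    then have "(\<Sum>i<?n. (cmod (u i))\<^sup>2) = 0"
      unfolding s_def complex_norm_square[symmetric] of_real_sum[symmetric] by (simp only: of_real_eq_0_iff)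
    then have "\<forall>i<?n. u i = 0"
      by (subst (asm) sum_nonneg_eq_0_iff) auto
    then show ?thesis
      by (intro exI[of _ "1\<^sub>m ?n"]) (auto simp: unitary_mat_one u_def)
  next
    case False
    define c where "c = 2 / s"
    have cs: "c * s = 2" using False by (simp add: c_def)
    have sc: "cnj s = s" using w0 by (simp add: s)
    have cc: "cnj c = c" using sc by (simp add: c_def)
    define H where "H = mat ?n ?n (\<lambda>(i,j). (if i = j then 1 else 0) - c * u i * cnj (u j))"
    have Hc: "H \<in> carrier_mat ?n ?n" by (simp add: H_def)
    have Hadj: "madj H = H"
      by (rule eq_matI) (auto simp: H_def cc)
    have "H * H = 1\<^sub>m ?n"
    proof (rule eq_matI)
      fix i j assume "i < dim_row (1\<^sub>m ?n)" "j < dim_col (1\<^sub>m ?n)"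
      then have ij: "i < ?n" "j < ?n" by auto
      have "(H * H) $$ (i,j) = (\<Sum>k<?n. ((if i = k then 1 else 0) - c * u i * cnj (u k)) * ((if k = j then 1 else 0) - c * u k * cnj (u j)))"
        using ij by (simp add: H_def scalar_prod_def atLeast0LessThan del: sum.lessThan_Suc)
      also have "\<dots> = (\<Sum>k<?n. (if i = k then (if k = j then 1 else 0) else 0)) - (\<Sum>k<?n. if k = j then c * u i * cnj (u k) else 0)
           - (\<Sum>k<?n. if i = k then c * u k * cnj (u j) else 0) + (\<Sum>k<?n. c * c * u i * cnj (u j) * (u k * cnj (u k)))"
        unfolding sum.distrib[symmetric] sum_subtractf[symmetric]
        by (rule sum.cong) (auto simp: algebra_simps)
      also have "\<dots> = (if i = j then 1 else 0) - c * u i * cnj (u j) - c * u i * cnj (u j) + c * (c * s) * u i * cnj (u j)"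
        using ij by (simp add: sum_distrib_left[symmetric] s_def[symmetric] sum.delta del: sum.lessThan_Suc)
      also have "\<dots> = (if i = j then 1 else 0)" by (simp add: cs)
      finally show "(H * H) $$ (i,j) = 1\<^sub>m ?n $$ (i,j)" using ij by simp
    qed (auto simp: H_def)
    moreover have "H $$ (i,0) = w $ i" if "i < ?n" for i
    proof -
      \<comment> \<open>Since \<open>s = - 2 * (w $ 0 - 1)\<close>, the rank-one term
        \<open>c * u i * cnj (u 0)\<close> of the first column is just \<open>- u i\<close>.\<close>
      have "c * (w $ 0 - 1) = -1" using arg_cong[OF cs, of "\<lambda>x. x / 2"] unfolding s by (simp add: algebra_simps diff_divide_distrib)
      moreover have "cnj (u 0) = w $ 0 - 1" using w0 by (simp add: u_def)
      ultimately have "c * u i * cnj (u 0) = u i * -1" by (metis mult.assoc mult.commute)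
      then have "c * u i * cnj (u 0) = - u i" by simp
      then show ?thesis using that by (simp add: H_def) (simp add: u_def)
    qed
    ultimately show ?thesis
      using Hc Hadj by (intro exI[of _ H]) (simp add: unitary_mat_def)
  qed
qed

text \<open>Dividing an eigenvector by its norm and by the phase of its first entry brings it into
  the form that \<open>householder\<close> requires.\<close>

lemma eigenvector_real_first:
  fixes A :: "complex mat"
  assumes A: "A \<in> carrier_mat (Suc m) (Suc m)"
  shows "\<exists>w e. w \<in> carrier_vec (Suc m) \<and> vnorm w = 1 \<and> Im (w $ 0) = 0 \<and> A *\<^sub>v w = e \<cdot>\<^sub>v w"
proof -
  obtain e where "eigenvalue A e"
    using spectrum_non_empty[OF A] by (auto simp: spectrum_def)
  then obtain v where v: "v \<in> carrier_vec (Suc m)" "v \<noteq> 0\<^sub>v (Suc m)" "A *\<^sub>v v = e \<cdot>\<^sub>v v"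
    using A by (auto simp: eigenvalue_def eigenvector_def)
  have nv: "vnorm v \<noteq> 0" using v vnorm_eq_0_iff[of v] by auto
  define c where "c = (if v $ 0 = 0 then 1 else cnj (sgn (v $ 0))) / vnorm v"
  have "cmod c = 1 / vnorm v"
    by (auto simp: c_def norm_divide norm_sgn)
  then have "vnorm (c \<cdot>\<^sub>v v) = 1" using nv by (simp add: vnorm_smult)
  moreover have "Im ((c \<cdot>\<^sub>v v) $ 0) = 0"
  proof -
    have "cnj (sgn z) * z = of_real (cmod z)" for z
    proof (cases "z = 0")
      case False
      then show ?thesis
        using complex_norm_square[of z] by (simp add: sgn_eq field_simps power2_eq_square)
    qed auto
    then show ?thesis using v by (auto simp: c_def)
  qed
  moreover have "A *\<^sub>v (c \<cdot>\<^sub>v v) = e \<cdot>\<^sub>v (c \<cdot>\<^sub>v v)"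
    using v A by (simp add: mult_mat_vec smult_smult_assoc mult.commute)
  ultimately show ?thesis using v by (intro exI[of _ "c \<cdot>\<^sub>v v"] exI[of _ e]) auto
qed

text \<open>Deflation: conjugation with a reflection that maps the first unit vector to an
  eigenvector makes the first column of the matrix diagonal. Normality then clears the first row as
  well, and the remaining block is again normal.\<close>

theorem spectral_theorem_normal:
  fixes A :: "complex mat"
  assumes "A \<in> carrier_mat d d" "A * madj A = madj A * A"
  shows "\<exists>W f. unitary_mat d W \<and> A = W * mat_diag d f * madj W"
  using assms
proof (induction d arbitrary: A)
  case 0
  then show ?case
    by (intro exI[of _ "1\<^sub>m 0"] exI[of _ "\<lambda>_. 0"] conjI unitary_mat_one eq_matI) auto
next
  case (Suc m A)
  let ?n = "Suc m"
  note A = Suc.prems(1)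
  obtain w e where w: "w \<in> carrier_vec ?n" "vnorm w = 1" "Im (w $ 0) = 0" "A *\<^sub>v w = e \<cdot>\<^sub>v w"
    using eigenvector_real_first[OF A] by blast
  obtain H where H: "unitary_mat ?n H" "madj H = H" "\<And>i. i < ?n \<Longrightarrow> H $$ (i,0) = w $ i"
    using householder[OF w(1-3)] by blast
  have Hc: "H \<in> carrier_mat ?n ?n" and HH: "H * H = 1\<^sub>m ?n"
    using unitary_matD[OF H(1)] H(2) by auto
  define B where "B = H * A * H"
  have Bc: "B \<in> carrier_mat ?n ?n" using Hc A by (auto simp: B_def)
  have Badj: "madj B = H * madj A * H"
    using Hc A H(2) by (simp add: B_def madj_mult[of _ ?n ?n _ ?n] assoc_mult_mat[of _ ?n ?n _ ?n _ ?n])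
  have mid: "(H * X * H) * (H * Y * H) = H * (X * Y) * H"
    if "X \<in> carrier_mat ?n ?n" "Y \<in> carrier_mat ?n ?n" for X Y
    using mult_cancel_mid[of "H * X" ?n ?n H H "Y * H" ?n] that Hc HH
    by (simp add: assoc_mult_mat[of _ ?n ?n _ ?n _ ?n])
  have Bn: "B * madj B = madj B * B"
    unfolding Badj using mid[of A "madj A"] mid[of "madj A" A] A Suc.prems(2) by (simp add: B_def)
  have colH: "col H 0 = w" using H(3) Hc w(1) by (auto intro!: eq_vecI)
  have "H *\<^sub>v w = col (H * H) 0" using col_mult2[OF Hc Hc, of 0] colH by simp
  then have Hw: "H *\<^sub>v w = unit_vec ?n 0" using HH by simp
  have "col B 0 = (H * A) *\<^sub>v w"
    unfolding B_def using col_mult2[of "H * A" ?n ?n H ?n 0] Hc A colH by auto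
  also have "\<dots> = e \<cdot>\<^sub>v unit_vec ?n 0"
    using assoc_mult_mat_vec[OF Hc A w(1)] w Hc by (simp add: mult_mat_vec Hw)
  finally have col: "col B 0 = e \<cdot>\<^sub>v unit_vec ?n 0" .
  have Bi0: "B $$ (i,0) = (if i = 0 then e else 0)" if "i < ?n" for i
    using arg_cong[OF col, of "\<lambda>v. v $ i"] that Bc by auto
  \<comment> \<open>By normality the first row and the first column of \<open>B\<close> have the
    same norm. The column contains only \<open>e\<close>, so the rest of the row vanishes.\<close>
  have "(B * madj B) $$ (0,0) = (madj B * B) $$ (0,0)" using Bn by simp
  then have "(\<Sum>j<?n. B $$ (0,j) * cnj (B $$ (0,j))) = (\<Sum>j<?n. cnj (B $$ (j,0)) * B $$ (j,0))"
    using Bc by (simp add: scalar_prod_def atLeast0LessThan del: sum.lessThan_Suc)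
  then have "(\<Sum>j<m. B $$ (0,Suc j) * cnj (B $$ (0,Suc j))) = 0"
    using Bi0 by (simp add: sum.lessThan_Suc_shift del: sum.lessThan_Suc)
  then have "(\<Sum>j<m. (cmod (B $$ (0,Suc j)))\<^sup>2) = 0"
    unfolding complex_norm_square[symmetric] of_real_sum[symmetric] by (simp only: of_real_eq_0_iff)
  then have "\<forall>j<m. B $$ (0, Suc j) = 0"
    by (subst (asm) sum_nonneg_eq_0_iff) auto
  then have B0j: "B $$ (0,j) = (if j = 0 then e else 0)" if "j < ?n" for j
    using that Bi0[of 0] by (cases j) auto
  define B' where "B' = mat m m (\<lambda>(i,j). B $$ (Suc i, Suc j))"
  have B'c: "B' \<in> carrier_mat m m" by (simp add: B'_def)
  have "B' * madj B' = madj B' * B'"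
  proof (rule eq_matI)
    fix i j assume "i < dim_row (madj B' * B')" "j < dim_col (madj B' * B')"
    then have ij: "i < m" "j < m" using B'c by auto
    have "(B * madj B) $$ (Suc i, Suc j) = (madj B * B) $$ (Suc i, Suc j)" using Bn by simp
    then have "(\<Sum>k<?n. B $$ (Suc i,k) * cnj (B $$ (Suc j,k))) = (\<Sum>k<?n. cnj (B $$ (k,Suc i)) * B $$ (k,Suc j))"
      using Bc ij by (simp add: scalar_prod_def atLeast0LessThan del: sum.lessThan_Suc)
    then have "(\<Sum>k<m. B $$ (Suc i,Suc k) * cnj (B $$ (Suc j,Suc k))) = (\<Sum>k<m. cnj (B $$ (Suc k,Suc i)) * B $$ (Suc k,Suc j))"
      using Bi0 B0j ij by (simp add: sum.lessThan_Suc_shift del: sum.lessThan_Suc)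
    then show "(B' * madj B') $$ (i,j) = (madj B' * B') $$ (i,j)"
      using ij by (simp add: B'_def scalar_prod_def atLeast0LessThan)
  qed (use B'c in auto)
  then obtain W' f where W': "unitary_mat m W'" "B' = W' * mat_diag m f * madj W'"
    using Suc.IH[OF B'c] by blast
  note W'c = unitary_matD[OF W'(1)]
  define W1 where "W1 = four_block_mat (1\<^sub>m 1) (0\<^sub>m 1 m) (0\<^sub>m m 1) W'"
  define f' where "f' j = (case j of 0 \<Rightarrow> e | Suc k \<Rightarrow> f k)" for j
  have W1c: "W1 \<in> carrier_mat ?n ?n" 
    unfolding W1_def using four_block_carrier_mat[of "1\<^sub>m 1" 1 1 W' m m] W'c by auto
  have W1a: "madj W1 = four_block_mat (1\<^sub>m 1) (0\<^sub>m 1 m) (0\<^sub>m m 1) (madj W')"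
    unfolding W1_def using W'c by (intro eq_matI) auto
  have D: "mat_diag ?n f' = four_block_mat (e \<cdot>\<^sub>m 1\<^sub>m 1) (0\<^sub>m 1 m) (0\<^sub>m m 1) (mat_diag m f)"
    by (intro eq_matI) (auto simp: mat_diag_def f'_def split: nat.splits)
  have Bb: "B = four_block_mat (e \<cdot>\<^sub>m 1\<^sub>m 1) (0\<^sub>m 1 m) (0\<^sub>m m 1) B'"
    using Bc Bi0 B0j by (intro eq_matI) (auto simp: B'_def)
  have mm: "four_block_mat X (0\<^sub>m 1 m) (0\<^sub>m m 1) Y * four_block_mat X' (0\<^sub>m 1 m) (0\<^sub>m m 1) Y'
      = four_block_mat (X * X') (0\<^sub>m 1 m) (0\<^sub>m m 1) (Y * Y')"
    if "X \<in> carrier_mat 1 1" "X' \<in> carrier_mat 1 1" "Y \<in> carrier_mat m m" "Y' \<in> carrier_mat m m" for X X' Y Y'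
    using that by (subst mult_four_block_mat[of _ 1 1 _ m _ m _ _ 1 _ m]) auto
  have W1u: "unitary_mat ?n W1"
    unfolding unitary_mat_def W1a using W1c W'c(3,4)
    unfolding W1_def mm[OF one_carrier_mat one_carrier_mat W'c(1,2)] mm[OF one_carrier_mat one_carrier_mat W'c(2,1)]
    by (simp add: four_block_one_mat)
  have BW: "B = W1 * mat_diag ?n f' * madj W1"
    unfolding W1a D unfolding W1_def Bb W'(2) using W'c
    by (subst mm, simp, simp, simp, simp) (subst mm, auto)
  define W where "W = H * W1"
  have "A = H * B * H"
  proof -
    have "H * B * H = (H * H) * A * (H * H)"
      using Hc A by (simp add: B_def assoc_mult_mat[of _ ?n ?n _ ?n _ ?n])
    then show ?thesis using HH A by simp
  qed
  also have "\<dots> = W * mat_diag ?n f' * madj W"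
    unfolding W_def BW using Hc W1c H(2) mat_diag_dim[of ?n f']
    by (simp add: madj_mult[of _ ?n ?n _ ?n] assoc_mult_mat[of _ ?n ?n _ ?n _ ?n])
  finally show ?case
    using unitary_mat_mult[OF H(1) W1u] by (auto simp: W_def)
qed

text \<open>\<open>E c\<close> is given for every complex \<open>c\<close>, so \<open>E 0\<close>
  can be used whether or not \<open>0\<close> is an eigenvalue. \<open>proj_commute\<close> stands
  for the fact that the spectral projections are polynomials in \<open>A\<close>: they commute with
  whatever commutes with \<open>A\<close>.\<close>

locale spectral_resolution =
  fixes d :: nat and A :: "complex mat" and E :: "complex \<Rightarrow> complex mat" and \<Lambda> :: "complex set"
  assumes A_carrier [simp]: "A \<in> carrier_mat d d"
    and finite_values [simp]: "finite \<Lambda>"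
    and proj_carrier [simp]: "E c \<in> carrier_mat d d"
    and proj_madj [simp]: "madj (E c) = E c"
    and proj_eigen: "v \<in> carrier_vec d \<Longrightarrow> A *\<^sub>v (E c *\<^sub>v v) = c \<cdot>\<^sub>v (E c *\<^sub>v v)"
    and proj_proj: "v \<in> carrier_vec d \<Longrightarrow> E c *\<^sub>v (E e *\<^sub>v v) = (if c = e then E c *\<^sub>v v else 0\<^sub>v d)"
    and proj_sum: "v \<in> carrier_vec d \<Longrightarrow> i < d \<Longrightarrow> v $ i = (\<Sum>c\<in>\<Lambda>. (E c *\<^sub>v v) $ i)"
    and proj_commute: "B \<in> carrier_mat d d \<Longrightarrow> B * A = A * B \<Longrightarrow> B * E c = E c * B"
begin

lemma proj_commute_vec:
  assumes "B \<in> carrier_mat d d" "B * A = A * B" "v \<in> carrier_vec d"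
  shows "E c *\<^sub>v (B *\<^sub>v v) = B *\<^sub>v (E c *\<^sub>v v)"
  using proj_commute[OF assms(1,2), of c] assms
  by (metis assoc_mult_mat_vec proj_carrier)

lemma ip_proj_left:
  assumes "v \<in> carrier_vec d" "w \<in> carrier_vec d"
  shows "ip (E c *\<^sub>v v) w = ip (E c *\<^sub>v v) (E c *\<^sub>v w)"
  using ip_madj[of "E c" d d "E c *\<^sub>v v" w] assms by (simp add: proj_proj)

lemma ip_decomp:
  assumes v: "v \<in> carrier_vec d" and w: "w \<in> carrier_vec d"
  shows "ip v w = (\<Sum>c\<in>\<Lambda>. ip (E c *\<^sub>v v) (E c *\<^sub>v w))"
proof -
  have "ip v w = (\<Sum>i<d. \<Sum>c\<in>\<Lambda>. (E c *\<^sub>v v) $ i * cnj (w $ i))"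
    unfolding ip_def using w proj_sum[OF v] by (auto simp: sum_distrib_right intro!: sum.cong)
  also have "\<dots> = (\<Sum>c\<in>\<Lambda>. ip (E c *\<^sub>v v) w)"
    using w by (subst sum.swap) (auto simp: ip_def)
  finally show ?thesis using ip_proj_left[OF v w] by simp
qed

lemma vnorm_decomp:
  assumes v: "v \<in> carrier_vec d"
  shows "(vnorm v)\<^sup>2 = (\<Sum>c\<in>\<Lambda>. (vnorm (E c *\<^sub>v v))\<^sup>2)"
proof -
  have "complex_of_real ((vnorm v)\<^sup>2) = of_real (\<Sum>c\<in>\<Lambda>. (vnorm (E c *\<^sub>v v))\<^sup>2)"
    using ip_decomp[OF v v] by (simp only: ip_self of_real_sum)
  then show ?thesis by (simp only: of_real_eq_iff)
qed

lemma proj_unique: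
  assumes v: "v \<in> carrier_vec d" and "\<And>c. c \<noteq> e \<Longrightarrow> E c *\<^sub>v v = 0\<^sub>v d"
  shows "E e *\<^sub>v v = v"
proof -
  let ?u = "v - E e *\<^sub>v v"
  have "E c *\<^sub>v ?u = 0\<^sub>v d" for c
    using assms by (cases "c = e") (auto simp: mult_minus_distrib_mat_vec[of _ d d] proj_proj)
  then have "vnorm ?u = 0" using vnorm_decomp[of ?u] v by simp
  then have "?u = 0\<^sub>v d" using v vnorm_eq_0_iff[of ?u] carrier_matD(1)[OF proj_carrier] by simp
  then show ?thesis using v by (auto simp: vec_eq_iff)
qed

end

theorem spectral_resolution_exists:
  fixes A :: "complex mat"
  assumes A: "A \<in> carrier_mat d d" "A * madj A = madj A * A"
  shows "\<exists>E \<Lambda>. spectral_resolution d A E \<Lambda>"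
proof -
  obtain W f where W: "unitary_mat d W" and AW: "A = W * mat_diag d f * madj W"
    using spectral_theorem_normal[OF A] by blast
  note Wc = unitary_matD[OF W]
  define J where "J c = mat_diag d (\<lambda>i. if f i = c then 1 else 0 :: complex)" for c
  define E where "E c = W * J c * madj W" for c
  have Jc: "J c \<in> carrier_mat d d" for c by (simp add: J_def)
  have Dc: "mat_diag d f \<in> carrier_mat d d" by simp
  have Ec: "E c \<in> carrier_mat d d" for c using Wc Jc by (simp add: E_def)
  have mid: "(W * X * madj W) * (W * Y * madj W) = W * (X * Y) * madj W"
    if "X \<in> carrier_mat d d" "Y \<in> carrier_mat d d" for X Y
    using mult_cancel_mid[of "W * X" d d "madj W" W "Y * madj W" d] that Wc
    by (simp add: assoc_mult_mat[of _ d d _ d _ d])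
  show ?thesis
  proof (intro exI[of _ E] exI[of _ "f ` {..<d}"], unfold_locales)
    show "A \<in> carrier_mat d d" by (rule A(1))
    show "finite (f ` {..<d})" by simp
    show "E c \<in> carrier_mat d d" for c by (rule Ec)
    have "madj (J c) = J c" for c by (rule eq_matI) (auto simp: J_def mat_diag_def)
    then show "madj (E c) = E c" for c
      using Wc Jc[of c] by (simp add: E_def madj_mult[of _ d d _ d] assoc_mult_mat[of _ d d _ d _ d])
    show "A *\<^sub>v (E c *\<^sub>v v) = c \<cdot>\<^sub>v (E c *\<^sub>v v)" if v: "v \<in> carrier_vec d" for c v
    proof -
      have "mat_diag d f * J c = c \<cdot>\<^sub>m J c"
        by (simp add: J_def) (auto intro!: eq_matI simp: mat_diag_def)
      then have "A * E c = c \<cdot>\<^sub>m E c"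
        unfolding AW E_def mid[OF Dc Jc]
        by (simp only: mult_smult_distrib[OF Wc(1) Jc] mult_smult_assoc_mat[OF square_mult_carrier[OF Wc(1) Jc] Wc(2)])
      moreover have "A *\<^sub>v (E c *\<^sub>v v) = (A * E c) *\<^sub>v v"
        using A(1) Ec v by (simp add: assoc_mult_mat_vec[of _ d d _ d])
      moreover have "(c \<cdot>\<^sub>m E c) *\<^sub>v v = c \<cdot>\<^sub>v (E c *\<^sub>v v)"
        using Ec[of c] v by (auto intro!: eq_vecI simp: scalar_prod_def sum_distrib_left mult.assoc)
      ultimately show ?thesis by simp
    qed
    show "E c *\<^sub>v (E e *\<^sub>v v) = (if c = e then E c *\<^sub>v v else 0\<^sub>v d)" if v: "v \<in> carrier_vec d" for c e v
    proof -
      have "J c * J e = (if c = e then J c else 0\<^sub>m d d)"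
        by (simp add: J_def) (auto intro!: eq_matI simp: mat_diag_def)
      then have "E c * E e = (if c = e then E c else 0\<^sub>m d d)"
        unfolding E_def mid[OF Jc Jc] using Wc by simp
      moreover have "E c *\<^sub>v (E e *\<^sub>v v) = (E c * E e) *\<^sub>v v"
        using Ec v by (simp add: assoc_mult_mat_vec[of _ d d _ d])
      moreover have "0\<^sub>m d d *\<^sub>v v = 0\<^sub>v d"
        using v by auto
      ultimately show ?thesis by simp
    qed
    show "v $ i = (\<Sum>c\<in>f ` {..<d}. (E c *\<^sub>v v) $ i)" if v: "v \<in> carrier_vec d" and i: "i < d" for v i
    proof -
      define u where "u = madj W *\<^sub>v v"
      have uc: "u \<in> carrier_vec d" using Wc v by (simp add: u_def)
      have Ev: "E c *\<^sub>v v = W *\<^sub>v (J c *\<^sub>v u)" for c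
        using Wc Jc v by (simp add: E_def u_def assoc_mult_mat_vec[of _ d d _ d])
      have Ju: "J c *\<^sub>v u = vec d (\<lambda>k. if f k = c then u $ k else 0)" for c
        using uc by (auto intro!: eq_vecI simp: J_def mat_diag_def scalar_prod_def sum.delta if_distrib[of "\<lambda>x. x * _"] cong: if_cong)
      have "(\<Sum>c\<in>f ` {..<d}. (E c *\<^sub>v v) $ i) = (\<Sum>c\<in>f ` {..<d}. \<Sum>k<d. if f k = c then W $$ (i,k) * u $ k else 0)"
        using i Wc by (auto simp: Ev Ju scalar_prod_def atLeast0LessThan intro!: sum.cong)
      also have "\<dots> = (\<Sum>k<d. \<Sum>c\<in>f ` {..<d}. if f k = c then W $$ (i,k) * u $ k else 0)"
        by (rule sum.swap)
      also have "\<dots> = (\<Sum>k<d. W $$ (i,k) * u $ k)"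
        by (intro sum.cong refl) (simp add: sum.delta)
      also have "\<dots> = (W *\<^sub>v u) $ i"
        using i Wc uc by (simp add: scalar_prod_def atLeast0LessThan)
      also have "W *\<^sub>v u = v"
        using Wc v unfolding u_def by (metis assoc_mult_mat_vec one_mult_mat_vec)
      finally show ?thesis by simp
    qed
    show "B * E c = E c * B" if B: "B \<in> carrier_mat d d" and BA: "B * A = A * B" for B c
    proof -
      \<comment> \<open>\<open>M\<close> is \<open>B\<close> in the eigenbasis. There, commuting
        with \<open>A\<close> says that entries between different eigenvalues vanish, and this is
        visibly enough for commuting with the indicator matrix \<open>J c\<close>.\<close>
      define M where "M = madj W * B * W"
      have Mc: "M \<in> carrier_mat d d" using Wc B by (simp add: M_def)
      have BM: "B = W * M * madj W"
      proof -
        have "W * M * madj W = (W * madj W) * B * (W * madj W)"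
          using Wc(1,2) B by (simp add: M_def assoc_mult_mat[of _ d d _ d _ d])
        also have "\<dots> = B" unfolding Wc(3) using B by simp
        finally show ?thesis by simp
      qed
      have inner: "X = Y" if "W * X * madj W = W * Y * madj W" "X \<in> carrier_mat d d" "Y \<in> carrier_mat d d" for X Y
      proof -
        have "madj W * (W * Z * madj W) * W = Z" if "Z \<in> carrier_mat d d" for Z
        proof -
          have "madj W * (W * Z * madj W) * W = (madj W * W) * Z * (madj W * W)"
            using Wc(1,2) that by (simp add: assoc_mult_mat[of _ d d _ d _ d])
          also have "\<dots> = Z" unfolding Wc(4) using that by simp
          finally show ?thesis .
        qed
        then show ?thesis using that by metis
      qed
      have "M * mat_diag d f = mat_diag d f * M"
        using BA mid[OF Mc Dc] mid[OF Dc Mc] Mc inner[of "M * mat_diag d f" "mat_diag d f * M"]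
        unfolding AW BM by auto
      then have *: "M $$ (i,j) * f j = f i * M $$ (i,j)" if "i < d" "j < d" for i j
        using that Mc by (metis (no_types, lifting) index_mat(1) mat_diag_mult_left mat_diag_mult_right case_prod_conv)
      then have *: "M $$ (i,j) = 0" if "i < d" "j < d" "f i \<noteq> f j" for i j
        using that by (metis mult.commute mult_cancel_left)
      have "M * J c = J c * M"
        using Mc *
        by (auto intro!: eq_matI simp: J_def mat_diag_mult_left[of _ d d] mat_diag_mult_right[of _ d d])
      then show ?thesis
        using mid[OF Mc Jc] mid[OF Jc Mc] by (simp add: BM E_def)
    qed
  qed
qed


section \<open>Hermitian forms and the operator norm\<close>

lemma madj_eqI:
  assumes "A \<in> carrier_mat d d" "B \<in> carrier_mat d d"
    and eq: "\<And>v w. v \<in> carrier_vec d \<Longrightarrow> w \<in> carrier_vec d \<Longrightarrow> ip (A *\<^sub>v v) w = ip v (B *\<^sub>v w)"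
  shows "madj A = B"
proof (rule eq_matI)
  fix i j assume "i < dim_row B" "j < dim_col B"
  then have ij: "i < d" "j < d" using assms by auto
  have "ip (A *\<^sub>v unit_vec d i) (unit_vec d j) = A $$ (j,i)"
    using assms(1) ij by (auto simp: ip_def if_distrib[of cnj] if_distrib[of "\<lambda>x. _ * x"] scalar_prod_right_unit sum.delta' cong: if_cong)
  moreover have "ip (unit_vec d i) (B *\<^sub>v unit_vec d j) = cnj (B $$ (i,j))"
    using assms(2) ij by (auto simp: ip_def if_distrib[of "\<lambda>x. x * _"] scalar_prod_right_unit sum.delta' cong: if_cong)
  ultimately have "cnj (A $$ (j,i)) = B $$ (i,j)"
    using eq[of "unit_vec d i" "unit_vec d j"] by (metis complex_cnj_cnj unit_vec_carrier)
  then show "madj A $$ (i,j) = B $$ (i,j)" using ij assms by simp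
qed (use assms in auto)

lemma vec_eqI_ip:
  assumes "v \<in> carrier_vec d" "v' \<in> carrier_vec d"
    and "\<And>w. w \<in> carrier_vec d \<Longrightarrow> ip v w = ip v' w"
  shows "v = v'"
proof -
  have "ip (v - v') (v - v') = 0"
    using assms by (simp add: ip_diff_left[of v d v'])
  then have "vnorm (v - v') = 0" by (simp only: ip_self of_real_eq_0_iff power_eq_0_iff)
  then have "v - v' = 0\<^sub>v d" using assms vnorm_eq_0_iff[of "v - v'"] by simp
  then show ?thesis using assms by (auto simp: vec_eq_iff)
qed

text \<open>Both the form and the norm are governed by the eigenvalues, which are real. The lower
  bound on the form excludes negative eigenvalues, whose modulus the upper bound would not
  control.\<close>

lemma hermitian_form_bound:
  assumes M: "M \<in> carrier_mat d d" and herm: "madj M = M"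
    and lower: "\<And>v. v \<in> carrier_vec d \<Longrightarrow> 0 \<le> Re (ip (M *\<^sub>v v) v)"
    and upper: "\<And>v. v \<in> carrier_vec d \<Longrightarrow> Re (ip (M *\<^sub>v v) v) \<le> r * (vnorm v)\<^sup>2"
    and r: "0 \<le> r" and v: "v \<in> carrier_vec d"
  shows "vnorm (M *\<^sub>v v) \<le> r * vnorm v"
proof -
  obtain E \<Lambda> where "spectral_resolution d M E \<Lambda>"
    using spectral_resolution_exists[OF M] herm by auto
  then interpret spectral_resolution d M E \<Lambda> .
  have le: "(vnorm (M *\<^sub>v x))\<^sup>2 \<le> r\<^sup>2 * (vnorm x)\<^sup>2" if "x = E c *\<^sub>v v" for c x
  proof (cases "vnorm x = 0")
    case True
    then show ?thesis using that v M proj_eigen[OF v] by (simp add: vnorm_smult)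
  next
    case False
    have x: "x \<in> carrier_vec d" and Mx: "M *\<^sub>v x = c \<cdot>\<^sub>v x"
      using that v proj_eigen[OF v] by auto
    have 1: "ip (M *\<^sub>v x) x = c * of_real ((vnorm x)\<^sup>2)"
      using x by (simp add: Mx ip_smult_left ip_self del: of_real_power)
    have "ip (M *\<^sub>v x) x = cnj c * of_real ((vnorm x)\<^sup>2)"
      using ip_madj[OF M x x] herm x by (simp add: Mx ip_smult_right ip_self del: of_real_power)
    then have "cnj c = c" using 1 False by auto
    then have c: "c = of_real (Re c)" by (simp add: complex_eq_iff)
    have "Re (ip (M *\<^sub>v x) x) = Re c * (vnorm x)\<^sup>2"
      unfolding 1 by simp
    then have "0 \<le> Re c * (vnorm x)\<^sup>2" "Re c * (vnorm x)\<^sup>2 \<le> r * (vnorm x)\<^sup>2"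
      using lower[OF x] upper[OF x] by auto
    then have "0 \<le> Re c" "Re c \<le> r"
      using False by (auto simp: zero_le_mult_iff)
    then have "cmod c \<le> r" by (subst c) simp
    then show ?thesis
      by (simp add: Mx vnorm_smult power_mult_distrib mult_right_mono power_mono)
  qed
  have "(vnorm (M *\<^sub>v v))\<^sup>2 = (\<Sum>c\<in>\<Lambda>. (vnorm (M *\<^sub>v (E c *\<^sub>v v)))\<^sup>2)"
    using vnorm_decomp[of "M *\<^sub>v v"] v M by (simp add: proj_commute_vec)
  also have "\<dots> \<le> (\<Sum>c\<in>\<Lambda>. r\<^sup>2 * (vnorm (E c *\<^sub>v v))\<^sup>2)"
    using le by (intro sum_mono) simp
  also have "\<dots> = (r * vnorm v)\<^sup>2"
    using vnorm_decomp[OF v] by (simp add: sum_distrib_left power_mult_distrib)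
  finally show ?thesis using r by (simp add: power2_le_iff_abs_le abs_mult)
qed

lemma op_norm_le:
  assumes "A \<in> carrier_mat m d" and "0 \<le> r"
    and "\<And>v. v \<in> carrier_vec d \<Longrightarrow> vnorm (A *\<^sub>v v) \<le> r * vnorm v"
  shows "op_norm A \<le> r"
  unfolding op_norm_def
proof (rule cSup_least)
  have "0\<^sub>v (dim_col A) \<in> carrier_vec (dim_col A) \<and> vnorm (0\<^sub>v (dim_col A)) \<le> 1" by simp
  then show "{vnorm (A *\<^sub>v v) |v. v \<in> carrier_vec (dim_col A) \<and> vnorm v \<le> 1} \<noteq> {}" by blast
next
  fix x assume "x \<in> {vnorm (A *\<^sub>v v) |v. v \<in> carrier_vec (dim_col A) \<and> vnorm v \<le> 1}"
  then obtain v where v: "v \<in> carrier_vec d" "vnorm v \<le> 1" "x = vnorm (A *\<^sub>v v)"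
    using assms(1) by auto
  have "r * vnorm v \<le> r * 1" using v assms(2) by (intro mult_left_mono) auto
  then show "x \<le> r" using assms(3)[OF v(1)] v by linarith
qed

lemma vnorm_le_sum: "vnorm v \<le> (\<Sum>i<dim_vec v. cmod (v $ i))"
  unfolding vnorm_L2 by (rule L2_set_le_sum) auto

lemma vnorm_mult_mat_vec_le:
  assumes A: "A \<in> carrier_mat m d" and v: "v \<in> carrier_vec d"
  shows "vnorm (A *\<^sub>v v) \<le> (\<Sum>i<m. \<Sum>j<d. cmod (A $$ (i,j))) * vnorm v"
proof -
  have "vnorm (A *\<^sub>v v) \<le> (\<Sum>i<m. cmod (\<Sum>j<d. A $$ (i,j) * v $ j))"
    using vnorm_le_sum[of "A *\<^sub>v v"] A v by (simp add: scalar_prod_def atLeast0LessThan)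
  also have "\<dots> \<le> (\<Sum>i<m. \<Sum>j<d. cmod (A $$ (i,j)) * vnorm v)"
  proof (rule sum_mono)
    fix i
    have "cmod (\<Sum>j<d. A $$ (i,j) * v $ j) \<le> (\<Sum>j<d. cmod (A $$ (i,j) * v $ j))"
      by (rule norm_sum)
    also have "\<dots> \<le> (\<Sum>j<d. cmod (A $$ (i,j)) * vnorm v)"
      using v by (auto intro!: sum_mono mult_left_mono cmod_index_le_vnorm simp: norm_mult)
    finally show "cmod (\<Sum>j<d. A $$ (i,j) * v $ j) \<le> (\<Sum>j<d. cmod (A $$ (i,j)) * vnorm v)" .
  qed
  finally show ?thesis by (simp add: sum_distrib_right)
qed

lemma op_norm_le_sum:
  assumes "A \<in> carrier_mat m d"
  shows "op_norm A \<le> (\<Sum>i<m. \<Sum>j<d. cmod (A $$ (i,j)))"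
  by (rule op_norm_le[OF assms _ vnorm_mult_mat_vec_le[OF assms]]) (auto intro!: sum_nonneg)

text \<open>\<open>op_norm\<close> is a \<open>Sup\<close>, so it bounds anything only after the set
  has been shown to be bounded above. Together with \<open>op_norm_le_sum\<close> this turns
  continuity with respect to \<open>op_norm\<close> into continuity of the entries, in which all the
  calculus is done.\<close>

lemma cmod_index_le_op_norm:
  assumes A: "A \<in> carrier_mat m d" and ij: "i < m" "j < d"
  shows "cmod (A $$ (i,j)) \<le> op_norm A"
proof -
  let ?S = "{vnorm (A *\<^sub>v v) |v. v \<in> carrier_vec (dim_col A) \<and> vnorm v \<le> 1}"
  let ?B = "\<Sum>i<m. \<Sum>j<d. cmod (A $$ (i,j))"
  have e: "vnorm (unit_vec d j :: complex vec) = 1"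
    using ij by (simp add: vnorm_unit_vec)
  have "bdd_above ?S"
  proof (rule bdd_aboveI[of _ ?B])
    fix x assume "x \<in> ?S"
    then obtain v where v: "v \<in> carrier_vec d" "vnorm v \<le> 1" "x = vnorm (A *\<^sub>v v)"
      using A by auto
    have "?B * vnorm v \<le> ?B * 1" using v by (intro mult_left_mono sum_nonneg) auto
    then show "x \<le> ?B" using vnorm_mult_mat_vec_le[OF A v(1)] v by linarith
  qed
  then have "vnorm (A *\<^sub>v unit_vec d j) \<le> op_norm A"
    unfolding op_norm_def using A e by (intro cSup_upper) auto
  moreover have "cmod ((A *\<^sub>v unit_vec d j) $ i) \<le> vnorm (A *\<^sub>v unit_vec d j)"
    using A ij by (intro cmod_index_le_vnorm) auto
  ultimately show ?thesis using A ij by (simp add: scalar_prod_right_unit)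
qed

section \<open>Averages of projections\<close>

lemma mult_mat_zero_vec: "(A :: complex mat) \<in> carrier_mat m d \<Longrightarrow> A *\<^sub>v 0\<^sub>v d = 0\<^sub>v m"
  by (auto simp: scalar_prod_def)

text \<open>
  On the spectral subspaces of the Casimir-like operator \<open>C\<close> with value \<open>c > 0\<close> the components
  \<open>w p = v - Pi p v\<close> satisfy \<open>c * (\<Sum>p. |w p|\<^sup>2) \<ge> g * (\<Sum>p. |X p (w p)|\<^sup>2) = g * (\<Sum>p. |X p v|\<^sup>2) = g * c * |v|\<^sup>2\<close>.
\<close>

lemma averaged_projections_bound:
  fixes X Pi :: "'p \<Rightarrow> complex mat" and C T M :: "complex mat"
  assumes fin: "finite S" and ne: "S \<noteq> {}"
    and X: "\<And>p. p \<in> S \<Longrightarrow> X p \<in> carrier_mat d d"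
    and Pi: "\<And>p. p \<in> S \<Longrightarrow> Pi p \<in> carrier_mat d d"
    and C: "C \<in> carrier_mat d d" and T: "T \<in> carrier_mat d d" and M: "M \<in> carrier_mat d d"
    and C_form: "\<And>v w. v \<in> carrier_vec d \<Longrightarrow> w \<in> carrier_vec d \<Longrightarrow>
        ip (C *\<^sub>v v) w = (\<Sum>p\<in>S. ip (X p *\<^sub>v v) (X p *\<^sub>v w))"
    and Pi_C: "\<And>p. p \<in> S \<Longrightarrow> Pi p * C = C * Pi p"
    and Pi_herm: "\<And>p. p \<in> S \<Longrightarrow> madj (Pi p) = Pi p"
    and Pi_idem: "\<And>p. p \<in> S \<Longrightarrow> Pi p * Pi p = Pi p"
    and X_Pi: "\<And>p. p \<in> S \<Longrightarrow> X p * Pi p = 0\<^sub>m d d"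
    and Pi_fix: "\<And>p v. p \<in> S \<Longrightarrow> v \<in> carrier_vec d \<Longrightarrow> X p *\<^sub>v v = 0\<^sub>v d \<Longrightarrow> Pi p *\<^sub>v v = v"
    and gap: "\<And>p v. p \<in> S \<Longrightarrow> v \<in> carrier_vec d \<Longrightarrow> g * (vnorm (X p *\<^sub>v v))\<^sup>2 \<le> Re (ip (C *\<^sub>v v) v)"
    and g: "g \<le> card S"
    and X_T: "\<And>p. p \<in> S \<Longrightarrow> X p * T = 0\<^sub>m d d"
    and T_fix: "\<And>v. v \<in> carrier_vec d \<Longrightarrow> (\<And>p. p \<in> S \<Longrightarrow> X p *\<^sub>v v = 0\<^sub>v d) \<Longrightarrow> madj T *\<^sub>v v = v"
    and M_def: "\<And>v w. v \<in> carrier_vec d \<Longrightarrow> w \<in> carrier_vec d \<Longrightarrow>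
        ip (M *\<^sub>v v) w = (\<Sum>p\<in>S. ip (Pi p *\<^sub>v v) w) / of_nat (card S) - ip (T *\<^sub>v v) w"
    and v: "v \<in> carrier_vec d"
  shows "vnorm (M *\<^sub>v v) \<le> (1 - g / card S) * vnorm v"
proof -
  define K where "K = real (card S)"
  have K: "K > 0" using fin ne by (simp add: K_def card_gt_0_iff)
  have Cherm: "madj C = C"
  proof (rule madj_eqI[OF C C])
    fix v w :: "complex vec" assume vw: "v \<in> carrier_vec d" "w \<in> carrier_vec d"
    have "ip v (C *\<^sub>v w) = cnj (ip (C *\<^sub>v w) v)"
      using vw C ip_commute[of "C *\<^sub>v w" d v] by simp
    also have "\<dots> = (\<Sum>p\<in>S. cnj (ip (X p *\<^sub>v w) (X p *\<^sub>v v)))"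
      using C_form[OF vw(2,1)] by simp
    also have "\<dots> = (\<Sum>p\<in>S. ip (X p *\<^sub>v v) (X p *\<^sub>v w))"
      using vw X by (intro sum.cong refl ip_commute[symmetric, of _ d]) auto
    finally show "ip (C *\<^sub>v v) w = ip v (C *\<^sub>v w)" using C_form[OF vw] by simp
  qed
  obtain E \<Lambda> where "spectral_resolution d C E \<Lambda>"
    using spectral_resolution_exists[OF C] Cherm by auto
  then interpret spectral_resolution d C E \<Lambda> .
  have C_self: "Re (ip (C *\<^sub>v x) x) = (\<Sum>p\<in>S. (vnorm (X p *\<^sub>v x))\<^sup>2)" if "x \<in> carrier_vec d" for x
    using C_form[OF that that] by (simp add: ip_self)
  have kerC: "X p *\<^sub>v x = 0\<^sub>v d" if "x \<in> carrier_vec d" "C *\<^sub>v x = 0\<^sub>v d" "p \<in> S" for x p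
  proof -
    have "(\<Sum>p\<in>S. (vnorm (X p *\<^sub>v x))\<^sup>2) = 0"
      using C_self[OF that(1)] that by simp
    then have "vnorm (X p *\<^sub>v x) = 0"
      using fin that(3) by (simp add: sum_nonneg_eq_0_iff)
    then show ?thesis using vnorm_eq_0_iff[of "X p *\<^sub>v x"] X[OF that(3)] by simp
  qed
  have zero_smult: "0 \<cdot>\<^sub>v x = 0\<^sub>v d" if "x \<in> carrier_vec d" for x :: "complex vec"
    using that by auto
  have CE0: "C *\<^sub>v (E 0 *\<^sub>v x) = 0\<^sub>v d" if "x \<in> carrier_vec d" for x
    using that proj_eigen[OF that, of 0] by (simp add: zero_smult)
  have CT: "C *\<^sub>v (T *\<^sub>v x) = 0\<^sub>v d" if x: "x \<in> carrier_vec d" for x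
  proof (rule vec_eqI_ip)
    fix w :: "complex vec" assume w: "w \<in> carrier_vec d"
    have "X p *\<^sub>v (T *\<^sub>v x) = 0\<^sub>v d" if "p \<in> S" for p
    proof -
      have "X p *\<^sub>v (T *\<^sub>v x) = (X p * T) *\<^sub>v x" using X[OF that] T x by simp
      then show ?thesis using X_T[OF that] x by auto
    qed
    then have "(\<Sum>p\<in>S. ip (X p *\<^sub>v (T *\<^sub>v x)) (X p *\<^sub>v w)) = 0"
      using X w by (intro sum.neutral) auto
    then show "ip (C *\<^sub>v (T *\<^sub>v x)) w = ip (0\<^sub>v d) w"
      using C_form[of "T *\<^sub>v x" w] T x w by simp
  qed (use C T x in auto)
  have E0T: "E 0 *\<^sub>v (T *\<^sub>v x) = T *\<^sub>v x" if x: "x \<in> carrier_vec d" for x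
  proof (rule proj_unique)
    fix c :: complex assume c: "c \<noteq> 0"
    let ?y = "T *\<^sub>v x"
    have y: "?y \<in> carrier_vec d" using T x by simp
    have "c \<cdot>\<^sub>v (E c *\<^sub>v ?y) = E c *\<^sub>v (C *\<^sub>v ?y)"
      using proj_eigen[OF y, of c] proj_commute_vec[OF C refl y, of c] by simp
    also have "\<dots> = 0\<^sub>v d" using CT[OF x] mult_mat_zero_vec[OF proj_carrier[of c]] by simp
    finally have "inverse c \<cdot>\<^sub>v (c \<cdot>\<^sub>v (E c *\<^sub>v ?y)) = inverse c \<cdot>\<^sub>v 0\<^sub>v d" by simp
    moreover have "inverse c \<cdot>\<^sub>v 0\<^sub>v d = 0\<^sub>v d" by (rule eq_vecI) auto
    ultimately show "E c *\<^sub>v ?y = 0\<^sub>v d" using c by (simp add: smult_smult_assoc)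
  qed (use T x in auto)
  \<comment> \<open>\<open>T\<close> maps into the kernel of \<open>C\<close>, and
    \<open>madj T\<close> fixes this kernel; testing against \<open>w\<close> shows that this forces
    \<open>T\<close> to be the orthogonal projection \<open>E 0\<close>.\<close>
  have TE: "T *\<^sub>v x = E 0 *\<^sub>v x" if x: "x \<in> carrier_vec d" for x
  proof (rule vec_eqI_ip)
    fix w :: "complex vec" assume w: "w \<in> carrier_vec d"
    have "ip (T *\<^sub>v x) w = ip (T *\<^sub>v x) (E 0 *\<^sub>v w)"
      using E0T[OF x] ip_proj_left[of "T *\<^sub>v x" w 0] T x w by simp
    also have "\<dots> = ip x (madj T *\<^sub>v (E 0 *\<^sub>v w))"
      using ip_madj[OF T x] w by simp
    also have "madj T *\<^sub>v (E 0 *\<^sub>v w) = E 0 *\<^sub>v w"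
      using w by (intro T_fix kerC CE0) auto
    also have "ip x (E 0 *\<^sub>v w) = ip (E 0 *\<^sub>v x) w"
      using ip_madj[OF proj_carrier[of 0] x w] by simp
    finally show "ip (T *\<^sub>v x) w = ip (E 0 *\<^sub>v x) w" .
  qed (use T x in auto)
  have Pi_sym: "ip (Pi p *\<^sub>v x) y = ip x (Pi p *\<^sub>v y)"
    if "p \<in> S" "x \<in> carrier_vec d" "y \<in> carrier_vec d" for p x y
    using ip_madj[OF Pi[OF that(1)] that(2,3)] Pi_herm[OF that(1)] by simp
  have M_herm: "madj M = M"
  proof (rule madj_eqI[OF M M])
    fix x y :: "complex vec" assume xy: "x \<in> carrier_vec d" "y \<in> carrier_vec d"
    have c: "ip x (M *\<^sub>v y) = cnj (ip (M *\<^sub>v y) x)"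
      using xy M ip_commute[of "M *\<^sub>v y" d x] by simp
    have "ip x (M *\<^sub>v y) = (\<Sum>p\<in>S. cnj (ip (Pi p *\<^sub>v y) x)) / of_nat (card S) - cnj (ip (E 0 *\<^sub>v y) x)"
      unfolding c M_def[OF xy(2,1)] TE[OF xy(2)] by simp
    also have "(\<Sum>p\<in>S. cnj (ip (Pi p *\<^sub>v y) x)) = (\<Sum>p\<in>S. ip (Pi p *\<^sub>v x) y)"
      using xy Pi by (intro sum.cong refl) (simp add: Pi_sym ip_commute[symmetric, of _ d])
    also have "cnj (ip (E 0 *\<^sub>v y) x) = ip (E 0 *\<^sub>v x) y"
      using ip_madj[OF proj_carrier[of 0] xy] xy by (simp add: ip_commute[symmetric, of _ d])
    finally show "ip (M *\<^sub>v x) y = ip x (M *\<^sub>v y)" using M_def[OF xy] TE[OF xy(1)] by simp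
  qed
  define w where "w p x = x - Pi p *\<^sub>v x" for p x
  have wc: "w p x \<in> carrier_vec d" if "p \<in> S" "x \<in> carrier_vec d" for p x
    using that Pi by (auto simp: w_def)
  have PiPi: "Pi p *\<^sub>v (Pi p *\<^sub>v x) = Pi p *\<^sub>v x" if "p \<in> S" "x \<in> carrier_vec d" for p x
    using Pi_idem[OF that(1)] Pi[OF that(1)] that(2) by (metis assoc_mult_mat_vec)
  have Pi_pyth: "Re (ip (Pi p *\<^sub>v x) x) = (vnorm x)\<^sup>2 - (vnorm (w p x))\<^sup>2"
    "(vnorm (w p x))\<^sup>2 \<le> (vnorm x)\<^sup>2" if p: "p \<in> S" and x: "x \<in> carrier_vec d" for p x
  proof -
    have Px: "Pi p *\<^sub>v x \<in> carrier_vec d" using Pi[OF p] x by simp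
    have 1: "ip (Pi p *\<^sub>v x) x = ip (Pi p *\<^sub>v x) (Pi p *\<^sub>v x)"
      using Pi_sym[OF p Px x] PiPi[OF p x] by simp
    have 2: "ip x (Pi p *\<^sub>v x) = ip (Pi p *\<^sub>v x) (Pi p *\<^sub>v x)"
      using 1 Pi_sym[OF p x x] by simp
    have "ip (w p x) (w p x) = ip x x - ip (Pi p *\<^sub>v x) x"
      unfolding w_def using x Px 1 2 by (simp add: ip_diff_left[of _ d] ip_diff_right[of _ d])
    then have "Re (ip (w p x) (w p x)) = Re (ip x x) - Re (ip (Pi p *\<^sub>v x) x)" by simp
    then show r: "Re (ip (Pi p *\<^sub>v x) x) = (vnorm x)\<^sup>2 - (vnorm (w p x))\<^sup>2"
      by (simp add: ip_self)
    have "Re (ip (Pi p *\<^sub>v x) x) = (vnorm (Pi p *\<^sub>v x))\<^sup>2" unfolding 1 by (simp add: ip_self)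
    then show "(vnorm (w p x))\<^sup>2 \<le> (vnorm x)\<^sup>2" using r by (simp add: algebra_simps)
  qed
  have Xw: "X p *\<^sub>v w p x = X p *\<^sub>v x" if p: "p \<in> S" and x: "x \<in> carrier_vec d" for p x
  proof -
    have "X p *\<^sub>v (Pi p *\<^sub>v x) = (X p * Pi p) *\<^sub>v x" using X[OF p] Pi[OF p] x by simp
    also have "\<dots> = 0\<^sub>v d" using X_Pi[OF p] x by auto
    finally show ?thesis
      using X[OF p] Pi[OF p] x by (simp add: w_def mult_minus_distrib_mat_vec[of _ d d])
  qed
  have Ew: "E c *\<^sub>v w p x = w p (E c *\<^sub>v x)" if p: "p \<in> S" and x: "x \<in> carrier_vec d" for p x c
    using proj_commute_vec[OF Pi[OF p] Pi_C[OF p] x, of c] Pi[OF p] x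
    by (simp add: w_def mult_minus_distrib_mat_vec[of _ d d])
  \<comment> \<open>\<open>Pi p\<close> fixes the kernel of \<open>C\<close>, so only the part of
    \<open>x\<close> orthogonal to this kernel contributes to \<open>w p x\<close>.\<close>
  have w_kill: "w p x = w p (x - E 0 *\<^sub>v x)" if p: "p \<in> S" and x: "x \<in> carrier_vec d" for p x
  proof -
    have "Pi p *\<^sub>v (E 0 *\<^sub>v x) = E 0 *\<^sub>v x"
      using x p by (intro Pi_fix kerC CE0) auto
    then show ?thesis
      using Pi[OF p] x carrier_matD(1)[OF proj_carrier[of 0]] 
      by (auto simp: w_def mult_minus_distrib_mat_vec[of _ d d])
  qed
  have eig: "(\<Sum>p\<in>S. (vnorm (w p x))\<^sup>2) \<ge> g * (vnorm x)\<^sup>2"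
    if c: "c \<noteq> 0" and y: "y \<in> carrier_vec d" and xdef: "x = E c *\<^sub>v y" for c x y
  proof (cases "vnorm x = 0")
    case True
    then show ?thesis by (simp add: sum_nonneg)
  next
    case False
    have x: "x \<in> carrier_vec d" using y by (simp add: xdef)
    have Cx: "C *\<^sub>v x = c \<cdot>\<^sub>v x" using proj_eigen[OF y] by (simp add: xdef)
    have cform: "ip (C *\<^sub>v z) z = c * of_real ((vnorm z)\<^sup>2)" if "z = E c *\<^sub>v u" "u \<in> carrier_vec d" for z u
      using proj_eigen[OF that(2), of c] that by (simp add: ip_smult_left[of _ d] ip_self del: of_real_power)
    have "c * of_real ((vnorm x)\<^sup>2) = of_real (\<Sum>p\<in>S. (vnorm (X p *\<^sub>v x))\<^sup>2)"
      using cform[OF xdef y] C_form[OF x x] by (simp only: ip_self of_real_sum)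
    then have "c = of_real ((\<Sum>p\<in>S. (vnorm (X p *\<^sub>v x))\<^sup>2) / (vnorm x)\<^sup>2)"
      using False by (simp add: field_simps)
    moreover have "(\<Sum>p\<in>S. (vnorm (X p *\<^sub>v x))\<^sup>2) / (vnorm x)\<^sup>2 \<ge> 0"
      by (intro divide_nonneg_nonneg sum_nonneg) auto
    ultimately obtain c' where c': "c = of_real c'" "c' \<ge> 0" by blast
    then have pos: "c' > 0" using c by (cases "c' = 0") auto
    have "c' * (g * (vnorm x)\<^sup>2) = g * Re (ip (C *\<^sub>v x) x)"
      unfolding cform[OF xdef y] c'(1) by simp
    also have "\<dots> = (\<Sum>p\<in>S. g * (vnorm (X p *\<^sub>v w p x))\<^sup>2)"
      unfolding C_self[OF x] sum_distrib_left by (intro sum.cong refl) (simp add: Xw x)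
    \<comment> \<open>The gap is applied to the vectors \<open>w p x\<close> and not to
      \<open>x\<close>. They lie in the same eigenspace of \<open>C\<close> as \<open>x\<close>,
      because \<open>Pi p\<close> commutes with \<open>C\<close>; so the right-hand side again
      carries the factor \<open>c'\<close>, which cancels.\<close>
    also have "\<dots> \<le> (\<Sum>p\<in>S. Re (ip (C *\<^sub>v w p x) (w p x)))"
      using x by (intro sum_mono gap wc)
    also have "\<dots> = (\<Sum>p\<in>S. c' * (vnorm (w p x))\<^sup>2)"
    proof (intro sum.cong refl)
      fix p assume p: "p \<in> S"
      have "ip (C *\<^sub>v w p x) (w p x) = c * of_real ((vnorm (w p x))\<^sup>2)"
        by (rule cform[of _ "w p y"]) (use p y wc Ew in \<open>auto simp: xdef\<close>)
      then show "Re (ip (C *\<^sub>v w p x) (w p x)) = c' * (vnorm (w p x))\<^sup>2" by (simp add: c')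
    qed
    also have "\<dots> = c' * (\<Sum>p\<in>S. (vnorm (w p x))\<^sup>2)" by (simp add: sum_distrib_left)
    finally show ?thesis using pos by simp
  qed
  \<comment> \<open>As a quadratic form, \<open>M\<close> is \<open>1 - E 0\<close> minus the mean
    of the \<open>1 - Pi p\<close>. A lower bound on the sum of the squares of the
    \<open>vnorm (w p x)\<close> is therefore an upper bound on \<open>M\<close>, and
    conversely.\<close>
  have form: "Re (ip (M *\<^sub>v x) x) = (vnorm (x - E 0 *\<^sub>v x))\<^sup>2 - (\<Sum>p\<in>S. (vnorm (w p x))\<^sup>2) / K"
    and sumw: "(\<Sum>p\<in>S. (vnorm (w p x))\<^sup>2) \<ge> g * (vnorm (x - E 0 *\<^sub>v x))\<^sup>2"
      "(\<Sum>p\<in>S. (vnorm (w p x))\<^sup>2) \<le> K * (vnorm (x - E 0 *\<^sub>v x))\<^sup>2"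
    and n1: "(vnorm (x - E 0 *\<^sub>v x))\<^sup>2 \<le> (vnorm x)\<^sup>2" if x: "x \<in> carrier_vec d" for x
  proof -
    let ?x1 = "x - E 0 *\<^sub>v x"
    have x1: "?x1 \<in> carrier_vec d" using x by simp
    have E0x: "E 0 *\<^sub>v x \<in> carrier_vec d" using x by simp
    have a: "ip x (E 0 *\<^sub>v x) = ip (E 0 *\<^sub>v x) (E 0 *\<^sub>v x)" "ip (E 0 *\<^sub>v x) x = ip (E 0 *\<^sub>v x) (E 0 *\<^sub>v x)"
      using ip_proj_left[OF x x, of 0] ip_madj[OF proj_carrier[of 0] x x] by auto
    have "ip ?x1 ?x1 = ip x x - ip (E 0 *\<^sub>v x) (E 0 *\<^sub>v x)"
      using x E0x a by (simp add: ip_diff_left[of _ d] ip_diff_right[of _ d])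
    then have "Re (ip ?x1 ?x1) = Re (ip x x) - Re (ip (E 0 *\<^sub>v x) (E 0 *\<^sub>v x))" by simp
    then have b: "(vnorm ?x1)\<^sup>2 = (vnorm x)\<^sup>2 - Re (ip (E 0 *\<^sub>v x) x)"
      unfolding a(2) by (simp add: ip_self)
    then show "(vnorm ?x1)\<^sup>2 \<le> (vnorm x)\<^sup>2"
      unfolding a(2) by (simp add: ip_self)
    have "Re (ip (M *\<^sub>v x) x) = (\<Sum>p\<in>S. Re (ip (Pi p *\<^sub>v x) x)) / K - Re (ip (E 0 *\<^sub>v x) x)"
      unfolding M_def[OF x x] TE[OF x] K_def by (simp add: Re_divide_of_nat)
    also have "(\<Sum>p\<in>S. Re (ip (Pi p *\<^sub>v x) x)) = K * (vnorm x)\<^sup>2 - (\<Sum>p\<in>S. (vnorm (w p x))\<^sup>2)"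
      using x by (simp add: Pi_pyth sum_subtractf K_def)
    finally show "Re (ip (M *\<^sub>v x) x) = (vnorm ?x1)\<^sup>2 - (\<Sum>p\<in>S. (vnorm (w p x))\<^sup>2) / K"
      using K b by (simp add: diff_divide_distrib)
    have "(\<Sum>p\<in>S. (vnorm (w p x))\<^sup>2) \<le> (\<Sum>p\<in>S. (vnorm ?x1)\<^sup>2)"
      using w_kill[OF _ x] Pi_pyth(2)[OF _ x1] by (intro sum_mono) metis
    then show "(\<Sum>p\<in>S. (vnorm (w p x))\<^sup>2) \<le> K * (vnorm ?x1)\<^sup>2"
      by (simp add: K_def)
    have E1: "E c *\<^sub>v ?x1 = (if c = 0 then 0\<^sub>v d else E c *\<^sub>v x)" for c
      using x carrier_matD(1)[OF proj_carrier[of c]] by (auto simp: mult_minus_distrib_mat_vec[of _ d d] proj_proj)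
    \<comment> \<open>Eigenspace by eigenspace: the value \<open>0\<close> contributes nothing,
      since \<open>?x1\<close> has no component in the kernel of \<open>C\<close>, and
      \<open>eig\<close> covers the other values.\<close>
    have "g * (vnorm ?x1)\<^sup>2 = (\<Sum>c\<in>\<Lambda>. g * (vnorm (E c *\<^sub>v ?x1))\<^sup>2)"
      using vnorm_decomp[OF x1] by (simp add: sum_distrib_left)
    also have "\<dots> \<le> (\<Sum>c\<in>\<Lambda>. \<Sum>p\<in>S. (vnorm (w p (E c *\<^sub>v ?x1)))\<^sup>2)"
    proof (rule sum_mono)
      fix c
      show "g * (vnorm (E c *\<^sub>v ?x1))\<^sup>2 \<le> (\<Sum>p\<in>S. (vnorm (w p (E c *\<^sub>v ?x1)))\<^sup>2)"
      proof (cases "c = 0")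
        case True
        then show ?thesis by (simp add: E1 sum_nonneg)
      next
        case False
        then show ?thesis using eig[OF False x1 refl] by simp
      qed
    qed
    also have "\<dots> = (\<Sum>p\<in>S. \<Sum>c\<in>\<Lambda>. (vnorm (E c *\<^sub>v w p ?x1))\<^sup>2)"
      using x1 by (subst sum.swap) (simp add: Ew)
    also have "\<dots> = (\<Sum>p\<in>S. (vnorm (w p x))\<^sup>2)"
      using vnorm_decomp[OF wc[OF _ x1]] w_kill[OF _ x] by (intro sum.cong refl) metis
    finally show "g * (vnorm ?x1)\<^sup>2 \<le> (\<Sum>p\<in>S. (vnorm (w p x))\<^sup>2)" .
  qed
  have r: "0 \<le> 1 - g / K" using g K by (simp add: K_def)
  have "vnorm (M *\<^sub>v v) \<le> (1 - g / K) * vnorm v"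
  proof (rule hermitian_form_bound[OF M M_herm _ _ r v])
    fix x :: "complex vec" assume x: "x \<in> carrier_vec d"
    show "0 \<le> Re (ip (M *\<^sub>v x) x)"
    proof -
      have "(\<Sum>p\<in>S. (vnorm (w p x))\<^sup>2) / K \<le> (vnorm (x - E 0 *\<^sub>v x))\<^sup>2"
        using sumw(2)[OF x] K by (simp add: pos_divide_le_eq mult.commute)
      then show ?thesis unfolding form[OF x] by simp
    qed
    have "g / K * (vnorm (x - E 0 *\<^sub>v x))\<^sup>2 \<le> (\<Sum>p\<in>S. (vnorm (w p x))\<^sup>2) / K"
      using sumw(1)[OF x] K by (simp add: field_simps)
    then have "Re (ip (M *\<^sub>v x) x) \<le> (1 - g / K) * (vnorm (x - E 0 *\<^sub>v x))\<^sup>2"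
      using form[OF x] by (simp add: algebra_simps)
    also have "\<dots> \<le> (1 - g / K) * (vnorm x)\<^sup>2"
      using r n1[OF x] by (intro mult_left_mono)
    finally show "Re (ip (M *\<^sub>v x) x) \<le> (1 - g / K) * (vnorm x)\<^sup>2" .
  qed
  then show ?thesis by (simp add: K_def)
qed

section \<open>One-parameter groups of matrices\<close>

lemma mult_index:
  "\<lbrakk>A \<in> carrier_mat a b; B \<in> carrier_mat b c; i < a; j < c\<rbrakk> \<Longrightarrow>
     (A * B) $$ (i,j) = (\<Sum>k<b. A $$ (i,k) * B $$ (k,j))"
  by (simp add: scalar_prod_def atLeast0LessThan)

lemma mult_vec_index:
  "\<lbrakk>A \<in> carrier_mat a b; v \<in> carrier_vec b; i < a\<rbrakk> \<Longrightarrow>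
     (A *\<^sub>v v) $ i = (\<Sum>k<b. A $$ (i,k) * v $ k)"
  by (simp add: scalar_prod_def atLeast0LessThan)

section \<open>Entrywise calculus for matrix curves\<close>

lemma has_vector_derivative_quotient_tendsto:
  assumes "(f has_vector_derivative f') (at x)"
  shows "((\<lambda>h. (f (x + h) - f x) /\<^sub>R h) \<longlongrightarrow> f') (at 0)"
proof -
  have "((\<lambda>h. norm (f (x + h) - f x - h *\<^sub>R f') / norm h) \<longlongrightarrow> 0) (at 0)"
    using assms unfolding has_vector_derivative_def has_derivative_at by simp
  moreover have "\<forall>\<^sub>F h in at 0. norm (f (x + h) - f x - h *\<^sub>R f') / norm h = norm ((f (x + h) - f x) /\<^sub>R h - f')"
    unfolding eventually_at_filter
  proof (intro always_eventually allI impI)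
    fix h :: real assume "h \<noteq> 0"
    then have "(f (x + h) - f x) /\<^sub>R h - f' = (f (x + h) - f x - h *\<^sub>R f') /\<^sub>R h"
      by (simp add: scaleR_right_diff_distrib)
    then show "norm (f (x + h) - f x - h *\<^sub>R f') / norm h = norm ((f (x + h) - f x) /\<^sub>R h - f')"
      by (simp only: norm_scaleR) (simp add: divide_inverse)
  qed
  ultimately have "((\<lambda>h. norm ((f (x + h) - f x) /\<^sub>R h - f')) \<longlongrightarrow> 0) (at 0)"
    by (rule Lim_transform_eventually)
  then show ?thesis by (simp add: tendsto_norm_zero_iff LIM_zero_iff)
qed

text \<open>Taken entry by entry, because the dimension \<open>d\<close> is a term and not part of
  the type.\<close>

definition mat_deriv :: "nat \<Rightarrow> (real \<Rightarrow> complex mat) \<Rightarrow> complex mat \<Rightarrow> real \<Rightarrow> bool" where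
  "mat_deriv d F F' s \<longleftrightarrow>
     (\<forall>i<d. \<forall>j<d. ((\<lambda>s. F s $$ (i,j)) has_vector_derivative F' $$ (i,j)) (at s))"

lemma mat_derivD:
  "mat_deriv d F F' s \<Longrightarrow> i < d \<Longrightarrow> j < d \<Longrightarrow>
     ((\<lambda>s. F s $$ (i,j)) has_vector_derivative F' $$ (i,j)) (at s)"
  by (simp add: mat_deriv_def)

lemma mat_deriv_unique:
  assumes "mat_deriv d F A s" "mat_deriv d F B s" "A \<in> carrier_mat d d" "B \<in> carrier_mat d d"
  shows "A = B"
  using assms by (intro eq_matI) (auto simp: mat_deriv_def, metis vector_derivative_unique_at)

lemma mat_deriv_const: "mat_deriv d (\<lambda>_. A) (0\<^sub>m d d) s"
  by (simp add: mat_deriv_def)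

lemma mat_deriv_mult:
  assumes F: "mat_deriv d F F' s" and G: "mat_deriv d G G' s"
    and c: "\<And>s. F s \<in> carrier_mat d d" "\<And>s. G s \<in> carrier_mat d d"
      "F' \<in> carrier_mat d d" "G' \<in> carrier_mat d d"
  shows "mat_deriv d (\<lambda>s. F s * G s) (F s * G' + F' * G s) s"
  unfolding mat_deriv_def
proof (intro allI impI)
  fix i j assume ij: "i < d" "j < d"
  have "((\<lambda>s. \<Sum>k<d. F s $$ (i,k) * G s $$ (k,j)) has_vector_derivative
          (\<Sum>k<d. F s $$ (i,k) * G' $$ (k,j) + F' $$ (i,k) * G s $$ (k,j))) (at s)"
    using ij by (intro has_vector_derivative_sum has_vector_derivative_mult mat_derivD[OF F] mat_derivD[OF G]) auto
  moreover have "(\<lambda>s. (F s * G s) $$ (i,j)) = (\<lambda>s. \<Sum>k<d. F s $$ (i,k) * G s $$ (k,j))"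
    using ij by (auto simp: fun_eq_iff mult_index[OF c(1,2)])
  moreover have "(F s * G' + F' * G s) $$ (i,j) = (\<Sum>k<d. F s $$ (i,k) * G' $$ (k,j) + F' $$ (i,k) * G s $$ (k,j))"
    using mult_index[OF c(1) c(4) ij, of s] mult_index[OF c(3) c(2) ij, of s] c(3) carrier_matD[OF c(2)[of s]] ij
    by (simp add: sum.distrib del: index_mult_mat(1))
  ultimately show "((\<lambda>s. (F s * G s) $$ (i,j)) has_vector_derivative (F s * G' + F' * G s) $$ (i,j)) (at s)"
    by simp
qed

lemma mat_deriv_const_mult:
  assumes "mat_deriv d G G' s" "A \<in> carrier_mat d d" "\<And>s. G s \<in> carrier_mat d d" "G' \<in> carrier_mat d d"
  shows "mat_deriv d (\<lambda>s. A * G s) (A * G') s"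
  using mat_deriv_mult[OF mat_deriv_const[of d A] assms(1)] assms left_mult_zero_mat[OF assms(3)[of s], of d]
  by simp

lemma mat_deriv_mult_const:
  assumes "mat_deriv d G G' s" "A \<in> carrier_mat d d" "\<And>s. G s \<in> carrier_mat d d" "G' \<in> carrier_mat d d"
  shows "mat_deriv d (\<lambda>s. G s * A) (G' * A) s"
  using mat_deriv_mult[OF assms(1) mat_deriv_const[of d A]] assms right_mult_zero_mat[OF assms(3)[of s], of d]
  by simp

lemma mat_deriv_chain:
  assumes F: "mat_deriv d F F' (a s)" and a: "(a has_real_derivative a') (at s)"
    and c: "F' \<in> carrier_mat d d"
  shows "mat_deriv d (\<lambda>s. F (a s)) (complex_of_real a' \<cdot>\<^sub>m F') s"
  unfolding mat_deriv_def
proof (intro allI impI)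
  fix i j assume ij: "i < d" "j < d"
  have "((\<lambda>s. F s $$ (i,j)) \<circ> a has_vector_derivative a' *\<^sub>R (F' $$ (i,j))) (at s)"
    using a mat_derivD[OF F ij]
    by (intro vector_diff_chain_at) (auto simp: has_real_derivative_iff_has_vector_derivative)
  then show "((\<lambda>s. F (a s) $$ (i,j)) has_vector_derivative (complex_of_real a' \<cdot>\<^sub>m F') $$ (i,j)) (at s)"
    using ij c by (simp add: o_def scaleR_conv_of_real)
qed

lemma mat_deriv_transform:
  assumes "mat_deriv d F F' s" "eventually (\<lambda>x. F x = G x) (nhds s)"
  shows "mat_deriv d G F' s"
  unfolding mat_deriv_def
proof (intro allI impI)
  fix i j assume ij: "i < d" "j < d"
  obtain S where S: "open S" "s \<in> S" "\<And>x. x \<in> S \<Longrightarrow> F x = G x"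
    using assms(2) by (auto simp: eventually_nhds)
  show "((\<lambda>s. G s $$ (i,j)) has_vector_derivative F' $$ (i,j)) (at s)"
    by (rule has_vector_derivative_transform_within_open[OF mat_derivD[OF assms(1) ij] S(1,2)])
      (simp add: S(3))
qed

text \<open>Smoothing: \<open>U s\<close> times the integral of \<open>U\<close> over
  \<open>[0, a]\<close> is the integral over \<open>[s, s + a]\<close>, which is differentiable in
  \<open>s\<close> by continuity of \<open>U\<close>. For small \<open>a\<close> the integral over
  \<open>[0, a]\<close> is an invertible matrix, so \<open>U\<close> itself is
  differentiable.\<close>

lemma one_param_group_deriv_zero:
  fixes U :: "real \<Rightarrow> complex mat"
  assumes Uc: "\<And>s. U s \<in> carrier_mat d d"
    and add: "\<And>s t. U (s + t) = U s * U t" and U0: "U 0 = 1\<^sub>m d"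
    and cont: "\<And>i j. i < d \<Longrightarrow> j < d \<Longrightarrow> continuous_on UNIV (\<lambda>s. U s $$ (i,j))"
  shows "\<exists>D. D \<in> carrier_mat d d \<and> mat_deriv d U D 0"
proof -
  \<comment> \<open>The primitive starts at \<open>-1\<close>, so that it is differentiable at both
    \<open>s\<close> and \<open>s + a\<close> for all \<open>s\<close> between \<open>-1\<close> and
    \<open>1\<close> and \<open>a\<close> between \<open>0\<close> and \<open>1\<close>.\<close>
  define F where "F i j x = integral {-1..x} (\<lambda>r. U r $$ (i,j))" for i j x
  have F: "(F i j has_vector_derivative U x $$ (i,j)) (at x)"
    if "i < d" "j < d" "-1 < x" "x < 2" for i j x
  proof -
    have "(F i j has_vector_derivative U x $$ (i,j)) (at x within {-1..2})"
      unfolding F_def using that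
      by (intro integral_has_vector_derivative continuous_on_subset[OF cont]) auto
    then have "(F i j has_vector_derivative U x $$ (i,j)) (at x within {-1<..<2})"
      by (rule has_vector_derivative_within_subset) auto
    then show ?thesis using that by (simp add: at_within_open[of x "{-1<..<2}"])
  qed
  define B where "B a = mat d d (\<lambda>(i,j). F i j a - F i j 0)" for a
  have Bc: "B a \<in> carrier_mat d d" for a by (simp add: B_def)
  \<comment> \<open>The mean of \<open>U\<close> over \<open>[0, a]\<close> tends to the identity.
    The determinant is a polynomial in the entries, so it tends to \<open>1\<close> and is nonzero
    for some \<open>a\<close>.\<close>
  have "((\<lambda>a. det ((1 / complex_of_real a) \<cdot>\<^sub>m B a)) \<longlongrightarrow> det (1\<^sub>m d)) (at_right 0)"
  proof -
    have ent: "((\<lambda>a. (1 / complex_of_real a) * (F i j a - F i j 0)) \<longlongrightarrow> (1\<^sub>m d) $$ (i,j)) (at_right 0)"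
      if "i < d" "j < d" for i j
    proof -
      have "((\<lambda>y. (F i j y - F i j 0) /\<^sub>R (y - 0)) \<longlongrightarrow> U 0 $$ (i,j)) (at 0)"
        using has_vector_derivative_quotient_tendsto[OF F[OF that, of 0]] by simp
      then have "((\<lambda>y. (F i j y - F i j 0) /\<^sub>R (y - 0)) \<longlongrightarrow> U 0 $$ (i,j)) (at_right 0)"
        by (rule filterlim_mono) (auto simp: at_le)
      then show ?thesis by (simp add: U0 scaleR_conv_of_real divide_inverse)
    qed
    have perm: "p i < d" if "p permutes {0..<d}" "i < d" for p i
      using permutes_in_image[OF that(1), of i] that(2) by simp
    have dB: "det ((1 / complex_of_real a) \<cdot>\<^sub>m B a) = (\<Sum>p\<in>{p. p permutes {0..<d}}.
        signof p * (\<Prod>i=0..<d. (1 / complex_of_real a) * (F i (p i) a - F i (p i) 0)))" for a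
      unfolding det_def by (auto simp: B_def perm intro!: sum.cong prod.cong)
    have d1: "det (1\<^sub>m d) = (\<Sum>p\<in>{p. p permutes {0..<d}}. signof p * (\<Prod>i=0..<d. (1\<^sub>m d :: complex mat) $$ (i, p i)))"
      unfolding det_def by simp
    show ?thesis
      unfolding dB d1
      by (intro tendsto_sum tendsto_mult[OF tendsto_const] tendsto_prod ent) (auto simp: perm)
  qed
  then have "eventually (\<lambda>a. det ((1 / complex_of_real a) \<cdot>\<^sub>m B a) \<noteq> 0) (at_right 0)"
    by (rule tendsto_imp_eventually_ne) simp
  moreover have "eventually (\<lambda>a. a \<in> {0<..<1}) (at_right (0::real))"
    by (rule eventually_at_right_real) simp
  ultimately have "eventually (\<lambda>a. det ((1 / complex_of_real a) \<cdot>\<^sub>m B a) \<noteq> 0 \<and> a \<in> {0<..<1}) (at_right 0)"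
    by (rule eventually_conj)
  then obtain a where a: "0 < a" "a < 1" "det ((1 / complex_of_real a) \<cdot>\<^sub>m B a) \<noteq> 0"
    by (auto dest!: eventually_happens)
  then have "det (B a) \<noteq> 0" using Bc[of a] by (auto simp: det_smult)
  then obtain G where G: "G \<in> carrier_mat d d" "B a * G = 1\<^sub>m d"
    using det_non_zero_imp_unit[OF Bc] by (auto simp: Units_def ring_mat_def)
  \<comment> \<open>The group law moves the factor \<open>U s\<close> under the integral, and
    translation turns the result into an integral from \<open>s\<close> to
    \<open>s + a\<close>.\<close>
  have UB: "(U s * B a) $$ (i,j) = F i j (s + a) - F i j s" if "i < d" "j < d" "-1 < s" "s < 1" for s i j
  proof -
    have "((\<lambda>r. U (s + r) $$ (i,j)) has_integral (F i j (s + a) - F i j (s + 0))) {0..a}"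
    proof (rule fundamental_theorem_of_calculus)
      fix r assume r: "r \<in> {0..a}"
      have "(F i j \<circ> (\<lambda>r. s + r) has_vector_derivative 1 *\<^sub>R (U (s + r) $$ (i,j))) (at r)"
        using that a r by (intro vector_diff_chain_at F) (auto intro!: derivative_eq_intros)
      then show "((\<lambda>r. F i j (s + r)) has_vector_derivative U (s + r) $$ (i,j)) (at r within {0..a})"
        by (auto simp: o_def intro: has_vector_derivative_at_within)
    qed (use a in auto)
    moreover have "((\<lambda>r. \<Sum>k<d. U s $$ (i,k) * U r $$ (k,j)) has_integral (\<Sum>k<d. U s $$ (i,k) * (F k j a - F k j 0))) {0..a}"
    proof (intro has_integral_sum has_integral_mult_right)
      fix k assume "k \<in> {..<d}"
      then show "((\<lambda>r. U r $$ (k,j)) has_integral F k j a - F k j 0) {0..a}"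
        using that a
        by (intro fundamental_theorem_of_calculus has_vector_derivative_at_within[OF F]) auto
    qed auto
    moreover have "U (s + r) $$ (i,j) = (\<Sum>k<d. U s $$ (i,k) * U r $$ (k,j))" for r
      using Uc[of s] Uc[of r] that by (simp add: add scalar_prod_def atLeast0LessThan)
    ultimately have "(\<Sum>k<d. U s $$ (i,k) * (F k j a - F k j 0)) = F i j (s + a) - F i j s"
      by (auto dest: has_integral_unique)
    then show ?thesis using Uc[of s] that by (simp add: B_def scalar_prod_def atLeast0LessThan)
  qed
  \<comment> \<open>The derivative of the integral over \<open>[s, s + a]\<close> at
    \<open>s = 0\<close> is \<open>U a - U 0\<close>; the factor \<open>G\<close> undoes the
    multiplication by \<open>B a\<close>.\<close>
  define D where "D = (U a - U 0) * G"
  have Dc: "D \<in> carrier_mat d d" unfolding D_def by (rule square_mult_carrier[OF minus_carrier_mat[OF Uc] G(1)])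
  have "mat_deriv d (\<lambda>s. U s * B a) (U a - U 0) 0"
    unfolding mat_deriv_def
  proof (intro allI impI)
    fix i j assume ij: "i < d" "j < d"
    have "(F i j \<circ> (\<lambda>r. r + a) has_vector_derivative 1 *\<^sub>R (U (0 + a) $$ (i,j))) (at 0)"
      using ij a by (intro vector_diff_chain_at F) (auto intro!: derivative_eq_intros)
    then have "((\<lambda>s. F i j (s + a) - F i j s) has_vector_derivative (U a $$ (i,j) - U 0 $$ (i,j))) (at 0)"
      using ij by (intro has_vector_derivative_diff F) (auto simp: o_def)
    then have "((\<lambda>s. (U s * B a) $$ (i,j)) has_vector_derivative (U a $$ (i,j) - U 0 $$ (i,j))) (at 0)"
      by (rule has_vector_derivative_transform_within_open[of _ _ _ "{-1<..<1}"]) (use ij UB in auto)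
    then show "((\<lambda>s. (U s * B a) $$ (i,j)) has_vector_derivative (U a - U 0) $$ (i,j)) (at 0)"
      using ij Uc[of 0] by simp
  qed
  then have "mat_deriv d (\<lambda>s. (U s * B a) * G) D 0"
    unfolding D_def using G(1) Uc Bc by (intro mat_deriv_mult_const) (auto intro: minus_carrier_mat[OF Uc])
  moreover have "(U s * B a) * G = U s" for s
    using Uc[of s] Bc[of a] G by (simp add: assoc_mult_mat[of _ d d _ d _ d])
  ultimately show ?thesis using Dc by auto
qed

lemma one_param_group_deriv:
  fixes U :: "real \<Rightarrow> complex mat"
  assumes Uc: "\<And>s. U s \<in> carrier_mat d d"
    and add: "\<And>s t. U (s + t) = U s * U t"
    and D: "D \<in> carrier_mat d d" "mat_deriv d U D 0"
  shows "mat_deriv d U (U s * D) s" "mat_deriv d U (D * U s) s" "U s * D = D * U s"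
proof -
  have D': "mat_deriv d U D (s - s)" using D by simp
  have ch: "mat_deriv d (\<lambda>r. U (r - s)) (complex_of_real 1 \<cdot>\<^sub>m D) s"
    by (rule mat_deriv_chain[where a = "\<lambda>r. r - s", OF D']) (auto intro!: derivative_eq_intros D)
  have one: "complex_of_real 1 \<cdot>\<^sub>m D = D" by (intro eq_matI) auto
  have "mat_deriv d (\<lambda>r. U s * U (r - s)) (U s * D) s"
    using ch Uc D unfolding one by (intro mat_deriv_const_mult) auto
  then show 1: "mat_deriv d U (U s * D) s"
    by (simp add: add[symmetric])
  have "mat_deriv d (\<lambda>r. U (r - s) * U s) (D * U s) s"
    using ch Uc D unfolding one by (intro mat_deriv_mult_const) auto
  then show 2: "mat_deriv d U (D * U s) s"
    by (simp add: add[symmetric])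
  show "U s * D = D * U s"
    using 1 2 by (rule mat_deriv_unique) (use Uc D in auto)
qed

text \<open>The curve \<open>s \<mapsto> U s *\<^sub>v v\<close> has derivative
  \<open>U s *\<^sub>v (D *\<^sub>v v) = 0\<close> everywhere, so it stays at its initial
  value.\<close>

lemma one_param_group_fixes:
  fixes U :: "real \<Rightarrow> complex mat"
  assumes Uc: "\<And>s. U s \<in> carrier_mat d d"
    and deriv: "\<And>s. mat_deriv d U (U s * D) s" and U0: "U 0 = 1\<^sub>m d"
    and D: "D \<in> carrier_mat d d"
    and v: "v \<in> carrier_vec d" "D *\<^sub>v v = 0\<^sub>v d"
  shows "U s *\<^sub>v v = v"
proof (rule eq_vecI)
  fix i assume "i < dim_vec v"
  then have i: "i < d" using v by simp
  have row: "(A *\<^sub>v v) $ i = (\<Sum>k<d. A $$ (i,k) * v $ k)" if "A \<in> carrier_mat d d" for A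
    using that i v by (simp add: scalar_prod_def atLeast0LessThan)
  have "((\<lambda>s. \<Sum>k<d. U s $$ (i,k) * v $ k) has_vector_derivative (\<Sum>k<d. (U s * D) $$ (i,k) * v $ k)) (at s)" for s
  proof (intro has_vector_derivative_sum)
    fix k assume "k \<in> {..<d}"
    then have "((\<lambda>s. U s $$ (i,k)) has_vector_derivative (U s * D) $$ (i,k)) (at s)"
      using i by (intro mat_derivD[OF deriv]) auto
    then show "((\<lambda>s. U s $$ (i,k) * v $ k) has_vector_derivative (U s * D) $$ (i,k) * v $ k) (at s)"
      by (rule has_vector_derivative_mult_left)
  qed
  moreover have "(\<Sum>k<d. (U s * D) $$ (i,k) * v $ k) = 0" for s
  proof -
    have "(U s * D) *\<^sub>v v = U s *\<^sub>v (D *\<^sub>v v)" by (rule assoc_mult_mat_vec[OF Uc D v(1)])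
    also have "\<dots> = 0\<^sub>v d" using v mult_mat_zero_vec[OF Uc[of s]] by simp
    finally show ?thesis using row[of "U s * D"] Uc[of s] D i by simp
  qed
  ultimately have "((\<lambda>s. (U s *\<^sub>v v) $ i) has_vector_derivative 0) (at s within UNIV)" for s
    using row[OF Uc] by simp
  then obtain c where c: "\<And>s. (U s *\<^sub>v v) $ i = c"
    using has_vector_derivative_zero_constant[of UNIV "\<lambda>s. (U s *\<^sub>v v) $ i"] by auto
  have "(U s *\<^sub>v v) $ i = (U 0 *\<^sub>v v) $ i" using c by metis
  then show "(U s *\<^sub>v v) $ i = v $ i" using v by (simp add: U0)
qed (use Uc[of s] v in auto)

section \<open>Rotations generated by anticommuting involutions\<close>

text \<open>Formed entry by entry, again because the dimension is not part of the type.\<close>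

definition mat_lincomb :: "nat \<Rightarrow> 'p set \<Rightarrow> ('p \<Rightarrow> complex) \<Rightarrow> ('p \<Rightarrow> complex mat) \<Rightarrow> complex mat" where
  "mat_lincomb N S \<alpha> A = mat N N (\<lambda>(i,j). \<Sum>p\<in>S. \<alpha> p * A p $$ (i,j))"

lemma mat_lincomb_carrier [simp]: "mat_lincomb N S \<alpha> A \<in> carrier_mat N N"
  by (simp add: mat_lincomb_def)

lemma mat_lincomb_mult_index:
  assumes "\<And>p. p \<in> S \<Longrightarrow> A p \<in> carrier_mat N N" "\<And>p. p \<in> S' \<Longrightarrow> B p \<in> carrier_mat N N"
    and ij: "i < N" "j < N"
  shows "(mat_lincomb N S \<alpha> A * mat_lincomb N S' \<beta> B) $$ (i,j)
    = (\<Sum>p\<in>S. \<Sum>q\<in>S'. \<alpha> p * \<beta> q * (A p * B q) $$ (i,j))"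
proof -
  have "(mat_lincomb N S \<alpha> A * mat_lincomb N S' \<beta> B) $$ (i,j)
      = (\<Sum>k<N. (\<Sum>p\<in>S. \<alpha> p * A p $$ (i,k)) * (\<Sum>q\<in>S'. \<beta> q * B q $$ (k,j)))"
    by (subst mult_index[of _ N N _ N]) (use ij in \<open>auto simp: mat_lincomb_def\<close>)
  also have "\<dots> = (\<Sum>k<N. \<Sum>p\<in>S. \<Sum>q\<in>S'. \<alpha> p * \<beta> q * (A p $$ (i,k) * B q $$ (k,j)))"
    by (simp add: sum_product ac_simps)
  also have "\<dots> = (\<Sum>p\<in>S. \<Sum>k<N. \<Sum>q\<in>S'. \<alpha> p * \<beta> q * (A p $$ (i,k) * B q $$ (k,j)))"
    by (rule sum.swap)
  also have "\<dots> = (\<Sum>p\<in>S. \<Sum>q\<in>S'. \<Sum>k<N. \<alpha> p * \<beta> q * (A p $$ (i,k) * B q $$ (k,j)))"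
    by (intro sum.cong refl sum.swap)
  also have "\<dots> = (\<Sum>p\<in>S. \<Sum>q\<in>S'. \<alpha> p * \<beta> q * (A p * B q) $$ (i,j))"
    by (intro sum.cong refl) (simp add: mult_index[OF assms(1) assms(2) ij] sum_distrib_left)
  finally show ?thesis .
qed

text \<open>\<open>rot N X \<theta>\<close> is \<open>exp (\<i> \<theta> X / 2)\<close> for an involution \<open>X\<close>.\<close>

definition rot :: "nat \<Rightarrow> complex mat \<Rightarrow> real \<Rightarrow> complex mat" where
  "rot N X \<theta> = complex_of_real (cos (\<theta>/2)) \<cdot>\<^sub>m 1\<^sub>m N + (\<i> * complex_of_real (sin (\<theta>/2))) \<cdot>\<^sub>m X"

text \<open>Such a pair obeys the relations of two different Pauli matrices, and with
  \<open>\<i> \<cdot>\<^sub>m (Q * P)\<close> it spans a copy of the complex quaternions. Many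
  lemmas below use the hypothesis for \<open>P\<close> alone, with \<open>Q\<close> as a witness
  that a partner exists.\<close>

definition anticomm :: "nat \<Rightarrow> complex mat \<Rightarrow> complex mat \<Rightarrow> bool" where
  "anticomm N P Q \<longleftrightarrow> P \<in> carrier_mat N N \<and> Q \<in> carrier_mat N N \<and> P * P = 1\<^sub>m N \<and> Q * Q = 1\<^sub>m N \<and>
     madj P = P \<and> madj Q = Q \<and> Q * P = - (P * Q)"

text \<open>The element \<open>a + b P + c Q + e R\<close> with \<open>R = \<i> Q P\<close>. In
  these coordinates identities between products of rotations become polynomial identities in sines
  and cosines.\<close>

definition quat :: "nat \<Rightarrow> complex mat \<Rightarrow> complex mat \<Rightarrow> complex \<Rightarrow> complex \<Rightarrow> complex \<Rightarrow> complex \<Rightarrow> complex mat" where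
  "quat N P Q a b c e = mat_lincomb N {..<4} (\<lambda>p. [a, b, c, e] ! p) (\<lambda>p. [1\<^sub>m N, P, Q, \<i> \<cdot>\<^sub>m (Q * P)] ! p)"

lemma rot_carrier [simp]: "X \<in> carrier_mat N N \<Longrightarrow> rot N X \<theta> \<in> carrier_mat N N"
  by (simp add: rot_def)

lemma anticommD:
  assumes "anticomm N P Q"
  shows "P \<in> carrier_mat N N" "Q \<in> carrier_mat N N" "P * P = 1\<^sub>m N" "Q * Q = 1\<^sub>m N"
    "madj P = P" "madj Q = Q" "Q * P = - (P * Q)"
  using assms by (simp_all add: anticomm_def)

lemma anticomm_sym: "anticomm N P Q \<Longrightarrow> anticomm N Q P"
  by (auto simp: anticomm_def)

lemma neg_smult_mat: "- (A :: complex mat) = (-1) \<cdot>\<^sub>m A"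
  by (intro eq_matI) auto

text \<open>The order of the factors in \<open>R\<close> is chosen so that \<open>(P, Q, R)\<close>
  multiplies like (sigma_x, sigma_y, sigma_z), with the same cyclic signs.\<close>

lemma quat_table:
  assumes "anticomm N P Q" and R: "R = \<i> \<cdot>\<^sub>m (Q * P)"
  shows "R \<in> carrier_mat N N" "R * R = 1\<^sub>m N" "madj R = R"
    "P * Q = \<i> \<cdot>\<^sub>m R" "Q * P = (-\<i>) \<cdot>\<^sub>m R" "Q * R = \<i> \<cdot>\<^sub>m P" "R * Q = (-\<i>) \<cdot>\<^sub>m P"
    "P * R = (-\<i>) \<cdot>\<^sub>m Q" "R * P = \<i> \<cdot>\<^sub>m Q"
proof -
  note a = anticommD[OF assms(1)]
  have PQ: "P * Q = (-1) \<cdot>\<^sub>m (Q * P)" unfolding a(7) by (intro eq_matI) auto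
  have QPP: "Q * P * P = Q" using a(1-6) by (simp add: assoc_mult_mat[of _ N N _ N _ N])
  have QQP: "Q * (Q * P) = P" using a(1-6) by (simp add: assoc_mult_mat[of _ N N _ N _ N, symmetric])
  have c: "Q * P \<in> carrier_mat N N" using a by simp
  have PQP: "P * (Q * P) = (-1) \<cdot>\<^sub>m Q"
  proof -
    have "P * (Q * P) = P * Q * P" using a(1-6) by (simp add: assoc_mult_mat[of _ N N _ N _ N])
    also have "\<dots> = (-1) \<cdot>\<^sub>m (Q * P * P)" unfolding PQ by (rule mult_smult_assoc_mat[OF c a(1)])
    finally show ?thesis by (simp add: QPP)
  qed
  have QPQ: "Q * P * Q = (-1) \<cdot>\<^sub>m P"
  proof -
    have "Q * P * Q = Q * (P * Q)" by (rule assoc_mult_mat[OF a(2,1,2)])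
    also have "\<dots> = (-1) \<cdot>\<^sub>m (Q * (Q * P))" unfolding PQ by (rule mult_smult_distrib[OF a(2) c])
    finally show ?thesis by (simp add: QQP)
  qed
  show Rc: "R \<in> carrier_mat N N" using a by (simp add: R)
  have sm: "x \<cdot>\<^sub>m (y \<cdot>\<^sub>m A) = (x * y) \<cdot>\<^sub>m A" for x y and A :: "complex mat"
    by (intro eq_matI) auto
  have one: "1 \<cdot>\<^sub>m A = A" for A :: "complex mat"
    by (intro eq_matI) auto
  show "P * Q = \<i> \<cdot>\<^sub>m R" "Q * P = (-\<i>) \<cdot>\<^sub>m R"
    unfolding R PQ sm by (simp_all add: one)
  show "madj R = R"
    unfolding R madj_smult madj_mult[OF a(2,1)] a(5,6) PQ sm by simp
  show QR: "Q * R = \<i> \<cdot>\<^sub>m P"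
    unfolding R mult_smult_distrib[OF a(2) c] QQP ..
  show RQ: "R * Q = (-\<i>) \<cdot>\<^sub>m P"
    unfolding R mult_smult_assoc_mat[OF c a(2)] QPQ sm by simp
  show PR: "P * R = (-\<i>) \<cdot>\<^sub>m Q"
    unfolding R mult_smult_distrib[OF a(1) c] PQP sm by simp
  show RP: "R * P = \<i> \<cdot>\<^sub>m Q"
    unfolding R mult_smult_assoc_mat[OF c a(1)] QPP ..
  have "R * R = \<i> \<cdot>\<^sub>m (Q * P * R)"
    unfolding R by (rule mult_smult_assoc_mat[OF c]) (use R Rc in simp)
  also have "Q * P * R = Q * (P * R)" by (rule assoc_mult_mat[OF a(2,1) Rc])
  also have "\<dots> = (-\<i>) \<cdot>\<^sub>m 1\<^sub>m N" unfolding PR mult_smult_distrib[OF a(2,2)] a(4) ..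
  finally show "R * R = 1\<^sub>m N" by (simp add: sm one)
qed

lemma anticomm_third:
  assumes "anticomm N P Q"
  shows "anticomm N (\<i> \<cdot>\<^sub>m (Q * P)) Q" "anticomm N P (\<i> \<cdot>\<^sub>m (Q * P))"
proof -
  define R where "R = \<i> \<cdot>\<^sub>m (Q * P)"
  note t = quat_table[OF assms R_def] and a = anticommD[OF assms]
  have "Q * R = - (R * Q)" unfolding t by (intro eq_matI) auto
  then show "anticomm N (\<i> \<cdot>\<^sub>m (Q * P)) Q"
    using t(1-3) a(2,4,6) unfolding R_def[symmetric] anticomm_def by blast
  have "R * P = - (P * R)" unfolding t by (intro eq_matI) auto
  then show "anticomm N P (\<i> \<cdot>\<^sub>m (Q * P))"
    using t(1-3) a(1,3,5) unfolding R_def[symmetric] anticomm_def by blast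
qed

lemma quat_eqI: "\<lbrakk>a = a'; b = b'; c = c'; e = e'\<rbrakk> \<Longrightarrow> quat N P Q a b c e = quat N P Q a' b' c' e'"
  by simp

lemma quat_mult:
  assumes "anticomm N P Q"
  shows "quat N P Q a b c e * quat N P Q a' b' c' e' = quat N P Q
    (a*a' + b*b' + c*c' + e*e') (a*b' + b*a' + \<i>*(c*e' - e*c'))
    (a*c' + c*a' + \<i>*(e*b' - b*e')) (a*e' + e*a' + \<i>*(b*c' - c*b'))"
proof (rule eq_matI)
  note an = anticommD[OF assms]
  define R where "R = \<i> \<cdot>\<^sub>m (Q * P)"
  note t = quat_table[OF assms R_def]
  have G: "[1\<^sub>m N, P, Q, R] ! p \<in> carrier_mat N N" if "p \<in> {..<4}" for p
    using that an(1,2) t(1)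
    by (auto simp: less_Suc_eq numeral_eq_Suc)
  fix i j assume "i < dim_row (quat N P Q
    (a*a' + b*b' + c*c' + e*e') (a*b' + b*a' + \<i>*(c*e' - e*c'))
    (a*c' + c*a' + \<i>*(e*b' - b*e')) (a*e' + e*a' + \<i>*(b*c' - c*b')))"
    "j < dim_col (quat N P Q
    (a*a' + b*b' + c*c' + e*e') (a*b' + b*a' + \<i>*(c*e' - e*c'))
    (a*c' + c*a' + \<i>*(e*b' - b*e')) (a*e' + e*a' + \<i>*(b*c' - c*b')))"
  then have ij: "i < N" "j < N" by (auto simp: quat_def mat_lincomb_def)
  have dims: "dim_row P = N" "dim_col P = N" "dim_row Q = N" "dim_col Q = N" "dim_row R = N" "dim_col R = N"
    using an t by auto
  have s4: "(\<Sum>p<4. f p) = f 0 + f 1 + f 2 + f 3" for f :: "nat \<Rightarrow> complex"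
    by (simp add: numeral_eq_Suc)
  have ones: "1\<^sub>m N * P = P" "1\<^sub>m N * Q = Q" "1\<^sub>m N * R = R" "P * 1\<^sub>m N = P" "Q * 1\<^sub>m N = Q" "R * 1\<^sub>m N = R"
    "1\<^sub>m N * 1\<^sub>m N = (1\<^sub>m N :: complex mat)"
    using an t by auto
  have nths: "[x0,x1,x2,x3] ! 0 = x0" "[x0,x1,x2,x3] ! 1 = x1" "[x0,x1,x2,x3] ! 2 = x2" "[x0,x1,x2,x3] ! 3 = x3"
    for x0 x1 x2 x3 :: 'z
    by (simp_all add: numeral_eq_Suc)
  have sm: "(x \<cdot>\<^sub>m A) $$ (i,j) = x * A $$ (i,j)" if "A \<in> carrier_mat N N" for x and A :: "complex mat"
    using that ij by simp
  have prod: "(mat_lincomb N {..<4} (\<lambda>p. [a,b,c,e] ! p) (\<lambda>p. [1\<^sub>m N, P, Q, R] ! p)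
      * mat_lincomb N {..<4} (\<lambda>p. [a',b',c',e'] ! p) (\<lambda>p. [1\<^sub>m N, P, Q, R] ! p)) $$ (i,j)
    = (\<Sum>p<4. \<Sum>q<4. [a,b,c,e] ! p * [a',b',c',e'] ! q * ([1\<^sub>m N, P, Q, R] ! p * [1\<^sub>m N, P, Q, R] ! q) $$ (i,j))"
    by (rule mat_lincomb_mult_index[OF G G ij])
  show "(quat N P Q a b c e * quat N P Q a' b' c' e') $$ (i,j) = quat N P Q
    (a*a' + b*b' + c*c' + e*e') (a*b' + b*a' + \<i>*(c*e' - e*c'))
    (a*c' + c*a' + \<i>*(e*b' - b*e')) (a*e' + e*a' + \<i>*(b*c' - c*b')) $$ (i,j)"
    unfolding quat_def R_def[symmetric]
    unfolding prod s4 nths ones an(3,4) t(2,4-9) sm[OF an(1)] sm[OF an(2)] sm[OF t(1)]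
    unfolding mat_lincomb_def s4 nths index_mat(1)[OF ij] case_prod_conv
    by (simp only: algebra_simps) simp
qed (auto simp: quat_def mat_lincomb_def)

lemma quat_rot:
  assumes "anticomm N P Q"
  shows "rot N P s = quat N P Q (cos (s/2)) (\<i> * sin (s/2)) 0 0"
    "rot N Q s = quat N P Q (cos (s/2)) 0 (\<i> * sin (s/2)) 0"
    "rot N (\<i> \<cdot>\<^sub>m (Q * P)) s = quat N P Q (cos (s/2)) 0 0 (\<i> * sin (s/2))"
  using anticommD(1,2)[OF assms] quat_table(1)[OF assms refl]
  by (auto intro!: eq_matI simp: rot_def quat_def mat_lincomb_def numeral_eq_Suc simp del: index_mult_mat(1))

lemma cos_sin_half:
  "cos s = (cos (s/2))\<^sup>2 - (sin (s/2))\<^sup>2" "sin s = 2 * sin (s/2) * cos (s/2)" for s :: real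
  using cos_double[of "s/2"] sin_double[of "s/2"] by auto

lemma rot_add:
  assumes "anticomm N P Q"
  shows "rot N P (s + t) = rot N P s * rot N P t"
  unfolding quat_rot(1)[OF assms] quat_mult[OF assms]
  by (rule quat_eqI) (simp_all add: add_divide_distrib cos_add sin_add algebra_simps)

lemma rot_zero [simp]: "anticomm N P Q \<Longrightarrow> rot N P 0 = 1\<^sub>m N"
  unfolding rot_def by (auto intro!: eq_matI dest: anticommD)

lemma rot_madj:
  assumes "P \<in> carrier_mat N N" "madj P = P"
  shows "madj (rot N P s) = rot N P (- s)"
  using assms by (simp add: rot_def madj_add[of _ N N] madj_smult)

lemma rot_uminus: "P \<in> carrier_mat N N \<Longrightarrow> rot N (- P) s = rot N P (- s)"
  by (auto intro!: eq_matI simp: rot_def)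

lemma rot_unitary:
  assumes "anticomm N P Q"
  shows "unitary_mat N (rot N P s)"
  using rot_add[OF assms, of s "- s"] rot_add[OF assms, of "- s" s] assms
    rot_madj[OF anticommD(1,5)[OF assms]] anticommD(1)[OF assms]
  by (simp add: unitary_mat_def)

text \<open>Conjugation by \<open>Q\<close> inverts a rotation about \<open>P\<close>, so its
  determinant equals its inverse and has square \<open>1\<close>. Every rotation is the square of
  the rotation by half the angle, hence the determinant is \<open>1\<close>.\<close>

lemma rot_SU:
  assumes "anticomm N P Q"
  shows "rot N P s \<in> SU N"
proof -
  note a = anticommD[OF assms]
  have det_sq: "det (rot N P s) * det (rot N P s) = 1" for s
  proof -
    have rc: "rot N P s \<in> carrier_mat N N" for s using a by simp
    have "Q * rot N P s = rot N P (- s) * Q"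
    proof -
      have "Q = quat N P Q 0 0 1 0"
        using a(1,2) by (auto intro!: eq_matI simp: quat_def mat_lincomb_def numeral_eq_Suc simp del: index_mult_mat(1))
      then show ?thesis
        using quat_mult[OF assms, of 0 0 1 0 "cos (s/2)" "\<i> * sin (s/2)" 0 0]
          quat_mult[OF assms, of "cos (s/2)" "- (\<i> * sin (s/2))" 0 0 0 0 1 0]
        by (simp add: quat_rot(1)[OF assms])
    qed
    then have "det Q * det (rot N P s) = det (rot N P (- s)) * det Q"
      using det_mult[OF a(2) rc] det_mult[OF rc a(2)] by metis
    moreover have "det Q * det Q = 1"
      using det_mult[OF a(2) a(2)] a(4) by simp
    ultimately have eq: "det (rot N P s) = det (rot N P (- s))"
      by (metis mult.commute mult.left_neutral mult.assoc)
    have "det (rot N P s) * det (rot N P (- s)) = det (rot N P (s + - s))"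
      unfolding rot_add[OF assms] using det_mult[OF rc rc] by simp
    then show ?thesis using eq assms by simp
  qed
  have "det (rot N P s) = det (rot N P (s/2 + s/2))" by simp
  also have "\<dots> = det (rot N P (s/2)) * det (rot N P (s/2))"
    unfolding rot_add[OF assms] using a by (intro det_mult[of _ N]) auto
  finally have "det (rot N P s) = 1" using det_sq by simp
  then show ?thesis using rot_unitary[OF assms] by (simp add: SU_def)
qed

text \<open>The two sides of the Euler-angle identity in coordinates: a rotation about
  \<open>P\<close> conjugated by one about \<open>Q\<close>, and a rotation about \<open>R\<close>
  between two equal rotations about \<open>P\<close>.\<close>

lemma quat_sandwich:
  assumes "anticomm N P Q"
  shows "quat N P Q c 0 (\<i> * z) 0 * quat N P Q C (\<i> * S) 0 0 * quat N P Q c 0 (- (\<i> * z)) 0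
      = quat N P Q (C * (c\<^sup>2 + z\<^sup>2)) (\<i> * (S * (c\<^sup>2 - z\<^sup>2))) 0 (\<i> * (2 * z * c * S))"
    "quat N P Q c (\<i> * z) 0 0 * quat N P Q C 0 0 (\<i> * S) * quat N P Q c (\<i> * z) 0 0
      = quat N P Q (C * (c\<^sup>2 - z\<^sup>2)) (\<i> * (C * (2 * z * c))) 0 (\<i> * (S * (c\<^sup>2 + z\<^sup>2)))"
  unfolding quat_mult[OF assms]
  by (intro quat_eqI; simp add: algebra_simps power2_eq_square)+

text \<open>Euler angles: the rotation about the axis \<open>cos \<phi> P + sin \<phi> R\<close> is a product of three
  rotations about \<open>P\<close> and \<open>R\<close>, with angles that depend smoothly on \<open>s\<close>.\<close>

lemma rot_conj_euler:
  fixes \<phi> s :: real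
  assumes "anticomm N P Q" and s: "\<bar>s\<bar> < pi"
  defines "a \<equiv> arctan (cos \<phi> * tan (s/2))" and "b \<equiv> 2 * arcsin (sin \<phi> * sin (s/2))"
  shows "rot N Q \<phi> * rot N P s * rot N Q (- \<phi>)
    = rot N P a * rot N (\<i> \<cdot>\<^sub>m (Q * P)) b * rot N P a"
proof -
  \<comment> \<open>By \<open>quat_sandwich\<close> the identity amounts to
    \<open>cos (b/2) * cos a = C\<close>, \<open>cos (b/2) * sin a = x * S\<close> and
    \<open>sin (b/2) = y * S\<close>. The last equation gives \<open>b\<close>, the quotient of the
    first two gives \<open>a\<close>; \<open>\<bar>s\<bar> < pi\<close> ensures
    \<open>C > 0\<close>, so that \<open>arctan\<close> is the right branch.\<close>
  define x y C S where "x = cos \<phi>" "y = sin \<phi>" "C = cos (s/2)" "S = sin (s/2)"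
  note defs = this
  have C: "C > 0" using s unfolding defs by (intro cos_gt_zero_pi) auto
  have xy: "x\<^sup>2 + y\<^sup>2 = 1" "C\<^sup>2 + S\<^sup>2 = 1" by (simp_all add: defs)
  define T where "T = sqrt (C\<^sup>2 + (x * S)\<^sup>2)"
  have T: "T > 0" using C by (simp add: T_def add_pos_nonneg)
  have "(y * S)\<^sup>2 = 1 - (C\<^sup>2 + (x * S)\<^sup>2)"
  proof -
    have "x\<^sup>2 * S\<^sup>2 + y\<^sup>2 * S\<^sup>2 = S\<^sup>2" using xy by (simp flip: distrib_right)
    then show ?thesis using xy by (simp add: power_mult_distrib)
  qed
  then have yS: "1 - (y * S)\<^sup>2 = C\<^sup>2 + (x * S)\<^sup>2" by simp
  have "(y * S)\<^sup>2 \<le> 1\<^sup>2" using yS by (metis add_nonneg_nonneg diff_ge_0_iff_ge one_power2 zero_le_power2)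
  then have "\<bar>y * S\<bar> \<le> 1" by (simp add: abs_square_le_1)
  then have ab: "-1 \<le> y * S" "y * S \<le> 1" by auto
  have sb: "sin (b/2) = y * S" unfolding b_def using ab by (simp add: defs)
  have cb: "cos (b/2) = T"
    using ab cos_arcsin[OF ab] unfolding b_def T_def by (simp add: defs[symmetric] yS)
  have sq: "sqrt (1 + (x * S / C)\<^sup>2) = T / C"
  proof -
    have "1 + (x * S / C)\<^sup>2 = (C\<^sup>2 + (x * S)\<^sup>2) / C\<^sup>2" using C by (simp add: field_simps)
    then show ?thesis using C by (simp add: T_def real_sqrt_divide)
  qed
  have a: "a = arctan (x * S / C)" unfolding a_def by (simp add: defs tan_def)
  have ca: "cos a = C / T" unfolding a cos_arctan sq by simp
  have sa: "sin a = x * S / T" unfolding a sin_arctan sq using C by simp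
  have unit: "complex_of_real (cos u)^2 + complex_of_real (sin u)^2 = 1" for u
    by (metis of_real_1 of_real_add of_real_power sin_cos_squared_add2)
  have half: "complex_of_real (cos (u/2))^2 - complex_of_real (sin (u/2))^2 = cos u"
    "2 * complex_of_real (sin (u/2)) * complex_of_real (cos (u/2)) = sin u" for u
    unfolding cos_sin_half[of u] by simp_all
  have "rot N Q \<phi> * rot N P s * rot N Q (- \<phi>) = quat N P Q C (\<i> * (x * S)) 0 (\<i> * (y * S))"
    using quat_sandwich(1)[OF assms(1), of "cos (\<phi>/2)" "sin (\<phi>/2)" C S]
    unfolding unit half by (simp add: quat_rot[OF assms(1)] defs mult.commute)
  moreover have "rot N P a * rot N (\<i> \<cdot>\<^sub>m (Q * P)) b * rot N P a
      = quat N P Q (cos (b/2) * cos a) (\<i> * (cos (b/2) * sin a)) 0 (\<i> * sin (b/2))"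
    using quat_sandwich(2)[OF assms(1), of "cos (a/2)" "sin (a/2)" "cos (b/2)" "sin (b/2)"]
    unfolding unit half by (simp add: quat_rot[OF assms(1)])
  ultimately show ?thesis using T C by (simp add: ca sa sb cb)
qed

text \<open>In \<open>rot_conj_euler\<close> the angle \<open>a\<close> occurs twice, so the two
  halves of \<open>cos \<phi>\<close> add up in the derivative.\<close>

lemma euler_angle_derivs:
  "((\<lambda>s. arctan (cos \<phi> * tan (s/2))) has_real_derivative cos \<phi> / 2) (at 0)"
  "((\<lambda>s. 2 * arcsin (sin \<phi> * sin (s/2))) has_real_derivative sin \<phi>) (at 0)"
  by (auto intro!: derivative_eq_intros)

section \<open>Differentiating a unitary representation\<close>

lemma SU_D:
  assumes "U \<in> SU N"
  shows "U \<in> carrier_mat N N" "unitary_mat N U" "det U = 1"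
  using assms by (auto simp: SU_def unitary_mat_def)

lemma one_SU: "1\<^sub>m N \<in> SU N"
  by (simp add: SU_def unitary_mat_one)

lemma mult_SU: "U \<in> SU N \<Longrightarrow> V \<in> SU N \<Longrightarrow> U * V \<in> SU N"
  using det_mult[of U N V] by (auto simp: SU_def unitary_mat_mult dest: unitary_matD(1))

lemma det_madj:
  assumes "A \<in> carrier_mat N N"
  shows "det (madj A) = cnj (det A)"
proof -
  have perm: "p i < N" if "p permutes {0..<N}" "i < N" for p i
    using permutes_in_image[OF that(1), of i] that(2) by simp
  have "det (madj A) = det (mconj A)"
    unfolding madj_def using assms by (intro det_transpose[of _ N]) (auto simp: mconj_def)
  also have "\<dots> = cnj (det A)"
    using assms by (auto simp: det_def mconj_def sign_def perm intro!: sum.cong prod.cong)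
  finally show ?thesis .
qed

lemma madj_SU: "U \<in> SU N \<Longrightarrow> madj U \<in> SU N"
  by (auto simp: SU_def unitary_mat_madj det_madj dest: unitary_matD(1))

locale su_rep =
  fixes N d :: nat and \<rho> :: "complex mat \<Rightarrow> complex mat"
  assumes rep: "unitary_rep N d \<rho>"
begin

lemma rho_unitary: "U \<in> SU N \<Longrightarrow> unitary_mat d (\<rho> U)"
  using rep by (simp add: unitary_rep_def)

lemma rho_carrier: "U \<in> SU N \<Longrightarrow> \<rho> U \<in> carrier_mat d d"
  using rho_unitary unitary_matD(1) by blast

lemma rho_mult: "U \<in> SU N \<Longrightarrow> V \<in> SU N \<Longrightarrow> \<rho> (U * V) = \<rho> U * \<rho> V"
  using rep by (simp add: unitary_rep_def)

lemma rho_one: "\<rho> (1\<^sub>m N) = 1\<^sub>m d"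
proof -
  let ?A = "\<rho> (1\<^sub>m N)"
  note u = unitary_matD[OF rho_unitary[OF one_SU]]
  have "?A * ?A = ?A" using rho_mult[OF one_SU one_SU] by simp
  then have "madj ?A * (?A * ?A) = 1\<^sub>m d" using u by simp
  moreover have "madj ?A * (?A * ?A) = ?A"
    using u by (simp add: assoc_mult_mat[OF u(2) u(1) u(1), symmetric])
  ultimately show ?thesis by simp
qed

lemma rho_entry_continuous:
  assumes U: "U \<in> SU N" and e: "e > 0"
  shows "\<exists>\<delta>>0. \<forall>V\<in>SU N. (\<Sum>i<N. \<Sum>j<N. cmod (U $$ (i,j) - V $$ (i,j))) < \<delta> \<longrightarrow>
           (\<forall>i<d. \<forall>j<d. cmod (\<rho> U $$ (i,j) - \<rho> V $$ (i,j)) < e)"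
proof -
  obtain \<delta> where \<delta>: "\<delta> > 0" "\<And>V. V \<in> SU N \<Longrightarrow> op_norm (U - V) < \<delta> \<Longrightarrow> op_norm (\<rho> U - \<rho> V) < e"
    using rep U e unfolding unitary_rep_def by meson
  show ?thesis
  proof (intro exI[of _ \<delta>] conjI ballI impI allI)
    fix V i j assume V: "V \<in> SU N" and s: "(\<Sum>i<N. \<Sum>j<N. cmod (U $$ (i,j) - V $$ (i,j))) < \<delta>"
      and ij: "i < d" "j < d"
    have c: "U - V \<in> carrier_mat N N" "\<rho> U - \<rho> V \<in> carrier_mat d d"
      using SU_D(1)[OF V] rho_carrier[OF V] by (auto intro: minus_carrier_mat)
    have "op_norm (U - V) \<le> (\<Sum>i<N. \<Sum>j<N. cmod ((U - V) $$ (i,j)))"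
      by (rule op_norm_le_sum[OF c(1)])
    also have "\<dots> < \<delta>" using s SU_D(1)[OF U] SU_D(1)[OF V] by simp
    finally have "op_norm (\<rho> U - \<rho> V) < e" using \<delta>(2)[OF V] by simp
    moreover have "cmod ((\<rho> U - \<rho> V) $$ (i,j)) \<le> op_norm (\<rho> U - \<rho> V)"
      by (rule cmod_index_le_op_norm[OF c(2) ij])
    ultimately show "cmod (\<rho> U $$ (i,j) - \<rho> V $$ (i,j)) < e"
      using ij rho_carrier[OF U] rho_carrier[OF V] by simp
  qed (use \<delta> in simp)
qed

lemma rho_entry_tendsto:
  assumes g: "eventually (\<lambda>s. \<gamma> s \<in> SU N) F" and U: "U \<in> SU N"
    and lim: "\<And>i j. i < N \<Longrightarrow> j < N \<Longrightarrow> ((\<lambda>s. \<gamma> s $$ (i,j)) \<longlongrightarrow> U $$ (i,j)) F"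
    and ij: "i < d" "j < d"
  shows "((\<lambda>s. \<rho> (\<gamma> s) $$ (i,j)) \<longlongrightarrow> \<rho> U $$ (i,j)) F"
proof (rule tendstoI)
  fix e :: real assume "e > 0"
  from rho_entry_continuous[OF U this] obtain \<delta> where \<delta>: "\<delta> > 0"
    "\<And>V. V \<in> SU N \<Longrightarrow> (\<Sum>i<N. \<Sum>j<N. cmod (U $$ (i,j) - V $$ (i,j))) < \<delta> \<Longrightarrow>
           cmod (\<rho> U $$ (i,j) - \<rho> V $$ (i,j)) < e"
    using ij by blast
  have "((\<lambda>s. \<Sum>i<N. \<Sum>j<N. cmod (U $$ (i,j) - \<gamma> s $$ (i,j))) \<longlongrightarrow> (\<Sum>i<N. \<Sum>j<N. cmod (U $$ (i,j) - U $$ (i,j)))) F"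
    by (intro tendsto_intros lim) auto
  then have "((\<lambda>s. \<Sum>i<N. \<Sum>j<N. cmod (U $$ (i,j) - \<gamma> s $$ (i,j))) \<longlongrightarrow> 0) F" by simp
  then have "eventually (\<lambda>s. (\<Sum>i<N. \<Sum>j<N. cmod (U $$ (i,j) - \<gamma> s $$ (i,j))) < \<delta>) F"
    using \<delta>(1) by (rule order_tendstoD)
  then show "eventually (\<lambda>s. dist (\<rho> (\<gamma> s) $$ (i,j)) (\<rho> U $$ (i,j)) < e) F"
    using g by eventually_elim (auto simp: dist_norm norm_minus_commute intro: \<delta>(2))
qed

definition rhot :: "complex mat \<Rightarrow> real \<Rightarrow> complex mat" where
  "rhot X s = \<rho> (rot N X s)"

text \<open>The Lie algebra representation at \<open>\<i> X / 2\<close>. As a total function it is a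
  default value wherever the derivative fails to exist; \<open>rhot_deriv0\<close> shows that it is
  the derivative for every involution with an anticommuting partner.\<close>

definition drho :: "complex mat \<Rightarrow> complex mat" where
  "drho X = mat d d (\<lambda>(i,j). vector_derivative (\<lambda>s. rhot X s $$ (i,j)) (at 0))"

lemma drho_carrier [simp]: "drho X \<in> carrier_mat d d"
  by (simp add: drho_def)

lemma rhot_unitary: "anticomm N P Q \<Longrightarrow> unitary_mat d (rhot P s)"
  unfolding rhot_def by (rule rho_unitary[OF rot_SU])

lemma rhot_carrier: "anticomm N P Q \<Longrightarrow> rhot P s \<in> carrier_mat d d"
  by (rule unitary_matD(1)[OF rhot_unitary])

lemma rhot_add: "anticomm N P Q \<Longrightarrow> rhot P (s + t) = rhot P s * rhot P t"
  unfolding rhot_def by (simp add: rot_add rho_mult rot_SU)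

lemma rhot_zero: "anticomm N P Q \<Longrightarrow> rhot P 0 = 1\<^sub>m d"
  unfolding rhot_def by (simp add: rho_one)

lemma rhot_cont:
  assumes "anticomm N P Q" "i < d" "j < d"
  shows "continuous_on UNIV (\<lambda>s. rhot P s $$ (i,j))"
  unfolding continuous_on_def rhot_def
proof
  fix s :: real
  show "((\<lambda>s. \<rho> (rot N P s) $$ (i,j)) \<longlongrightarrow> \<rho> (rot N P s) $$ (i,j)) (at s within UNIV)"
  proof (rule rho_entry_tendsto)
    fix k l assume "k < N" "l < N"
    then show "((\<lambda>s. rot N P s $$ (k,l)) \<longlongrightarrow> rot N P s $$ (k,l)) (at s within UNIV)"
      using anticommD(1)[OF assms(1)] by (auto simp: rot_def intro!: tendsto_intros)
  qed (use assms rot_SU in auto)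
qed

lemma rhot_deriv0:
  assumes "anticomm N P Q"
  shows "mat_deriv d (rhot P) (drho P) 0"
proof -
  obtain D where D: "D \<in> carrier_mat d d" "mat_deriv d (rhot P) D 0"
    using one_param_group_deriv_zero[of "rhot P" d] rhot_carrier[OF assms] rhot_add[OF assms]
      rhot_zero[OF assms] rhot_cont[OF assms] by blast
  have "drho P = D"
    using D by (intro eq_matI) (auto simp: drho_def mat_deriv_def intro!: vector_derivative_at)
  then show ?thesis using D by simp
qed

lemma rhot_deriv:
  assumes "anticomm N P Q"
  shows "mat_deriv d (rhot P) (rhot P s * drho P) s" "mat_deriv d (rhot P) (drho P * rhot P s) s"
    "rhot P s * drho P = drho P * rhot P s"
  using one_param_group_deriv[of "rhot P" d "drho P" s] rhot_carrier[OF assms] rhot_add[OF assms]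
    rhot_deriv0[OF assms] by auto

lemma rhot_inverse:
  assumes "anticomm N P Q"
  shows "rhot P s * rhot P (- s) = 1\<^sub>m d" "rhot P (- s) * rhot P s = 1\<^sub>m d"
  using rhot_add[OF assms, of s "- s"] rhot_add[OF assms, of "- s" s] rhot_zero[OF assms] by auto

lemma rhot_madj:
  assumes "anticomm N P Q"
  shows "madj (rhot P s) = rhot P (- s)"
proof -
  note u = unitary_matD[OF rhot_unitary[OF assms]]
  have "madj (rhot P s) = madj (rhot P s) * (rhot P s * rhot P (- s))"
    using right_mult_one_mat[OF u(2)] rhot_inverse[OF assms] by simp
  also have "\<dots> = (madj (rhot P s) * rhot P s) * rhot P (- s)"
    using assoc_mult_mat[OF u(2) u(1) u(1)] by simp
  also have "\<dots> = rhot P (- s)" unfolding u(4) by (rule left_mult_one_mat[OF u(1)])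
  finally show ?thesis .
qed

lemma rhot_reflect_deriv:
  assumes "anticomm N P Q"
  shows "mat_deriv d (\<lambda>s. rhot P (- s)) (- drho P) 0"
proof -
  have "mat_deriv d (rhot P) (drho P) (- 0)" using rhot_deriv0[OF assms] by simp
  then have "mat_deriv d (\<lambda>s. rhot P (- s)) (complex_of_real (-1) \<cdot>\<^sub>m drho P) 0"
    by (rule mat_deriv_chain) (auto intro!: derivative_eq_intros)
  then show ?thesis by (simp add: neg_smult_mat)
qed

lemma drho_madj:
  assumes "anticomm N P Q"
  shows "madj (drho P) = - drho P"
proof (rule mat_deriv_unique)
  show "mat_deriv d (\<lambda>s. rhot P (- s)) (madj (drho P)) 0"
    unfolding rhot_madj[OF assms, symmetric] mat_deriv_def
  proof (intro allI impI)
    fix i j assume ij: "i < d" "j < d"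
    have "((\<lambda>s. cnj (rhot P s $$ (j,i))) has_vector_derivative cnj (drho P $$ (j,i))) (at 0)"
      by (intro has_vector_derivative_cnj mat_derivD[OF rhot_deriv0[OF assms]] ij)
    then show "((\<lambda>s. madj (rhot P s) $$ (i,j)) has_vector_derivative madj (drho P) $$ (i,j)) (at 0)"
      using ij carrier_matD[OF rhot_carrier[OF assms]] carrier_matD[OF drho_carrier] by simp
  qed
qed (use rhot_reflect_deriv[OF assms] in auto)

lemma drho_ip:
  assumes "anticomm N P Q" "v \<in> carrier_vec d" "w \<in> carrier_vec d"
  shows "ip (drho P *\<^sub>v v) w = - ip v (drho P *\<^sub>v w)"
proof -
  have "(- drho P) *\<^sub>v w = (-1) \<cdot>\<^sub>v (drho P *\<^sub>v w)"
    using assms(3) carrier_matD[OF drho_carrier] by (intro eq_vecI) (auto simp: scalar_prod_def sum_negf)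
  then show ?thesis
    using ip_madj[OF drho_carrier assms(2,3)] drho_madj[OF assms(1)] assms
    by (simp add: ip_smult_right[of _ d])
qed

lemma drho_uminus:
  assumes "anticomm N P Q"
  shows "drho (- P) = - drho P"
proof -
  have "rhot (- P) = (\<lambda>s. rhot P (- s))"
    by (auto simp: rhot_def rot_uminus[OF anticommD(1)[OF assms]])
  then show ?thesis
    using rhot_reflect_deriv[OF assms] carrier_matD[OF drho_carrier]
    by (intro eq_matI) (auto simp: drho_def[of "- P"] mat_deriv_def intro!: vector_derivative_at)
qed

text \<open>The adjoint action, read off the Euler-angle identity by differentiating at
  \<open>s = 0\<close>. The right-hand side is linear in \<open>drho P\<close> and
  \<open>drho R\<close>, although \<rho> is never differentiated along
  \<open>cos \<phi> P + sin \<phi> R\<close>.\<close>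

lemma drho_conj:
  assumes "anticomm N P Q"
  defines "R \<equiv> \<i> \<cdot>\<^sub>m (Q * P)"
  shows "rhot Q \<phi> * drho P * rhot Q (- \<phi>)
    = complex_of_real (cos \<phi>) \<cdot>\<^sub>m drho P + complex_of_real (sin \<phi>) \<cdot>\<^sub>m drho R"
proof -
  note aP = assms(1) and aQ = anticomm_sym[OF assms(1)]
  have aR: "anticomm N R Q" unfolding R_def by (rule anticomm_third(1)[OF assms(1)])
  note cP = rhot_carrier[OF aP] and cQ = rhot_carrier[OF aQ] and cR = rhot_carrier[OF aR]
  define a where "a s = arctan (cos \<phi> * tan (s/2))" for s
  define b where "b s = 2 * arcsin (sin \<phi> * sin (s/2))" for s
  have ab0: "a 0 = 0" "b 0 = 0" by (simp_all add: a_def b_def)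
  have da: "(a has_real_derivative cos \<phi> / 2) (at 0)" "(b has_real_derivative sin \<phi>) (at 0)"
    unfolding a_def b_def by (rule euler_angle_derivs)+
  have eq: "rhot P (a s) * rhot R (b s) * rhot P (a s) = rhot Q \<phi> * rhot P s * rhot Q (- \<phi>)"
    if "\<bar>s\<bar> < pi" for s
  proof -
    have "\<rho> (rot N Q \<phi> * rot N P s * rot N Q (- \<phi>)) = \<rho> (rot N P (a s) * rot N R (b s) * rot N P (a s))"
      unfolding R_def a_def b_def rot_conj_euler[OF aP that] ..
    then show ?thesis
      unfolding rhot_def
      using rot_SU[OF aP] rot_SU[OF aQ] rot_SU[OF aR] by (simp add: rho_mult mult_SU)
  qed
  define L where "L = rhot Q \<phi> * drho P * rhot Q (- \<phi>)"
  have "mat_deriv d (\<lambda>s. rhot Q \<phi> * rhot P s * rhot Q (- \<phi>)) L 0"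
    unfolding L_def using cP cQ rhot_deriv0[OF aP]
    by (intro mat_deriv_mult_const mat_deriv_const_mult) auto
  define A' where "A' = complex_of_real (cos \<phi> / 2) \<cdot>\<^sub>m drho P"
  define B' where "B' = complex_of_real (sin \<phi>) \<cdot>\<^sub>m drho R"
  have A'c: "A' \<in> carrier_mat d d" and B'c: "B' \<in> carrier_mat d d" by (auto simp: A'_def B'_def)
  have dA: "mat_deriv d (\<lambda>s. rhot P (a s)) A' 0"
    unfolding A'_def by (rule mat_deriv_chain[OF _ da(1)]) (use rhot_deriv0[OF aP] in \<open>auto simp: ab0\<close>)
  have dB: "mat_deriv d (\<lambda>s. rhot R (b s)) B' 0"
    unfolding B'_def by (rule mat_deriv_chain[OF _ da(2)]) (use rhot_deriv0[OF aR] in \<open>auto simp: ab0\<close>)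
  have "mat_deriv d (\<lambda>s. rhot P (a s) * rhot R (b s)) (rhot P (a 0) * B' + A' * rhot R (b 0)) 0"
    using cP cR A'c B'c by (intro mat_deriv_mult dA dB) auto
  then have dAB: "mat_deriv d (\<lambda>s. rhot P (a s) * rhot R (b s)) (B' + A') 0"
    using A'c B'c by (simp add: ab0 rhot_zero[OF aP] rhot_zero[OF aR])
  have "mat_deriv d (\<lambda>s. rhot P (a s) * rhot R (b s) * rhot P (a s))
      (rhot P (a 0) * rhot R (b 0) * A' + (B' + A') * rhot P (a 0)) 0"
    using cP cR A'c B'c by (intro mat_deriv_mult dA dAB) auto
  then have "mat_deriv d (\<lambda>s. rhot P (a s) * rhot R (b s) * rhot P (a s)) (A' + (B' + A')) 0"
    using A'c B'c by (simp add: ab0 rhot_zero[OF aP] rhot_zero[OF aR])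
  \<comment> \<open>The identity is available only for \<open>\<bar>s\<bar> < pi\<close>, which
    suffices for a derivative at \<open>0\<close>.\<close>
  then have "mat_deriv d (\<lambda>s. rhot Q \<phi> * rhot P s * rhot Q (- \<phi>)) (A' + (B' + A')) 0"
  proof (rule mat_deriv_transform)
    have "eventually (\<lambda>s. s \<in> {-pi<..<pi}) (nhds (0::real))"
      by (rule eventually_nhds_in_open) auto
    then show "\<forall>\<^sub>F s in nhds 0. rhot P (a s) * rhot R (b s) * rhot P (a s) = rhot Q \<phi> * rhot P s * rhot Q (- \<phi>)"
      by eventually_elim (auto intro!: eq)
  qed
  then have "L = A' + (B' + A')"
    using \<open>mat_deriv d (\<lambda>s. rhot Q \<phi> * rhot P s * rhot Q (- \<phi>)) L 0\<close>
    by (intro mat_deriv_unique[of d _ L 0]) (use cQ A'c B'c in \<open>auto simp: L_def\<close>)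
  then show ?thesis
    unfolding L_def using carrier_matD[OF drho_carrier]
    by (auto intro!: eq_matI simp: A'_def B'_def simp del: index_mult_mat(1))
qed

text \<open>The derivative of \<open>drho_conj\<close> at \<open>\<phi> = 0\<close>. The half angle
  in \<open>rot\<close> makes the structure constant equal to \<open>1\<close>.\<close>

lemma drho_commutator:
  assumes "anticomm N P Q"
  shows "drho Q * drho P = drho P * drho Q + drho (\<i> \<cdot>\<^sub>m (Q * P))"
proof -
  define R where "R = \<i> \<cdot>\<^sub>m (Q * P)"
  note aQ = anticomm_sym[OF assms]
  note cQ = rhot_carrier[OF aQ]
  have 1: "mat_deriv d (\<lambda>\<phi>. rhot Q \<phi> * drho P * rhot Q (- \<phi>))
      (rhot Q 0 * drho P * (- drho Q) + (drho Q * drho P) * rhot Q (- 0)) 0"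
    using cQ by (intro mat_deriv_mult mat_deriv_mult_const rhot_deriv0[OF aQ] rhot_reflect_deriv[OF aQ]) auto
  have 2: "mat_deriv d (\<lambda>\<phi>. complex_of_real (cos \<phi>) \<cdot>\<^sub>m drho P + complex_of_real (sin \<phi>) \<cdot>\<^sub>m drho R) (drho R) 0"
    unfolding mat_deriv_def
  proof (intro allI impI)
    fix i j assume ij: "i < d" "j < d"
    have c: "((\<lambda>\<phi>. complex_of_real (cos \<phi>)) has_vector_derivative complex_of_real 0) (at 0)"
      by (intro has_vector_derivative_of_real) (auto intro!: derivative_eq_intros simp flip: has_real_derivative_iff_has_vector_derivative)
    have s: "((\<lambda>\<phi>. complex_of_real (sin \<phi>)) has_vector_derivative complex_of_real 1) (at 0)"
      by (intro has_vector_derivative_of_real) (auto intro!: derivative_eq_intros simp flip: has_real_derivative_iff_has_vector_derivative)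
    have "((\<lambda>\<phi>. complex_of_real (cos \<phi>) * drho P $$ (i,j) + complex_of_real (sin \<phi>) * drho R $$ (i,j))
        has_vector_derivative (complex_of_real 0 * drho P $$ (i,j) + complex_of_real 1 * drho R $$ (i,j))) (at 0)"
      by (intro has_vector_derivative_add has_vector_derivative_mult_left c s)
    then show "((\<lambda>\<phi>. (complex_of_real (cos \<phi>) \<cdot>\<^sub>m drho P + complex_of_real (sin \<phi>) \<cdot>\<^sub>m drho R) $$ (i,j))
        has_vector_derivative drho R $$ (i,j)) (at 0)"
      using ij carrier_matD[OF drho_carrier] by simp
  qed
  have "rhot Q 0 * drho P * (- drho Q) + (drho Q * drho P) * rhot Q (- 0) = drho R"
    by (rule mat_deriv_unique[OF 1]) (use 2 drho_conj[OF assms] cQ in \<open>auto simp: R_def\<close>)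
  then have "drho P * (- drho Q) + drho Q * drho P = drho R"
    by (simp add: rhot_zero[OF aQ] right_mult_one_mat[of _ d d] left_mult_one_mat[of _ d d])
  moreover have "drho P * (- drho Q) = - (drho P * drho Q)"
    by (rule uminus_mult_right_mat) (use carrier_matD[OF drho_carrier] in auto)
  ultimately have "drho R = - (drho P * drho Q) + drho Q * drho P" by simp
  then show ?thesis
    unfolding R_def[symmetric] using carrier_matD[OF drho_carrier]
    by (auto intro!: eq_matI simp del: index_mult_mat(1))
qed

lemma drho_commute:
  assumes P: "anticomm N P P'" and Q: "anticomm N Q Q'" and "Q * P = P * Q"
  shows "rhot Q \<phi> * drho P = drho P * rhot Q \<phi>"
proof -
  note cP = rhot_carrier[OF P] and cQ = rhot_carrier[OF Q]
  note a = anticommD[OF P] anticommD[OF Q]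
  have rr: "rot N Q \<phi> * rot N P s = rot N P s * rot N Q \<phi>" for s
  proof -
    have e: "(x \<cdot>\<^sub>m 1\<^sub>m N + y \<cdot>\<^sub>m A) * (z \<cdot>\<^sub>m 1\<^sub>m N + w \<cdot>\<^sub>m B)
        = ((x * z) \<cdot>\<^sub>m 1\<^sub>m N + (y * z) \<cdot>\<^sub>m A) + ((x * w) \<cdot>\<^sub>m B + (y * w) \<cdot>\<^sub>m (A * B))"
      if "A \<in> carrier_mat N N" "B \<in> carrier_mat N N" for x y z w and A B :: "complex mat"
    proof -
      have "(x \<cdot>\<^sub>m 1\<^sub>m N + y \<cdot>\<^sub>m A) * (z \<cdot>\<^sub>m 1\<^sub>m N + w \<cdot>\<^sub>m B)
          = (x \<cdot>\<^sub>m 1\<^sub>m N + y \<cdot>\<^sub>m A) * (z \<cdot>\<^sub>m 1\<^sub>m N) + (x \<cdot>\<^sub>m 1\<^sub>m N + y \<cdot>\<^sub>m A) * (w \<cdot>\<^sub>m B)"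
        using that by (intro mult_add_distrib_mat[of _ N N]) auto
      also have "(x \<cdot>\<^sub>m 1\<^sub>m N + y \<cdot>\<^sub>m A) * (z \<cdot>\<^sub>m 1\<^sub>m N) = z \<cdot>\<^sub>m (x \<cdot>\<^sub>m 1\<^sub>m N + y \<cdot>\<^sub>m A)"
        using that by (subst mult_smult_distrib[of _ N N _ N]) (auto simp: right_mult_one_mat[of _ N N])
      also have "(x \<cdot>\<^sub>m 1\<^sub>m N + y \<cdot>\<^sub>m A) * (w \<cdot>\<^sub>m B) = w \<cdot>\<^sub>m ((x \<cdot>\<^sub>m 1\<^sub>m N + y \<cdot>\<^sub>m A) * B)"
        using that by (intro mult_smult_distrib[of _ N N _ N]) auto
      also have "(x \<cdot>\<^sub>m 1\<^sub>m N + y \<cdot>\<^sub>m A) * B = (x \<cdot>\<^sub>m 1\<^sub>m N) * B + (y \<cdot>\<^sub>m A) * B"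
        using that by (intro add_mult_distrib_mat[of _ N N]) auto
      also have "(x \<cdot>\<^sub>m 1\<^sub>m N) * B = x \<cdot>\<^sub>m B"
        using that by (subst mult_smult_assoc_mat[of _ N N _ N]) auto
      also have "(y \<cdot>\<^sub>m A) * B = y \<cdot>\<^sub>m (A * B)"
        using that by (intro mult_smult_assoc_mat[of _ N N _ N]) auto
      finally show ?thesis
        using that by (auto intro!: eq_matI simp: algebra_simps simp del: index_mult_mat(1))
    qed
    show ?thesis
      unfolding rot_def e[OF a(8,1)] e[OF a(1,8)] assms(3) using a(1,8)
      by (intro eq_matI) (auto simp: algebra_simps simp del: index_mult_mat(1))
  qed
  have rr': "rhot Q \<phi> * rhot P s = rhot P s * rhot Q \<phi>" for s
    unfolding rhot_def using rr[of s] rot_SU[OF P] rot_SU[OF Q] by (metis rho_mult)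
  have "mat_deriv d (\<lambda>s. rhot Q \<phi> * rhot P s) (rhot Q \<phi> * drho P) 0"
    using cP cQ by (intro mat_deriv_const_mult rhot_deriv0[OF P]) auto
  moreover have "mat_deriv d (\<lambda>s. rhot P s * rhot Q \<phi>) (drho P * rhot Q \<phi>) 0"
    using cP cQ by (intro mat_deriv_mult_const rhot_deriv0[OF P]) auto
  ultimately show ?thesis
    unfolding rr' by (rule mat_deriv_unique) (use cQ in auto)
qed

end

section \<open>Pauli strings\<close>

lemma sum_div_mod:
  fixes f :: "nat \<Rightarrow> nat \<Rightarrow> 'a::comm_monoid_add"
  shows "(\<Sum>k<a * b. f (k div b) (k mod b)) = (\<Sum>i<a. \<Sum>j<b. f i j)"
proof (cases "b = 0")
  case False
  have "(\<Sum>k<a * b. f (k div b) (k mod b)) = (\<Sum>(i,j)\<in>{..<a} \<times> {..<b}. f i j)"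
  proof (rule sum.reindex_bij_witness[of _ "\<lambda>(i,j). i * b + j" "\<lambda>k. (k div b, k mod b)"])
    fix p assume "p \<in> {..<a} \<times> {..<b}"
    then obtain i j where p: "p = (i,j)" "i < a" "j < b" by auto
    then show "(case p of (i,j) \<Rightarrow> i * b + j) \<in> {..<a * b}"
      using mult_le_mono1[of "Suc i" a b] by auto
  qed (use False in \<open>auto simp: less_mult_imp_div_less\<close>)
  then show ?thesis by (simp add: sum.cartesian_product)
qed simp

lemma block_index_less: "(i::nat) < a \<Longrightarrow> k < b \<Longrightarrow> i * b + k < a * b"
  using mult_le_mono1[of "Suc i" a b] by simp

lemma mod_less_of_less_mult: "(i::nat) < a * b \<Longrightarrow> i mod b < b"
  by (cases b) auto

lemma kron_carrier [simp]:
  "A \<in> carrier_mat a b \<Longrightarrow> B \<in> carrier_mat c e \<Longrightarrow> kron A B \<in> carrier_mat (a * c) (b * e)"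
  by (auto simp: kron_def)

lemma kron_index:
  "\<lbrakk>A \<in> carrier_mat a b; B \<in> carrier_mat c e; i < a * c; j < b * e\<rbrakk> \<Longrightarrow>
     kron A B $$ (i,j) = A $$ (i div c, j div e) * B $$ (i mod c, j mod e)"
  by (auto simp: kron_def)

lemma kron_block:
  assumes "A \<in> carrier_mat a a" "B \<in> carrier_mat b b" "i < a" "j < a" "k < b" "l < b"
  shows "kron A B $$ (i * b + k, j * b + l) = A $$ (i,j) * B $$ (k,l)"
proof -
  have "i * b + k < a * b" "j * b + l < a * b"
    using assms mult_le_mono1[of "Suc i" a b] mult_le_mono1[of "Suc j" a b] by auto
  then show ?thesis using assms by (simp add: kron_index[OF assms(1,2)])
qed

lemma kron_mult:
  assumes "A \<in> carrier_mat a a" "C \<in> carrier_mat a a" "B \<in> carrier_mat b b" "D \<in> carrier_mat b b"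
  shows "kron A B * kron C D = kron (A * C) (B * D)"
proof (rule eq_matI)
  fix i j assume "i < dim_row (kron (A * C) (B * D))" "j < dim_col (kron (A * C) (B * D))"
  then have ij: "i < a * b" "j < a * b" using assms by (auto simp: kron_def)
  then have ij': "i div b < a" "j div b < a" "i mod b < b" "j mod b < b"
    by (auto simp: less_mult_imp_div_less simp: mod_less_of_less_mult)
  have "(kron A B * kron C D) $$ (i,j) = (\<Sum>k<a * b. (A $$ (i div b, k div b) * B $$ (i mod b, k mod b)) * (C $$ (k div b, j div b) * D $$ (k mod b, j mod b)))"
    using assms ij by (subst mult_index[of _ "a * b" "a * b" _ "a * b"]) (auto simp: kron_index[of _ a a _ b b])
  also have "\<dots> = (\<Sum>k<a. \<Sum>l<b. (A $$ (i div b, k) * B $$ (i mod b, l)) * (C $$ (k, j div b) * D $$ (l, j mod b)))"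
    by (rule sum_div_mod)
  also have "\<dots> = (\<Sum>k<a. A $$ (i div b, k) * C $$ (k, j div b)) * (\<Sum>l<b. B $$ (i mod b, l) * D $$ (l, j mod b))"
    by (simp add: sum_product ac_simps)
  also have "\<dots> = (A * C) $$ (i div b, j div b) * (B * D) $$ (i mod b, j mod b)"
    using assms ij' by (simp add: mult_index[of _ a a _ a] mult_index[of _ b b _ b] del: index_mult_mat(1))
  also have "\<dots> = kron (A * C) (B * D) $$ (i,j)"
    using assms ij by (subst kron_index[of _ a a _ b b]) auto
  finally show "(kron A B * kron C D) $$ (i,j) = kron (A * C) (B * D) $$ (i,j)" .
qed (use assms in \<open>auto simp: kron_def\<close>)

lemma kron_one: "kron (1\<^sub>m a) (1\<^sub>m b) = 1\<^sub>m (a * b)"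
proof (rule eq_matI)
  fix i j assume "i < dim_row (1\<^sub>m (a * b))" "j < dim_col (1\<^sub>m (a * b))"
  then have ij: "i < a * b" "j < a * b" by auto
  then have ij': "i div b < a" "j div b < a" "i mod b < b" "j mod b < b"
    by (auto simp: less_mult_imp_div_less simp: mod_less_of_less_mult)
  have "i = j \<longleftrightarrow> i div b = j div b \<and> i mod b = j mod b" by (metis div_mult_mod_eq)
  then show "kron (1\<^sub>m a) (1\<^sub>m b) $$ (i,j) = 1\<^sub>m (a * b) $$ (i,j)"
    using ij ij' by (auto simp: kron_index[of _ a a _ b b])
qed (auto simp: kron_def)

lemma kron_madj: "madj (kron A B) = kron (madj A) (madj B)"
proof (rule eq_matI)
  fix i j assume "i < dim_row (kron (madj A) (madj B))" "j < dim_col (kron (madj A) (madj B))"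
  then have "i < dim_col A * dim_col B" "j < dim_row A * dim_row B" by (auto simp: kron_def)
  moreover from this have "i div dim_col B < dim_col A" "j div dim_row B < dim_row A" "i mod dim_col B < dim_col B" "j mod dim_row B < dim_row B"
    by (auto simp: less_mult_imp_div_less simp: mod_less_of_less_mult)
  ultimately show "madj (kron A B) $$ (i,j) = kron (madj A) (madj B) $$ (i,j)"
    by (simp add: kron_def)
qed (auto simp: kron_def)

lemma kron_smult_left: "kron (c \<cdot>\<^sub>m A) B = c \<cdot>\<^sub>m kron A B"
  by (rule eq_matI) (auto simp: kron_def less_mult_imp_div_less)

lemma kron_smult_right: "kron A (c \<cdot>\<^sub>m B) = c \<cdot>\<^sub>m kron A B"
  by (rule eq_matI) (auto simp: kron_def simp: mod_less_of_less_mult)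

section \<open>One-qubit Pauli matrices\<close>

lemma two_by_two_eqI:
  fixes A B :: "complex mat"
  assumes "A \<in> carrier_mat 2 2" "B \<in> carrier_mat 2 2"
    "A $$ (0,0) = B $$ (0,0)" "A $$ (0,1) = B $$ (0,1)" "A $$ (1,0) = B $$ (1,0)" "A $$ (1,1) = B $$ (1,1)"
  shows "A = B"
  using assms by (intro eq_matI) (auto dest!: less_2_cases)

lemma pauli1_carrier [simp]: "pauli1 k \<in> carrier_mat 2 2"
  by (auto simp: pauli1_def sigma_x_def sigma_y_def sigma_z_def mat_of_rows_list_def)

lemma pauli1_index:
  "pauli1 k $$ (0,0) = (if k = 0 then 1 else if k = 1 then 0 else if k = 2 then 0 else 1)"
  "pauli1 k $$ (0,1) = (if k = 0 then 0 else if k = 1 then 1 else if k = 2 then -\<i> else 0)"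
  "pauli1 k $$ (1,0) = (if k = 0 then 0 else if k = 1 then 1 else if k = 2 then \<i> else 0)"
  "pauli1 k $$ (1,1) = (if k = 0 then 1 else if k = 1 then 0 else if k = 2 then 0 else -1)"
  by (auto simp: pauli1_def sigma_x_def sigma_y_def sigma_z_def mat_of_rows_list_def)

lemma mult_two_index:
  "A \<in> carrier_mat 2 2 \<Longrightarrow> B \<in> carrier_mat 2 2 \<Longrightarrow> i < 2 \<Longrightarrow> j < 2 \<Longrightarrow>
    (A * B) $$ (i,j) = A $$ (i,0) * B $$ (0,j) + A $$ (i,1) * B $$ (1,j)" for A B :: "complex mat"
  by (subst mult_index[of _ 2 2 _ 2]) (auto simp: numeral_2_eq_2)

lemma pauli1_sq: "k < 4 \<Longrightarrow> pauli1 k * pauli1 k = 1\<^sub>m 2"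
  by (rule two_by_two_eqI) (auto simp: mult_two_index pauli1_index simp del: index_mult_mat(1) One_nat_def)

lemma pauli1_madj: "madj (pauli1 k) = pauli1 k"
  using carrier_matD[OF pauli1_carrier[of k]]
  by (intro two_by_two_eqI) (auto simp: pauli1_index simp del: One_nat_def)

lemma pauli1_zero: "pauli1 0 = 1\<^sub>m 2"
  by (simp add: pauli1_def)

lemma pauli1_mult:
  assumes "k < 4" "l < 4"
  shows "\<exists>c m. m < 4 \<and> pauli1 k * pauli1 l = c \<cdot>\<^sub>m pauli1 m"
proof -
  \<comment> \<open>The indices \<open>1\<close>, \<open>2\<close>, \<open>3\<close> add up to
    \<open>6\<close>, so \<open>6 - k - l\<close> is the third of them.\<close>
  define m where "m = (if k = l then 0 else if k = 0 then l else if l = 0 then k else 6 - k - l)"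
  have kl: "k = 0 \<or> k = 1 \<or> k = 2 \<or> k = 3" "l = 0 \<or> l = 1 \<or> l = 2 \<or> l = 3" using assms by auto
  have "m < 4" using kl by (auto simp: m_def)
  moreover have "\<exists>c. pauli1 k * pauli1 l = c \<cdot>\<^sub>m pauli1 m"
  proof -
    have "pauli1 k * pauli1 l = c \<cdot>\<^sub>m pauli1 m"
      if "c = (if k = l \<or> k = 0 \<or> l = 0 then 1 else if (k,l) \<in> {(1,2),(2,3),(3,1)} then \<i> else -\<i>)" for c
      using kl unfolding that m_def
      by (elim disjE; hypsubst; intro two_by_two_eqI)
        (simp_all add: mult_two_index pauli1_index carrier_matD[OF pauli1_carrier] del: index_mult_mat(1) One_nat_def)
    then show ?thesis by blast
  qed
  ultimately show ?thesis by blast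
qed

lemma pauli1_commute:
  assumes "k < 4" "l < 4"
  shows "pauli1 l * pauli1 k = (if k = l \<or> k = 0 \<or> l = 0 then 1 else -1) \<cdot>\<^sub>m (pauli1 k * pauli1 l)"
proof -
  have kl: "k = 0 \<or> k = 1 \<or> k = 2 \<or> k = 3" "l = 0 \<or> l = 1 \<or> l = 2 \<or> l = 3" using assms by auto
  then show ?thesis
    by (elim disjE; hypsubst; intro two_by_two_eqI)
      (simp_all add: mult_two_index pauli1_index carrier_matD[OF pauli1_carrier] del: index_mult_mat(1) One_nat_def)
qed

section \<open>Words of Pauli indices and their strings\<close>

definition pauli_words :: "nat \<Rightarrow> nat list set" where
  "pauli_words n = {ks. length ks = n \<and> set ks \<subseteq> {0..<4}}"

lemma pauli_words_0: "pauli_words 0 = {[]}"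
  by (auto simp: pauli_words_def)

lemma pauli_words_Suc: "pauli_words (Suc n) = (\<lambda>(k, ks). k # ks) ` ({..<4} \<times> pauli_words n)"
  by (auto simp: pauli_words_def length_Suc_conv image_iff)

lemma finite_pauli_words: "finite (pauli_words n)"
  using finite_lists_length_eq[of "{0..<4::nat}" n] by (simp add: pauli_words_def conj_commute)

lemma card_pauli_words: "card (pauli_words n) = 4 ^ n"
  using card_lists_length_eq[of "{0..<4::nat}" n] by (simp add: pauli_words_def conj_commute)

lemma pauli_string_carrier [simp]: "pauli_string ks \<in> carrier_mat (2 ^ length ks) (2 ^ length ks)"
  by (induction ks) auto

lemma pauli_string_sq: "set ks \<subseteq> {0..<4} \<Longrightarrow> pauli_string ks * pauli_string ks = 1\<^sub>m (2 ^ length ks)"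
  by (induction ks) (auto simp: kron_mult[OF pauli1_carrier pauli1_carrier pauli_string_carrier pauli_string_carrier] pauli1_sq kron_one)

lemma pauli_string_madj: "madj (pauli_string ks) = pauli_string ks"
  by (induction ks) (auto simp: kron_madj pauli1_madj)

lemma pauli_string_mult:
  assumes "length ks = length ls" "set ks \<subseteq> {0..<4}" "set ls \<subseteq> {0..<4}"
  shows "\<exists>c ms. length ms = length ks \<and> set ms \<subseteq> {0..<4} \<and> pauli_string ks * pauli_string ls = c \<cdot>\<^sub>m pauli_string ms"
  using assms
proof (induction ks ls rule: list_induct2)
  case Nil
  then show ?case by (intro exI[of _ 1] exI[of _ "[]"]) (auto intro!: eq_matI)
next
  case (Cons k ks l ls)
  obtain c ms where 1: "length ms = length ks" "set ms \<subseteq> {0..<4}" "pauli_string ks * pauli_string ls = c \<cdot>\<^sub>m pauli_string ms"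
    using Cons by auto
  obtain c' m where 2: "m < 4" "pauli1 k * pauli1 l = c' \<cdot>\<^sub>m pauli1 m"
    using pauli1_mult[of k l] Cons.prems by auto
  have "pauli_string (k # ks) * pauli_string (l # ls) = kron (pauli1 k * pauli1 l) (pauli_string ks * pauli_string ls)"
    using kron_mult[OF pauli1_carrier pauli1_carrier pauli_string_carrier, of "pauli_string ls" ks k l] Cons.hyps by simp
  also have "\<dots> = (c' * c) \<cdot>\<^sub>m pauli_string (m # ms)"
    unfolding 1 2 kron_smult_left kron_smult_right by (auto intro!: eq_matI)
  finally show ?case
    using 1(1,2) 2(1) by (intro exI[of _ "c' * c"] exI[of _ "m # ms"]) auto
qed

lemma pauli_string_commute:
  assumes "length ks = length ls" "set ks \<subseteq> {0..<4}" "set ls \<subseteq> {0..<4}"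
  shows "\<exists>c\<in>{1,-1}. pauli_string ls * pauli_string ks = c \<cdot>\<^sub>m (pauli_string ks * pauli_string ls)"
  using assms
proof (induction ks ls rule: list_induct2)
  case Nil
  then show ?case by (intro bexI[of _ 1]) (auto intro!: eq_matI)
next
  case (Cons k ks l ls)
  obtain c where 1: "c \<in> {1,-1}" "pauli_string ls * pauli_string ks = c \<cdot>\<^sub>m (pauli_string ks * pauli_string ls)"
    using Cons by auto
  define c' :: complex where "c' = (if k = l \<or> k = 0 \<or> l = 0 then 1 else -1)"
  have 2: "pauli1 l * pauli1 k = c' \<cdot>\<^sub>m (pauli1 k * pauli1 l)"
    unfolding c'_def using Cons.prems by (intro pauli1_commute) auto
  have m: "pauli_string (k # ks) * pauli_string (l # ls) = kron (pauli1 k * pauli1 l) (pauli_string ks * pauli_string ls)"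
    "pauli_string (l # ls) * pauli_string (k # ks) = kron (pauli1 l * pauli1 k) (pauli_string ls * pauli_string ks)"
    using kron_mult[OF pauli1_carrier pauli1_carrier pauli_string_carrier, of "pauli_string ls" ks k l]
      kron_mult[OF pauli1_carrier pauli1_carrier pauli_string_carrier, of "pauli_string ks" ls l k] Cons.hyps
      pauli_string_carrier[of ks] pauli_string_carrier[of ls] by auto
  have "pauli_string (l # ls) * pauli_string (k # ks) = (c' * c) \<cdot>\<^sub>m (pauli_string (k # ks) * pauli_string (l # ls))"
    unfolding m unfolding 1 2 kron_smult_left kron_smult_right by (auto intro!: eq_matI)
  then show ?case using 1(1) by (intro bexI[of _ "c' * c"]) (auto simp: c'_def)
qed

lemma pauli_string_replicate: "pauli_string (replicate n 0) = 1\<^sub>m (2 ^ n)"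
  by (induction n) (auto simp: pauli1_zero kron_one)

text \<open>At the first position with a non-identity letter put a different non-identity letter,
  and the identity at all other positions. Exactly one factor then changes sign.\<close>

lemma pauli_string_anticomm_ex:
  assumes "set ks \<subseteq> {0..<4}" "pauli_string ks \<noteq> 1\<^sub>m (2 ^ length ks)"
  shows "\<exists>ls. length ls = length ks \<and> set ls \<subseteq> {0..<4} \<and>
    pauli_string ls * pauli_string ks = (-1) \<cdot>\<^sub>m (pauli_string ks * pauli_string ls)"
  using assms
proof (induction ks)
  case (Cons k ks)
  let ?A = "pauli_string ks"
  have m: "pauli_string (a # ls) * pauli_string (b # ls') = kron (pauli1 a * pauli1 b) (pauli_string ls * pauli_string ls')"
    if "length ls = length ls'" for a b ls ls'
    using kron_mult[OF pauli1_carrier pauli1_carrier pauli_string_carrier, of "pauli_string ls'" ls a b] that by simp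
  show ?case
  proof (cases "k = 0")
    case True
    then have "?A \<noteq> 1\<^sub>m (2 ^ length ks)"
      using Cons.prems by (auto simp: pauli1_zero kron_one)
    then obtain ls where ls: "length ls = length ks" "set ls \<subseteq> {0..<4}"
      "pauli_string ls * pauli_string ks = (-1) \<cdot>\<^sub>m (pauli_string ks * pauli_string ls)"
      using Cons by auto
    then show ?thesis
      using True by (intro exI[of _ "0 # ls"]) (simp only: m kron_smult_right, simp)
  next
    case False
    define l :: nat where "l = (if k = 1 then 2 else 1)"
    have "pauli1 l * pauli1 k = (-1) \<cdot>\<^sub>m (pauli1 k * pauli1 l)"
      using pauli1_commute[of k l] False Cons.prems by (auto simp: l_def)
    then have "pauli_string (l # replicate (length ks) 0) * pauli_string (k # ks)
      = (-1) \<cdot>\<^sub>m (pauli_string (k # ks) * pauli_string (l # replicate (length ks) 0))"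
      by (subst (1 2) m) (simp_all add: kron_smult_left pauli_string_replicate
          left_mult_one_mat[OF pauli_string_carrier] right_mult_one_mat[OF pauli_string_carrier])
    then show ?thesis by (intro exI[of _ "l # replicate (length ks) 0"]) (auto simp: l_def)
  qed
qed auto

lemma involution_nonzero_entry:
  fixes A :: "complex mat"
  assumes "A \<in> carrier_mat m m" "A * A = 1\<^sub>m m" "m > 0"
  shows "\<exists>i<m. \<exists>j<m. A $$ (i,j) \<noteq> 0"
proof (rule ccontr)
  assume "\<not> ?thesis"
  then have "(A * A) $$ (0,0) = 0"
    using assms by (subst mult_index[of _ m m _ m]) auto
  then show False using assms by simp
qed

text \<open>A nonzero entry of the tail, looked up in each of the four blocks, reproduces the first
  letter up to a factor, and no two one-qubit Pauli matrices are proportional. This both counts the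
  strings correctly and identifies strings that are known only up to a phase.\<close>

lemma pauli_string_scalar_unique:
  assumes "length ks = length ls" "set ks \<subseteq> {0..<4}" "set ls \<subseteq> {0..<4}"
    and "pauli_string ks = c \<cdot>\<^sub>m pauli_string ls"
  shows "c = 1 \<and> ks = ls"
  using assms
proof (induction ks ls rule: list_induct2)
  case Nil
  have "(1\<^sub>m 1 :: complex mat) $$ (0,0) = (c \<cdot>\<^sub>m 1\<^sub>m 1) $$ (0,0)" using Nil by simp
  then show ?case by simp
next
  case (Cons k ks l ls)
  let ?m = "2 ^ length ks :: nat"
  let ?A = "pauli_string ks" and ?B = "pauli_string ls"
  have c: "?A \<in> carrier_mat ?m ?m" "?B \<in> carrier_mat ?m ?m"
    using pauli_string_carrier[of ks] pauli_string_carrier[of ls] Cons.hyps by auto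
  have entry: "pauli1 k $$ (i,j) * ?A $$ (p,q) = c * (pauli1 l $$ (i,j) * ?B $$ (p,q))"
    if "i < 2" "j < 2" "p < ?m" "q < ?m" for i j p q
  proof -
    have "i * ?m + p < 2 * ?m" "j * ?m + q < 2 * ?m"
      using that by (simp_all only: block_index_less)
    moreover have "kron (pauli1 l) ?B \<in> carrier_mat (2 * ?m) (2 * ?m)" using c by simp
    moreover have "kron (pauli1 k) ?A $$ (i * ?m + p, j * ?m + q) = (c \<cdot>\<^sub>m kron (pauli1 l) ?B) $$ (i * ?m + p, j * ?m + q)"
      using Cons.prems by simp
    ultimately show ?thesis
      using kron_block[OF pauli1_carrier c(1) that, of k] kron_block[OF pauli1_carrier c(2) that, of l] by simp
  qed
  obtain p q where pq: "p < ?m" "q < ?m" "?A $$ (p,q) \<noteq> 0"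
    using involution_nonzero_entry[OF c(1)] pauli_string_sq[of ks] Cons.prems by auto
  have kl: "k = 0 \<or> k = 1 \<or> k = 2 \<or> k = 3" "l = 0 \<or> l = 1 \<or> l = 2 \<or> l = 3"
    using Cons.prems by auto
  note e4 = entry[OF _ _ pq(1,2), of 0 0, simplified pauli1_index] entry[OF _ _ pq(1,2), of 0 1, simplified pauli1_index]
    entry[OF _ _ pq(1,2), of 1 0, simplified pauli1_index] entry[OF _ _ pq(1,2), of 1 1, simplified pauli1_index]
  have "k = l"
    using kl e4 pq(3) by (auto split: if_splits)
  moreover have "?A = c \<cdot>\<^sub>m ?B"
  proof (rule eq_matI)
    fix p q assume "p < dim_row (c \<cdot>\<^sub>m ?B)" "q < dim_col (c \<cdot>\<^sub>m ?B)"
    then have pq: "p < ?m" "q < ?m" using c by auto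
    have "?A $$ (p,q) = c * ?B $$ (p,q)"
      using kl \<open>k = l\<close> entry[of 0 0 p q] entry[of 0 1 p q] pq
      by (auto simp: pauli1_index simp del: One_nat_def)
    then show "?A $$ (p,q) = (c \<cdot>\<^sub>m ?B) $$ (p,q)" using pq c by simp
  qed (use c carrier_matD[OF c(1)] in auto)
  ultimately show ?case using Cons by auto
qed

text \<open>A matrix of twice the size is a 2 by 2 matrix of blocks \<open>B a b\<close>. Its
  coefficients \<open>C k\<close> with respect to the one-qubit Pauli matrices are matrices of the
  smaller size, to which induction applies.\<close>

lemma pauli_string_span:
  assumes "M \<in> carrier_mat (2 ^ n) (2 ^ n)"
  shows "\<exists>\<alpha>. \<forall>i<2^n. \<forall>j<2^n. M $$ (i,j) = (\<Sum>ks\<in>pauli_words n. \<alpha> ks * pauli_string ks $$ (i,j))"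
  using assms
proof (induction n arbitrary: M)
  case 0
  then show ?case by (intro exI[of _ "\<lambda>_. M $$ (0,0)"]) (auto simp: pauli_words_0)
next
  case (Suc n)
  let ?m = "2 ^ n :: nat"
  define B where "B a b = mat ?m ?m (\<lambda>(i,j). M $$ (a * ?m + i, b * ?m + j))" for a b
  define C where "C k = mat ?m ?m (\<lambda>(i,j). if k = 0 then (B 0 0 $$ (i,j) + B 1 1 $$ (i,j)) / 2
     else if k = 1 then (B 0 1 $$ (i,j) + B 1 0 $$ (i,j)) / 2
     else if k = 2 then \<i> * (B 0 1 $$ (i,j) - B 1 0 $$ (i,j)) / 2
     else (B 0 0 $$ (i,j) - B 1 1 $$ (i,j)) / 2)" for k :: nat
  have "\<forall>k. \<exists>\<alpha>. \<forall>i<?m. \<forall>j<?m. C k $$ (i,j) = (\<Sum>ks\<in>pauli_words n. \<alpha> ks * pauli_string ks $$ (i,j))"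
    by (intro allI Suc.IH) (simp add: C_def)
  then obtain \<alpha> where \<alpha>: "\<And>k i j. i < ?m \<Longrightarrow> j < ?m \<Longrightarrow> C k $$ (i,j) = (\<Sum>ks\<in>pauli_words n. \<alpha> k ks * pauli_string ks $$ (i,j))"
    by metis
  show ?case
  proof (intro exI[of _ "\<lambda>ks. \<alpha> (hd ks) (tl ks)"] allI impI)
    fix i j :: nat assume ij: "i < 2 ^ Suc n" "j < 2 ^ Suc n"
    define a b p q where "a = i div ?m" "b = j div ?m" "p = i mod ?m" "q = j mod ?m"
    note abpq = this
    have ab: "a < 2" "b < 2" and pq: "p < ?m" "q < ?m"
      using ij by (auto simp: abpq less_mult_imp_div_less)
    have ij_eq: "i = a * ?m + p" "j = b * ?m + q" by (simp_all only: abpq div_mult_mod_eq)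
    have "(\<Sum>ks\<in>pauli_words (Suc n). \<alpha> (hd ks) (tl ks) * pauli_string ks $$ (i,j))
        = (\<Sum>(k,ks)\<in>{..<4} \<times> pauli_words n. \<alpha> k ks * pauli_string (k # ks) $$ (i,j))"
      unfolding pauli_words_Suc by (subst sum.reindex) (auto simp: inj_on_def split_def intro!: sum.cong)
    also have "\<dots> = (\<Sum>(k,ks)\<in>{..<4} \<times> pauli_words n. pauli1 k $$ (a,b) * (\<alpha> k ks * pauli_string ks $$ (p,q)))"
    proof (intro sum.cong refl, clarify)
      fix k ks assume "ks \<in> pauli_words n"
      then have "pauli_string ks \<in> carrier_mat ?m ?m" using pauli_string_carrier[of ks] by (simp add: pauli_words_def)
      then show "\<alpha> k ks * pauli_string (k # ks) $$ (i,j) = pauli1 k $$ (a,b) * (\<alpha> k ks * pauli_string ks $$ (p,q))"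
        unfolding ij_eq using kron_block[OF pauli1_carrier _ ab pq] by simp
    qed
    also have "\<dots> = (\<Sum>k<4. pauli1 k $$ (a,b) * C k $$ (p,q))"
      by (simp add: sum.cartesian_product[symmetric] sum_distrib_left \<alpha>[OF pq])
    also have "\<dots> = pauli1 0 $$ (a,b) * C 0 $$ (p,q) + pauli1 1 $$ (a,b) * C 1 $$ (p,q)
        + pauli1 2 $$ (a,b) * C 2 $$ (p,q) + pauli1 3 $$ (a,b) * C 3 $$ (p,q)"
      by (simp add: numeral_eq_Suc)
    also have "\<dots> = B a b $$ (p,q)"
    proof -
      have "a = 0 \<or> a = 1" "b = 0 \<or> b = 1" using ab by auto
      then show ?thesis
        using pq by (auto simp: pauli1_index C_def field_simps simp del: One_nat_def)
    qed
    also have "\<dots> = M $$ (i,j)" using pq by (simp add: B_def ij_eq)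
    finally show "M $$ (i,j) = (\<Sum>ks\<in>pauli_words (Suc n). \<alpha> (hd ks) (tl ks) * pauli_string ks $$ (i,j))" by simp
  qed
qed


section \<open>Pauli operators, their products and triples\<close>

definition pauli_all :: "nat \<Rightarrow> complex mat set" where
  "pauli_all n = pauli_string ` pauli_words n"

lemma Paulis_eq: "Paulis n = pauli_all n - {1\<^sub>m (2^n)}"
  by (auto simp: Paulis_def pauli_all_def pauli_words_def)

lemma PaulisD: "A \<in> Paulis n \<Longrightarrow> A \<in> pauli_all n" "A \<in> Paulis n \<Longrightarrow> A \<noteq> 1\<^sub>m (2^n)"
  by (auto simp: Paulis_eq)

lemma finite_pauli_all: "finite (pauli_all n)"
  by (simp add: pauli_all_def finite_pauli_words)

lemma finite_Paulis: "finite (Paulis n)"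
  by (simp add: Paulis_eq finite_pauli_all)

lemma one_pauli_all: "1\<^sub>m (2^n) \<in> pauli_all n"
  unfolding pauli_all_def pauli_string_replicate[symmetric] by (rule imageI) (auto simp: pauli_words_def)

lemma card_Paulis: "card (Paulis n) + 1 = card (pauli_all n)" "card (pauli_all n) \<le> 4 ^ n"
proof -
  show "card (Paulis n) + 1 = card (pauli_all n)"
    unfolding Paulis_eq using card_Suc_Diff1[OF finite_pauli_all one_pauli_all] by simp
  show "card (pauli_all n) \<le> 4 ^ n"
    unfolding pauli_all_def card_pauli_words[symmetric] by (rule card_image_le[OF finite_pauli_words])
qed

lemma pauli_all_props:
  assumes "A \<in> pauli_all n"
  shows "A \<in> carrier_mat (2^n) (2^n)" "A * A = 1\<^sub>m (2^n)" "madj A = A"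
proof -
  obtain ks where ks: "length ks = n" "set ks \<subseteq> {0..<4}" "A = pauli_string ks"
    using assms by (auto simp: pauli_all_def pauli_words_def)
  show "A \<in> carrier_mat (2^n) (2^n)" "A * A = 1\<^sub>m (2^n)" "madj A = A"
    using ks pauli_string_carrier[of ks] pauli_string_sq[OF ks(2)] pauli_string_madj[of ks] by auto
qed

lemma smult_smult_mat: "x \<cdot>\<^sub>m (y \<cdot>\<^sub>m A) = (x * y) \<cdot>\<^sub>m A" for A :: "complex mat"
  by (intro eq_matI) auto

lemma one_smult_mat [simp]: "1 \<cdot>\<^sub>m A = A" for A :: "complex mat"
  by (intro eq_matI) auto

lemma pauli_all_commute:
  assumes "A \<in> pauli_all n" "B \<in> pauli_all n"
  shows "B * A = A * B \<or> anticomm (2^n) A B"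
proof -
  obtain ks where ks: "length ks = n" "set ks \<subseteq> {0..<4}" "A = pauli_string ks"
    using assms by (auto simp: pauli_all_def pauli_words_def)
  obtain ls where ls: "length ls = n" "set ls \<subseteq> {0..<4}" "B = pauli_string ls"
    using assms by (auto simp: pauli_all_def pauli_words_def)
  have "\<exists>c\<in>{1,-1}. B * A = c \<cdot>\<^sub>m (A * B)"
    unfolding ks(3) ls(3) by (rule pauli_string_commute) (use ks ls in auto)
  then obtain c :: complex where c: "c \<in> {1,-1}" "B * A = c \<cdot>\<^sub>m (A * B)" by blast
  then show ?thesis
    using pauli_all_props[OF assms(1)] pauli_all_props[OF assms(2)]
    unfolding anticomm_def neg_smult_mat by auto
qed

lemma pauli_all_scalar_unique:
  assumes "A \<in> pauli_all n" "B \<in> pauli_all n" "A = c \<cdot>\<^sub>m B"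
  shows "c = 1" "A = B"
proof -
  obtain ks where ks: "length ks = n" "set ks \<subseteq> {0..<4}" "A = pauli_string ks"
    using assms by (auto simp: pauli_all_def pauli_words_def)
  obtain ls where ls: "length ls = n" "set ls \<subseteq> {0..<4}" "B = pauli_string ls"
    using assms by (auto simp: pauli_all_def pauli_words_def)
  have "c = 1 \<and> ks = ls"
    using assms(3) ks ls by (intro pauli_string_scalar_unique) auto
  then show "c = 1" "A = B" using ks ls by auto
qed

lemma inj_pauli_string: "inj_on pauli_string (pauli_words n)"
proof (rule inj_onI)
  fix ks ls assume "ks \<in> pauli_words n" "ls \<in> pauli_words n" "pauli_string ks = pauli_string ls"
  then show "ks = ls"
    using pauli_string_scalar_unique[of ks ls 1] by (auto simp: pauli_words_def)
qed

lemma pauli_all_mult: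
  assumes "A \<in> pauli_all n" "B \<in> pauli_all n"
  shows "\<exists>c. \<exists>C\<in>pauli_all n. A * B = c \<cdot>\<^sub>m C"
proof -
  obtain ks where ks: "length ks = n" "set ks \<subseteq> {0..<4}" "A = pauli_string ks"
    using assms by (auto simp: pauli_all_def pauli_words_def)
  obtain ls where ls: "length ls = n" "set ls \<subseteq> {0..<4}" "B = pauli_string ls"
    using assms by (auto simp: pauli_all_def pauli_words_def)
  obtain c ms where "length ms = n" "set ms \<subseteq> {0..<4}" "A * B = c \<cdot>\<^sub>m pauli_string ms"
    using pauli_string_mult[of ks ls] ks ls by auto
  then show ?thesis by (auto simp: pauli_all_def pauli_words_def)
qed

lemma anticomm_ne_one:
  assumes "anticomm N A B" "N > 0"
  shows "A \<noteq> 1\<^sub>m N"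
proof
  assume A: "A = 1\<^sub>m N"
  note a = anticommD[OF assms(1)]
  have B: "B = - B" using a(2,7) by (simp add: A)
  have "B $$ (i,j) = 0" if "i < N" "j < N" for i j
    using arg_cong[OF B, of "\<lambda>M. M $$ (i,j)"] that a(2) by simp
  then show False
    using involution_nonzero_entry[OF a(2,4) assms(2)] by auto
qed

lemma Paulis_partner:
  assumes "A \<in> Paulis n"
  shows "\<exists>B\<in>Paulis n. anticomm (2^n) A B"
proof -
  obtain ks where ks: "length ks = n" "set ks \<subseteq> {0..<4}" "A = pauli_string ks" "A \<noteq> 1\<^sub>m (2^n)"
    using assms by (auto simp: Paulis_def)
  obtain ls where ls: "length ls = n" "set ls \<subseteq> {0..<4}"
    "pauli_string ls * A = (-1) \<cdot>\<^sub>m (A * pauli_string ls)"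
    using pauli_string_anticomm_ex[of ks] ks by auto
  let ?B = "pauli_string ls"
  have B: "?B \<in> pauli_all n" using ls by (auto simp: pauli_all_def pauli_words_def)
  have "anticomm (2^n) A ?B"
    using pauli_all_props[OF B] pauli_all_props[OF PaulisD(1)[OF assms]] ls(3)
    unfolding anticomm_def neg_smult_mat by auto
  moreover have "?B \<in> Paulis n"
    using anticomm_ne_one[OF anticomm_sym[OF calculation]] B by (simp add: Paulis_eq)
  ultimately show ?thesis by blast
qed

lemma Paulis_nonempty:
  assumes "n \<ge> 1"
  shows "Paulis n \<noteq> {}"
proof -
  let ?ks = "replicate n (1::nat)"
  have "pauli_string ?ks \<in> pauli_all n" by (auto simp: pauli_all_def pauli_words_def)
  moreover have "pauli_string ?ks \<noteq> 1\<^sub>m (2^n)"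
  proof
    assume "pauli_string ?ks = 1\<^sub>m (2^n)"
    then have "pauli_string ?ks = 1 \<cdot>\<^sub>m pauli_string (replicate n 0)" by (simp add: pauli_string_replicate)
    then have "?ks = replicate n 0"
      using pauli_string_scalar_unique[of ?ks "replicate n 0" 1] by fastforce
    then show False using assms by (cases n) auto
  qed
  ultimately show ?thesis by (auto simp: Paulis_eq)
qed

lemma anticomm_uminus: "anticomm N A B \<Longrightarrow> anticomm N (- A) B"
proof -
  assume ab: "anticomm N A B"
  note a = anticommD[OF ab]
  have "B * (- A) = - (B * A)" using a(1,2) by simp
  also have "\<dots> = - ((- A) * B)" using a(1,2) unfolding a(7) by simp
  finally have "B * (- A) = - ((- A) * B)" .
  moreover have "(- A) * (- A) = 1\<^sub>m N" using a(1,3) by (simp add: uminus_mult_left_mat)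
  moreover have "madj (- A) = - A" using a(5) by (simp add: neg_smult_mat madj_smult)
  ultimately show ?thesis using a(1,2,4,6) by (simp add: anticomm_def)
qed

text \<open>The product of two strings is a string up to a phase. Since
  \<open>\<i> \<cdot>\<^sub>m (B * A)\<close> is an involution, the phase times \<open>\<i>\<close>
  has square \<open>1\<close>, so only a sign remains open.\<close>

lemma Paulis_third_ex:
  assumes "A \<in> Paulis n" "B \<in> Paulis n" "anticomm (2^n) A B"
  shows "\<exists>C\<in>Paulis n. \<i> \<cdot>\<^sub>m (B * A) = C \<or> \<i> \<cdot>\<^sub>m (B * A) = - C"
proof -
  let ?R = "\<i> \<cdot>\<^sub>m (B * A)"
  obtain c C where C: "C \<in> pauli_all n" "B * A = c \<cdot>\<^sub>m C"
    using pauli_all_mult[OF PaulisD(1)[OF assms(2)] PaulisD(1)[OF assms(1)]] by blast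
  have R: "?R = (\<i> * c) \<cdot>\<^sub>m C" by (simp add: C smult_smult_mat)
  note Cp = pauli_all_props[OF C(1)]
  have "((\<i> * c) \<cdot>\<^sub>m C) * ((\<i> * c) \<cdot>\<^sub>m C) = ((\<i> * c) * (\<i> * c)) \<cdot>\<^sub>m (C * C)"
    using Cp(1) mult_smult_assoc_mat[OF Cp(1) smult_carrier_mat[OF Cp(1)], of "\<i> * c" "\<i> * c"] mult_smult_distrib[OF Cp(1) Cp(1), of "\<i> * c"]
    by (simp add: smult_smult_mat)
  then have "1\<^sub>m (2^n) = ((\<i> * c) * (\<i> * c)) \<cdot>\<^sub>m (1\<^sub>m (2^n))"
    using quat_table(2)[OF assms(3) refl] unfolding R Cp(2) by simp
  then have "(1\<^sub>m (2^n) :: complex mat) $$ (0,0) = (((\<i> * c) * (\<i> * c)) \<cdot>\<^sub>m (1\<^sub>m (2^n))) $$ (0,0)" by simp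
  then have "(\<i> * c) * (\<i> * c) = 1" by simp
  then have "\<i> * c = 1 \<or> \<i> * c = -1" by (simp add: square_eq_1_iff)
  then have or: "?R = C \<or> ?R = - C" unfolding R by (auto simp: neg_smult_mat)
  have aR: "anticomm (2^n) ?R B" by (rule anticomm_third(1)[OF assms(3)])
  have "anticomm (2^n) C B"
    using or
  proof
    assume "?R = - C"
    then have "C = - ?R" by (auto intro!: eq_matI)
    then show ?thesis using anticomm_uminus[OF aR] by simp
  qed (use aR in simp)
  then have "C \<noteq> 1\<^sub>m (2^n)" by (rule anticomm_ne_one) simp
  then show ?thesis using or C(1) by (auto simp: Paulis_eq)
qed

text \<open>The third member of the triple of \<open>A\<close> and \<open>B\<close>, stripped of its
  sign so that it is again an element of \<open>Paulis n\<close>. For fixed \<open>B\<close> this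
  pairs up the strings that anticommute with \<open>B\<close>.\<close>

definition pauli_third :: "nat \<Rightarrow> complex mat \<Rightarrow> complex mat \<Rightarrow> complex mat" where
  "pauli_third n B A = (SOME C. C \<in> Paulis n \<and> (\<i> \<cdot>\<^sub>m (B * A) = C \<or> \<i> \<cdot>\<^sub>m (B * A) = - C))"

lemma pauli_third:
  assumes "A \<in> Paulis n" "B \<in> Paulis n" "anticomm (2^n) A B"
  shows "pauli_third n B A \<in> Paulis n"
    "\<i> \<cdot>\<^sub>m (B * A) = pauli_third n B A \<or> \<i> \<cdot>\<^sub>m (B * A) = - pauli_third n B A"
    "anticomm (2^n) (pauli_third n B A) B"
proof -
  let ?C = "pauli_third n B A"
  have "?C \<in> Paulis n \<and> (\<i> \<cdot>\<^sub>m (B * A) = ?C \<or> \<i> \<cdot>\<^sub>m (B * A) = - ?C)"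
    using Paulis_third_ex[OF assms] unfolding pauli_third_def Bex_def by (rule someI_ex)
  then show "?C \<in> Paulis n" and or: "\<i> \<cdot>\<^sub>m (B * A) = ?C \<or> \<i> \<cdot>\<^sub>m (B * A) = - ?C" by auto
  have aR: "anticomm (2^n) (\<i> \<cdot>\<^sub>m (B * A)) B" by (rule anticomm_third(1)[OF assms(3)])
  show "anticomm (2^n) ?C B"
    using or
  proof
    assume "\<i> \<cdot>\<^sub>m (B * A) = - ?C"
    then have "?C = - (\<i> \<cdot>\<^sub>m (B * A))" by (auto intro!: eq_matI)
    then show ?thesis using anticomm_uminus[OF aR] by simp
  qed (use aR in simp)
qed

text \<open>Multiplying by \<open>B\<close> twice gives \<open>A\<close> back up to sign, and
  proportional strings are equal.\<close>

lemma pauli_third_involution: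
  assumes "A \<in> Paulis n" "B \<in> Paulis n" "anticomm (2^n) A B"
  shows "pauli_third n B (pauli_third n B A) = A"
proof -
  let ?N = "2^n :: nat"
  define R where "R = \<i> \<cdot>\<^sub>m (B * A)"
  define C where "C = pauli_third n B A"
  note C = pauli_third[OF assms, folded C_def R_def]
  define C' where "C' = pauli_third n B C"
  note C' = pauli_third[OF C(1) assms(2) C(3), folded C'_def]
  note a = anticommD[OF assms(3)]
  have Cc: "C \<in> carrier_mat ?N ?N" using anticommD(1)[OF C(3)] .
  have BR: "B * R = \<i> \<cdot>\<^sub>m A" by (rule quat_table(6)[OF assms(3) R_def])
  have "C = R \<or> C = - R" using C(2) by (auto intro!: eq_matI)
  then have "\<i> \<cdot>\<^sub>m (B * C) = (-1) \<cdot>\<^sub>m A \<or> \<i> \<cdot>\<^sub>m (B * C) = A"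
  proof
    assume "C = R"
    then show ?thesis by (simp add: BR smult_smult_mat)
  next
    assume eq: "C = - R"
    have Rc: "R \<in> carrier_mat ?N ?N" using a(1,2) by (simp add: R_def)
    have "B * C = - (B * R)" unfolding eq using a(2) Rc by simp
    then show ?thesis by (simp add: BR smult_smult_mat neg_smult_mat)
  qed
  then have "(\<exists>e::complex. A = e \<cdot>\<^sub>m C')"
    using C'(2)
  proof (elim disjE)
    assume "\<i> \<cdot>\<^sub>m (B * C) = (-1) \<cdot>\<^sub>m A" "\<i> \<cdot>\<^sub>m (B * C) = C'"
    then have "(-1) \<cdot>\<^sub>m ((-1) \<cdot>\<^sub>m A) = (-1) \<cdot>\<^sub>m C'" by simp
    then show ?thesis by (intro exI[of _ "-1"]) (simp add: smult_smult_mat)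
  next
    assume "\<i> \<cdot>\<^sub>m (B * C) = (-1) \<cdot>\<^sub>m A" "\<i> \<cdot>\<^sub>m (B * C) = - C'"
    then have "(-1) \<cdot>\<^sub>m ((-1) \<cdot>\<^sub>m A) = (-1) \<cdot>\<^sub>m ((-1) \<cdot>\<^sub>m C')" by (simp add: neg_smult_mat)
    then show ?thesis by (intro exI[of _ 1]) (simp add: smult_smult_mat)
  next
    assume "\<i> \<cdot>\<^sub>m (B * C) = A" "\<i> \<cdot>\<^sub>m (B * C) = C'"
    then show ?thesis by (intro exI[of _ 1]) simp
  next
    assume "\<i> \<cdot>\<^sub>m (B * C) = A" "\<i> \<cdot>\<^sub>m (B * C) = - C'"
    then show ?thesis by (intro exI[of _ "-1"]) (simp add: neg_smult_mat)
  qed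
  then have "A = C'"
    using pauli_all_scalar_unique(2)[OF PaulisD(1)[OF assms(1)] PaulisD(1)[OF C'(1)]] by blast
  then show ?thesis by (simp add: C'_def C_def)
qed

text \<open>Left multiplication by an anticommuting string embeds the commutant of \<open>A\<close> into the set of
  strings that anticommute with \<open>A\<close>.\<close>

lemma card_anticomm:
  assumes A: "A \<in> Paulis n"
  shows "card (Paulis n) + 1 \<le> 2 * card {B \<in> Paulis n. anticomm (2^n) A B}"
proof -
  let ?N = "2^n :: nat"
  let ?anti = "{B \<in> Paulis n. anticomm ?N A B}"
  \<comment> \<open>The identity is counted among the commuting strings, hence
    \<open>pauli_all n\<close> here and the \<open>+ 1\<close> in the statement.\<close>
  let ?comm = "pauli_all n - ?anti"
  note Ap = pauli_all_props[OF PaulisD(1)[OF A]]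
  obtain B0 where B0: "B0 \<in> Paulis n" "anticomm ?N A B0" using Paulis_partner[OF A] by blast
  note b0 = anticommD[OF B0(2)]
  have "\<forall>B\<in>pauli_all n. \<exists>C\<in>pauli_all n. \<exists>c. B0 * B = c \<cdot>\<^sub>m C"
    using pauli_all_mult[OF PaulisD(1)[OF B0(1)]] by blast
  then obtain f where "\<forall>B\<in>pauli_all n. f B \<in> pauli_all n \<and> (\<exists>c. B0 * B = c \<cdot>\<^sub>m f B)"
    using bchoice[of "pauli_all n" "\<lambda>B C. C \<in> pauli_all n \<and> (\<exists>c. B0 * B = c \<cdot>\<^sub>m C)"] by blast
  then obtain c where f: "\<And>B. B \<in> pauli_all n \<Longrightarrow> f B \<in> pauli_all n" "\<And>B. B \<in> pauli_all n \<Longrightarrow> B0 * B = c B \<cdot>\<^sub>m f B"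
    by metis
  have recover: "B = c B \<cdot>\<^sub>m (B0 * f B)" if B: "B \<in> pauli_all n" for B
  proof -
    have Bc: "B \<in> carrier_mat ?N ?N" by (rule pauli_all_props(1)[OF B])
    have fc: "f B \<in> carrier_mat ?N ?N" by (rule pauli_all_props(1)[OF f(1)[OF B]])
    have "B = (B0 * B0) * B" using b0(4) Bc by simp
    also have "\<dots> = B0 * (c B \<cdot>\<^sub>m f B)" using assoc_mult_mat[OF b0(2) b0(2) Bc] f(2)[OF B] by simp
    also have "\<dots> = c B \<cdot>\<^sub>m (B0 * f B)" by (rule mult_smult_distrib[OF b0(2) fc])
    finally show ?thesis .
  qed
  have c0: "c B \<noteq> 0" if B: "B \<in> pauli_all n" for B
  proof
    assume "c B = 0"
    then have "B $$ (i,j) = 0" if "i < ?N" "j < ?N" for i j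
      using arg_cong[OF recover[OF B], of "\<lambda>M. M $$ (i,j)"] that b0(2) pauli_all_props(1)[OF f(1)[OF B]]
      by (simp del: index_mult_mat(1))
    then show False
      using involution_nonzero_entry[OF pauli_all_props(1,2)[OF B]] by auto
  qed
  have inj: "inj_on f ?comm"
  proof (rule inj_onI)
    fix B B' assume BB: "B \<in> ?comm" "B' \<in> ?comm" "f B = f B'"
    then have all: "B \<in> pauli_all n" "B' \<in> pauli_all n" by auto
    have "B0 * f B = (1 / c B') \<cdot>\<^sub>m B'"
      using recover[OF all(2)] c0[OF all(2)] BB(3) by (metis (no_types, lifting) smult_smult_mat one_smult_mat nonzero_eq_divide_eq)
    then have "B = (c B * (1 / c B')) \<cdot>\<^sub>m B'"
      using recover[OF all(1)] by (simp add: smult_smult_mat)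
    then show "B = B'" by (rule pauli_all_scalar_unique(2)[OF all])
  qed
  have into: "f B \<in> ?anti" if B: "B \<in> ?comm" for B
  proof -
    have Ball: "B \<in> pauli_all n" using B by simp
    have Bc: "B \<in> carrier_mat ?N ?N" by (rule pauli_all_props(1)[OF Ball])
    have fc: "f B \<in> carrier_mat ?N ?N" by (rule pauli_all_props(1)[OF f(1)[OF Ball]])
    have "\<not> anticomm ?N A B"
      using B anticomm_ne_one[of ?N B A] anticomm_sym[of ?N A B] by (auto simp: Paulis_eq)
    then have BA: "B * A = A * B" using pauli_all_commute[OF PaulisD(1)[OF A] Ball] by blast
    have "(B0 * B) * A = B0 * (A * B)" using assoc_mult_mat[OF b0(2) Bc Ap(1)] BA by simp
    also have "\<dots> = (B0 * A) * B" using assoc_mult_mat[OF b0(2) Ap(1) Bc] by simp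
    also have "\<dots> = - (A * B0) * B" by (simp only: b0(7))
    also have "\<dots> = - ((A * B0) * B)" using Ap(1) b0(2) Bc by simp
    also have "\<dots> = - (A * (B0 * B))" using assoc_mult_mat[OF Ap(1) b0(2) Bc] by simp
    finally have "(c B \<cdot>\<^sub>m f B) * A = (-1) \<cdot>\<^sub>m (A * (c B \<cdot>\<^sub>m f B))"
      by (simp only: f(2)[OF Ball] neg_smult_mat)
    then have eq: "c B \<cdot>\<^sub>m (f B * A) = (-1) \<cdot>\<^sub>m (c B \<cdot>\<^sub>m (A * f B))"
      by (simp only: mult_smult_assoc_mat[OF fc Ap(1)] mult_smult_distrib[OF Ap(1) fc])
    have "f B * A = - (A * f B)"
    proof (rule eq_matI)
      fix i j assume "i < dim_row (- (A * f B))" "j < dim_col (- (A * f B))"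
      then have ij: "i < ?N" "j < ?N" using Ap(1) fc by auto
      have "c B * (f B * A) $$ (i,j) = c B * (- (A * f B)) $$ (i,j)"
        using arg_cong[OF eq, of "\<lambda>M. M $$ (i,j)"] ij Ap(1) fc by (simp del: index_mult_mat(1))
      then show "(f B * A) $$ (i,j) = (- (A * f B)) $$ (i,j)" using c0[OF Ball] by simp
    qed (use Ap(1) fc in auto)
    then have "anticomm ?N A (f B)"
      using Ap pauli_all_props[OF f(1)[OF Ball]] by (simp add: anticomm_def)
    then show ?thesis
      using f(1)[OF Ball] anticomm_ne_one[of ?N "f B" A] anticomm_sym by (auto simp: Paulis_eq)
  qed
  have "card ?comm \<le> card ?anti"
    using inj into finite_Paulis by (intro card_inj_on_le[of f]) auto
  moreover have "card ?comm = card (pauli_all n) - card ?anti"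
    using finite_Paulis by (intro card_Diff_subset) (auto simp: Paulis_eq)
  ultimately show ?thesis using card_Paulis(1)[of n] by linarith
qed

section \<open>Pauli rotations generate a dense subgroup\<close>

lemma cis_sum: "finite A \<Longrightarrow> cis (\<Sum>i\<in>A. f i) = (\<Prod>i\<in>A. cis (f i))"
  by (induction A rule: finite_induct) (simp_all flip: cis_mult)

lemma det_mat_diag: "det (mat_diag n f :: complex mat) = (\<Prod>i<n. f i)"
  by (subst det_upper_triangular[of _ n])
    (auto simp: prod_list_diag_prod mat_diag_def atLeast0LessThan intro!: prod.cong)

text \<open>A logarithm of \<open>U\<close> with trace zero. The trace condition is what keeps the
  generator in the span of the non-identity strings.\<close>

lemma SU_diagonalize:
  assumes U: "U \<in> SU N" and N: "N > 0"
  shows "\<exists>W \<theta>. unitary_mat N W \<and> (\<Sum>i<N. \<theta> i) = (0::real) \<and> U = W * mat_diag N (\<lambda>i. cis (\<theta> i)) * madj W"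
proof -
  note Uc = unitary_matD[OF SU_D(2)[OF U]]
  obtain W f where W: "unitary_mat N W" and UW: "U = W * mat_diag N f * madj W"
    using spectral_theorem_normal[OF Uc(1)] Uc by auto
  note Wc = unitary_matD[OF W]
  let ?D = "mat_diag N f"
  have Dc: "?D \<in> carrier_mat N N" by simp
  have D: "?D = madj W * U * W"
  proof -
    have "madj W * U * W = (madj W * W) * ?D * (madj W * W)"
      unfolding UW using Wc(1,2) Dc by (simp add: assoc_mult_mat[of _ N N _ N _ N])
    also have "\<dots> = ?D" unfolding Wc(4) by (simp only: left_mult_one_mat[OF Dc] right_mult_one_mat[OF Dc])
    finally show ?thesis by simp
  qed
  have "unitary_mat N ?D"
    unfolding D by (intro unitary_mat_mult unitary_mat_madj W SU_D(2)[OF U])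
  then have DD: "?D * madj ?D = 1\<^sub>m N" by (rule unitary_matD(3))
  have f1: "f i * cnj (f i) = 1" if "i < N" for i
  proof -
    have "(?D * madj ?D) $$ (i,i) = f i * cnj (f i)"
      using that by (subst mult_index[of _ N N _ N]) (auto simp: mat_diag_def if_distrib[of "\<lambda>x. x * _"] sum.delta cong: if_cong)
    then show ?thesis using DD that by simp
  qed
  then have "cmod (f i) = 1" if "i < N" for i
    using that by (metis complex_mod_sqrt_Re_mult_cnj one_complex.sel(1) real_sqrt_one)
  then have f_cis: "f i = cis (Arg (f i))" if "i < N" for i
    using that rcis_cmod_Arg[of "f i"] by (simp add: rcis_def)
  have "det W * det (madj W) = 1"
    using det_mult[OF Wc(1,2)] Wc(3) by simp
  moreover have "det U = det W * det ?D * det (madj W)"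
    unfolding UW using det_mult[OF square_mult_carrier[OF Wc(1) Dc] Wc(2)] det_mult[OF Wc(1) Dc] by simp
  ultimately have "det ?D = 1" using SU_D(3)[OF U] by (metis mult.commute mult.left_neutral mult.assoc)
  then have "cis (\<Sum>i<N. Arg (f i)) = 1"
    using f_cis by (simp add: det_mat_diag cis_sum)
  then have "cos (\<Sum>i<N. Arg (f i)) = 1" by (simp add: complex_eq_iff)
  then obtain m :: int where m: "(\<Sum>i<N. Arg (f i)) = real_of_int m * 2 * pi"
    using cos_one_2pi_int by blast
  \<comment> \<open>Determinant \<open>1\<close> only makes the sum of the arguments a multiple of
    \<open>2 * pi\<close>. Subtracting it from the first angle leaves \<open>cis\<close> unchanged
    and makes the sum zero.\<close>
  define \<theta> where "\<theta> i = Arg (f i) - (if i = 0 then real_of_int m * 2 * pi else 0)" for i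
  have "(\<Sum>i<N. \<theta> i) = 0"
    using m N by (simp add: \<theta>_def sum_subtractf sum.delta)
  moreover have "cis (\<theta> i) = cis (Arg (f i))" for i
    using cis_multiple_2pi[of "of_int m"] by (auto simp: \<theta>_def mult.commute mult.left_commute simp flip: cis_divide)
  then have "?D = mat_diag N (\<lambda>i. cis (\<theta> i))"
    using f_cis by (auto simp: mat_diag_def intro!: eq_matI)
  ultimately show ?thesis using W UW by metis
qed

text \<open>Telescoping with \<open>A^(k+1) - B^(k+1) = A^k (A - B) + (A^k - B^k) B\<close>: unitary
  factors preserve norms, so the errors merely add up.\<close>

lemma unitary_pow_diff:
  assumes A: "unitary_mat N A" and B: "unitary_mat N B"
    and le: "\<And>x. x \<in> carrier_vec N \<Longrightarrow> vnorm ((A - B) *\<^sub>v x) \<le> \<delta> * vnorm x"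
    and x: "x \<in> carrier_vec N"
  shows "vnorm ((A ^\<^sub>m k) *\<^sub>v x - (B ^\<^sub>m k) *\<^sub>v x) \<le> real k * \<delta> * vnorm x"
  using x
proof (induction k arbitrary: x)
  case 0
  then show ?case using carrier_matD[OF unitary_matD(1)[OF A]] carrier_matD[OF unitary_matD(1)[OF B]] by simp
next
  case (Suc k)
  note Ac = unitary_matD(1)[OF A] and Bc = unitary_matD(1)[OF B]
  have Ak: "A ^\<^sub>m k \<in> carrier_mat N N" "B ^\<^sub>m k \<in> carrier_mat N N" using Ac Bc by auto
  have uAk: "unitary_mat N (A ^\<^sub>m k)"
    by (induction k) (use A Ac in \<open>auto simp: unitary_mat_one intro: unitary_mat_mult\<close>)
  have AB: "A - B \<in> carrier_mat N N" using Bc by (rule minus_carrier_mat)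
  have y: "(A - B) *\<^sub>v x \<in> carrier_vec N" "B *\<^sub>v x \<in> carrier_vec N" "A *\<^sub>v x \<in> carrier_vec N"
    using AB Ac Bc Suc.prems by auto
  have "A *\<^sub>v x = (A - B) *\<^sub>v x + B *\<^sub>v x"
    using Ac Bc Suc.prems by (auto simp: minus_mult_distrib_mat_vec[of _ N N])
  then have "(A ^\<^sub>m k) *\<^sub>v (A *\<^sub>v x) = (A ^\<^sub>m k) *\<^sub>v ((A - B) *\<^sub>v x) + (A ^\<^sub>m k) *\<^sub>v (B *\<^sub>v x)"
    using mult_add_distrib_mat_vec[OF Ak(1) y(1,2)] by simp
  then have "(A ^\<^sub>m Suc k) *\<^sub>v x - (B ^\<^sub>m Suc k) *\<^sub>v x
      = (A ^\<^sub>m k) *\<^sub>v ((A - B) *\<^sub>v x) + ((A ^\<^sub>m k) *\<^sub>v (B *\<^sub>v x) - (B ^\<^sub>m k) *\<^sub>v (B *\<^sub>v x))"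
    using Ak Ac Bc Suc.prems y by (auto simp: assoc_mult_mat_vec[of _ N N _ N])
  then have "vnorm ((A ^\<^sub>m Suc k) *\<^sub>v x - (B ^\<^sub>m Suc k) *\<^sub>v x)
      \<le> vnorm ((A ^\<^sub>m k) *\<^sub>v ((A - B) *\<^sub>v x)) + vnorm ((A ^\<^sub>m k) *\<^sub>v (B *\<^sub>v x) - (B ^\<^sub>m k) *\<^sub>v (B *\<^sub>v x))"
    using Ak y by (simp add: vnorm_triangle[of _ N])
  also have "\<dots> \<le> \<delta> * vnorm x + real k * \<delta> * vnorm (B *\<^sub>v x)"
    using Suc.IH[OF y(2)] unitary_vnorm[OF uAk y(1)] le[OF Suc.prems] by linarith
  also have "\<dots> = real (Suc k) * \<delta> * vnorm x"
    using unitary_vnorm[OF B Suc.prems] by (simp add: algebra_simps)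
  finally show ?case .
qed

text \<open>The estimate behind the Trotter formula: curves with the same value and derivative at
  \<open>0\<close> differ at \<open>1 / k\<close> by less than order \<open>1 / k\<close>, so that
  \<open>k\<close> such errors still tend to zero.\<close>

lemma mat_deriv_diff_quotient:
  assumes F: "mat_deriv N F D 0" and G: "mat_deriv N G D 0" and FG: "F 0 = G 0"
    and c: "\<And>s. F s \<in> carrier_mat N N" "\<And>s. G s \<in> carrier_mat N N"
  shows "(\<lambda>k. real k * (\<Sum>i<N. \<Sum>j<N. cmod ((F (1 / real k) - G (1 / real k)) $$ (i,j)))) \<longlonglongrightarrow> 0"
proof -
  have seq: "filterlim (\<lambda>k. 1 / real k) (at 0) sequentially"
    unfolding filterlim_at
    by (auto intro!: lim_1_over_n eventually_sequentiallyI[of 1])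
  have ent: "(\<lambda>k. cmod ((F (1 / real k) $$ (i,j) - G (1 / real k) $$ (i,j)) /\<^sub>R (1 / real k))) \<longlonglongrightarrow> 0"
    if "i < N" "j < N" for i j
  proof -
    have "((\<lambda>s. F s $$ (i,j) - G s $$ (i,j)) has_vector_derivative D $$ (i,j) - D $$ (i,j)) (at 0)"
      by (intro has_vector_derivative_diff mat_derivD[OF F] mat_derivD[OF G] that)
    then have "((\<lambda>h. (F h $$ (i,j) - G h $$ (i,j)) /\<^sub>R h) \<longlongrightarrow> 0) (at 0)"
      using has_vector_derivative_quotient_tendsto[of "\<lambda>s. F s $$ (i,j) - G s $$ (i,j)" 0 0] FG by simp
    from filterlim_compose[OF this seq]
    show ?thesis by (rule tendsto_norm_zero)
  qed
  have "(\<lambda>k. \<Sum>i<N. \<Sum>j<N. cmod ((F (1 / real k) $$ (i,j) - G (1 / real k) $$ (i,j)) /\<^sub>R (1 / real k))) \<longlonglongrightarrow> (\<Sum>i<N. \<Sum>j<N. 0)"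
    by (intro tendsto_sum ent) auto
  moreover have "(\<Sum>i<N. \<Sum>j<N. cmod ((F (1 / real k) $$ (i,j) - G (1 / real k) $$ (i,j)) /\<^sub>R (1 / real k)))
      = real k * (\<Sum>i<N. \<Sum>j<N. cmod ((F (1 / real k) - G (1 / real k)) $$ (i,j)))" for k
    using carrier_matD[OF c(1)] carrier_matD[OF c(2)] by (simp add: sum_distrib_left)
  ultimately show ?thesis by simp
qed

text \<open>\<open>P = Q * (Q * P)\<close> and \<open>- P = (Q * P) * Q\<close> have the same
  trace.\<close>

lemma anticomm_traceless:
  assumes "anticomm N P Q"
  shows "(\<Sum>i<N. P $$ (i,i)) = 0"
proof -
  note a = anticommD[OF assms]
  have tr: "(\<Sum>i<N. (A * B) $$ (i,i)) = (\<Sum>i<N. (B * A) $$ (i,i))"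
    if "A \<in> carrier_mat N N" "B \<in> carrier_mat N N" for A B :: "complex mat"
  proof -
    have "(\<Sum>i<N. (A * B) $$ (i,i)) = (\<Sum>i<N. \<Sum>k<N. A $$ (i,k) * B $$ (k,i))"
      by (intro sum.cong refl mult_index[OF that]) auto
    also have "\<dots> = (\<Sum>k<N. \<Sum>i<N. B $$ (k,i) * A $$ (i,k))"
      by (subst sum.swap) (simp add: mult.commute)
    also have "\<dots> = (\<Sum>k<N. (B * A) $$ (k,k))"
      by (intro sum.cong refl mult_index[OF that(2,1), symmetric]) auto
    finally show ?thesis .
  qed
  have QP: "Q * P \<in> carrier_mat N N" "P * Q \<in> carrier_mat N N" using a by auto
  have 1: "Q * (Q * P) = P"
    using a(1-4) assoc_mult_mat[OF a(2,2,1)] by simp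
  have "(Q * P) * Q = - (P * Q) * Q" by (simp only: a(7))
  also have "\<dots> = - (P * Q * Q)" using a(1,2) by simp
  also have "P * Q * Q = P" using a(1-4) assoc_mult_mat[OF a(1,2,2)] by simp
  finally have 2: "(Q * P) * Q = - P" .
  have "(\<Sum>i<N. P $$ (i,i)) = (\<Sum>i<N. (- P) $$ (i,i))"
    using tr[OF a(2) QP(1)] unfolding 1 2 .
  also have "\<dots> = - (\<Sum>i<N. P $$ (i,i))" using a(1) by (simp add: sum_negf)
  finally show ?thesis by simp
qed

text \<open>Averaging an expansion of \<open>H\<close> with its adjoint makes the coefficients real,
  because the strings are Hermitian. The coefficient of the identity vanishes, because all other
  strings have trace zero.\<close>

lemma hermitian_traceless_pauli:
  assumes H: "H \<in> carrier_mat (2^n) (2^n)" "madj H = H" and tr: "(\<Sum>i<2^n. H $$ (i,i)) = 0"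
  shows "\<exists>a. \<forall>i<2^n. \<forall>j<2^n. H $$ (i,j) = (\<Sum>P\<in>Paulis n. complex_of_real (a P) * P $$ (i,j))"
proof -
  let ?N = "2^n :: nat"
  obtain \<alpha> where \<alpha>: "\<And>i j. i < ?N \<Longrightarrow> j < ?N \<Longrightarrow> H $$ (i,j) = (\<Sum>ks\<in>pauli_words n. \<alpha> ks * pauli_string ks $$ (i,j))"
    using pauli_string_span[OF H(1)] by blast
  define \<beta> where "\<beta> P = \<alpha> (the_inv_into (pauli_words n) pauli_string P)" for P
  have \<beta>: "H $$ (i,j) = (\<Sum>P\<in>pauli_all n. \<beta> P * P $$ (i,j))" if "i < ?N" "j < ?N" for i j
    unfolding pauli_all_def sum.reindex[OF inj_pauli_string]
    by (simp add: \<alpha>[OF that] \<beta>_def the_inv_into_f_f[OF inj_pauli_string])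
  have real: "H $$ (i,j) = (\<Sum>P\<in>pauli_all n. complex_of_real (Re (\<beta> P)) * P $$ (i,j))" if "i < ?N" "j < ?N" for i j
  proof -
    have P_herm: "cnj (P $$ (j,i)) = P $$ (i,j)" if "P \<in> pauli_all n" for P
      using pauli_all_props(1,3)[OF that] \<open>i < ?N\<close> \<open>j < ?N\<close> by (metis carrier_matD madj_index)
    have "H $$ (i,j) = cnj (H $$ (j,i))"
      using H that by (metis carrier_matD madj_index)
    also have "\<dots> = (\<Sum>P\<in>pauli_all n. cnj (\<beta> P) * P $$ (i,j))"
      using that by (simp add: \<beta> P_herm)
    finally have "2 * H $$ (i,j) = (\<Sum>P\<in>pauli_all n. (\<beta> P + cnj (\<beta> P)) * P $$ (i,j))"
      using \<beta>[OF that] by (simp add: distrib_right sum.distrib)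
    also have "\<dots> = (\<Sum>P\<in>pauli_all n. 2 * (complex_of_real (Re (\<beta> P)) * P $$ (i,j)))"
      by (simp add: complex_add_cnj ac_simps)
    also have "\<dots> = 2 * (\<Sum>P\<in>pauli_all n. complex_of_real (Re (\<beta> P)) * P $$ (i,j))"
      by (simp add: sum_distrib_left)
    finally show ?thesis by simp
  qed
  let ?one = "1\<^sub>m ?N :: complex mat"
  have split: "H $$ (i,j) = complex_of_real (Re (\<beta> ?one)) * ?one $$ (i,j) + (\<Sum>P\<in>Paulis n. complex_of_real (Re (\<beta> P)) * P $$ (i,j))"
    if "i < ?N" "j < ?N" for i j
    unfolding real[OF that] Paulis_eq by (rule sum.remove[OF finite_pauli_all one_pauli_all])
  have "(\<Sum>i<?N. \<Sum>P\<in>Paulis n. complex_of_real (Re (\<beta> P)) * P $$ (i,i)) = (\<Sum>P\<in>Paulis n. complex_of_real (Re (\<beta> P)) * (\<Sum>i<?N. P $$ (i,i)))"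
    by (subst sum.swap) (simp add: sum_distrib_left)
  also have "\<dots> = 0"
    using Paulis_partner anticomm_traceless by (intro sum.neutral) fastforce
  finally have "(\<Sum>i<?N. H $$ (i,i)) = of_nat ?N * complex_of_real (Re (\<beta> ?one))"
    using split by (simp add: sum.distrib)
  then have "complex_of_real (Re (\<beta> ?one)) = 0" using tr by simp
  then show ?thesis using split by (intro exI[of _ "\<lambda>P. Re (\<beta> P)"]) auto
qed

text \<open>The factor \<open>2\<close> in the angle compensates the half angle in
  \<open>rot\<close>.\<close>

lemma rot_deriv:
  assumes "P \<in> carrier_mat N N"
  shows "mat_deriv N (\<lambda>s. rot N P (2 * s * a)) ((\<i> * complex_of_real a) \<cdot>\<^sub>m P) 0"
  unfolding mat_deriv_def
proof (intro allI impI)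
  fix i j assume ij: "i < N" "j < N"
  have c: "((\<lambda>s. complex_of_real (cos (s * a))) has_vector_derivative complex_of_real 0) (at 0)"
    by (intro has_vector_derivative_of_real) (auto intro!: derivative_eq_intros simp flip: has_real_derivative_iff_has_vector_derivative)
  have s: "((\<lambda>s. complex_of_real (sin (s * a))) has_vector_derivative complex_of_real a) (at 0)"
    by (intro has_vector_derivative_of_real) (auto intro!: derivative_eq_intros simp flip: has_real_derivative_iff_has_vector_derivative)
  have "((\<lambda>s. complex_of_real (cos (s * a)) * 1\<^sub>m N $$ (i,j) + complex_of_real (sin (s * a)) * (\<i> * P $$ (i,j)))
      has_vector_derivative (complex_of_real 0 * 1\<^sub>m N $$ (i,j) + complex_of_real a * (\<i> * P $$ (i,j)))) (at 0)"
    by (intro has_vector_derivative_add has_vector_derivative_mult_left c s)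
  then show "((\<lambda>s. rot N P (2 * s * a) $$ (i,j)) has_vector_derivative ((\<i> * complex_of_real a) \<cdot>\<^sub>m P) $$ (i,j)) (at 0)"
    using ij assms by (simp add: rot_def ac_simps)
qed

context su_rep
begin

text \<open>The stabiliser of \<open>v\<close>. Its closure under products and limits lets
  invariance pass from Pauli rotations to all of \<open>SU N\<close>.\<close>

definition fixer :: "complex vec \<Rightarrow> complex mat set" where
  "fixer v = {U \<in> SU N. \<rho> U *\<^sub>v v = v}"

lemma fixer_mult:
  assumes v: "v \<in> carrier_vec d" and "U \<in> fixer v" "V \<in> fixer v"
  shows "U * V \<in> fixer v"
proof -
  have UV: "U \<in> SU N" "V \<in> SU N" using assms by (auto simp: fixer_def)
  have "(\<rho> U * \<rho> V) *\<^sub>v v = \<rho> U *\<^sub>v (\<rho> V *\<^sub>v v)"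
    by (rule assoc_mult_mat_vec[OF rho_carrier[OF UV(1)] rho_carrier[OF UV(2)] v])
  then show ?thesis using assms UV by (auto simp: fixer_def mult_SU rho_mult)
qed

lemma fixer_one: "v \<in> carrier_vec d \<Longrightarrow> 1\<^sub>m N \<in> fixer v"
  by (auto simp: fixer_def one_SU rho_one)

lemma fixer_pow: "v \<in> carrier_vec d \<Longrightarrow> U \<in> fixer v \<Longrightarrow> U ^\<^sub>m k \<in> fixer v"
  by (induction k) (auto simp: fixer_one fixer_mult, auto simp: fixer_def dest!: SU_D(1) intro: one_SU, simp add: rho_one)

lemma fixer_closed:
  assumes v: "v \<in> carrier_vec d" and g: "\<And>k. \<gamma> k \<in> fixer v" and U: "U \<in> SU N"
    and lim: "\<And>i j. i < N \<Longrightarrow> j < N \<Longrightarrow> (\<lambda>k::nat. \<gamma> k $$ (i,j)) \<longlonglongrightarrow> U $$ (i,j)"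
  shows "U \<in> fixer v"
proof -
  have gS: "\<gamma> k \<in> SU N" for k using g by (auto simp: fixer_def)
  have "\<rho> U *\<^sub>v v = v"
  proof (rule eq_vecI)
    fix i assume "i < dim_vec v"
    then have i: "i < d" using v by simp
    have "(\<lambda>k. \<Sum>j<d. \<rho> (\<gamma> k) $$ (i,j) * v $ j) \<longlonglongrightarrow> (\<Sum>j<d. \<rho> U $$ (i,j) * v $ j)"
      by (intro tendsto_sum tendsto_mult tendsto_const rho_entry_tendsto U lim i) (auto simp: gS)
    moreover have "(\<Sum>j<d. \<rho> (\<gamma> k) $$ (i,j) * v $ j) = v $ i" for k
      using g[of k] mult_vec_index[OF rho_carrier[OF gS] v i, of k] by (simp add: fixer_def)
    ultimately have "(\<Sum>j<d. \<rho> U $$ (i,j) * v $ j) = v $ i"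
      by (simp add: LIMSEQ_const_iff)
    then show "(\<rho> U *\<^sub>v v) $ i = v $ i"
      using mult_vec_index[OF rho_carrier[OF U] v i] by simp
  qed (use rho_carrier[OF U] v in auto)
  then show ?thesis using U by (simp add: fixer_def)
qed

text \<open>Infinitesimal invariance implies invariance. \<open>U\<close> is the value at
  \<open>1\<close> of a one-parameter group \<open>G\<close> with a traceless Hermitian generator
  \<open>H\<close>. Expanding \<open>H\<close> in strings gives a product \<open>F\<close> of Pauli
  rotations with the same derivative at \<open>0\<close>, and the powers
  \<open>F (1/k) ^\<^sub>m k\<close> stabilise \<open>v\<close> and converge to
  \<open>U\<close>.\<close>

lemma SU_in_fixer:
  assumes N: "N = 2^n" and v: "v \<in> carrier_vec d"
    and kill: "\<And>P. P \<in> Paulis n \<Longrightarrow> drho P *\<^sub>v v = 0\<^sub>v d"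
    and U: "U \<in> SU N"
  shows "U \<in> fixer v"
proof -
  have partner: "\<exists>Q. anticomm N P Q" if "P \<in> Paulis n" for P
    using Paulis_partner[OF that] N by auto
  have Pc: "P \<in> carrier_mat N N" if "P \<in> Paulis n" for P
    using partner[OF that] anticommD(1) by blast
  have rot_fix: "rot N P s \<in> fixer v" if P: "P \<in> Paulis n" for P s
  proof -
    obtain Q where Q: "anticomm N P Q" using partner[OF P] by blast
    have "rhot P s *\<^sub>v v = v"
      using rhot_carrier[OF Q] rhot_deriv(1)[OF Q] rhot_zero[OF Q] drho_carrier v kill[OF P]
      by (rule one_param_group_fixes)
    then show ?thesis using rot_SU[OF Q] by (simp add: fixer_def rhot_def)
  qed
  have N0: "N > 0" by (simp add: N)
  obtain W \<theta> where W: "unitary_mat N W" and th: "(\<Sum>i<N. \<theta> i) = (0::real)"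
    and UW: "U = W * mat_diag N (\<lambda>i. cis (\<theta> i)) * madj W"
    using SU_diagonalize[OF U N0] by blast
  note Wc = unitary_matD[OF W]
  define G where "G s = W * mat_diag N (\<lambda>i. cis (s * \<theta> i)) * madj W" for s :: real
  define H where "H = W * mat_diag N (\<lambda>i. complex_of_real (\<theta> i)) * madj W"
  have Dc: "mat_diag N f \<in> carrier_mat N N" for f :: "nat \<Rightarrow> complex" by simp
  have entry: "(W * mat_diag N f * madj W) $$ (i,j) = (\<Sum>k<N. W $$ (i,k) * f k * cnj (W $$ (j,k)))"
    if "i < N" "j < N" for i j f
  proof -
    have "(W * mat_diag N f * madj W) $$ (i,j) = (\<Sum>k<N. (W * mat_diag N f) $$ (i,k) * madj W $$ (k,j))"
      using Wc(1,2) Dc that by (intro mult_index[of _ N N]) auto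
    also have "\<dots> = (\<Sum>k<N. W $$ (i,k) * f k * cnj (W $$ (j,k)))"
      using Wc(1) that by (intro sum.cong refl) (auto simp: mat_diag_mult_right[OF Wc(1)])
    finally show ?thesis .
  qed
  have herm: "madj (W * mat_diag N f * madj W) = W * mat_diag N (\<lambda>k. cnj (f k)) * madj W" for f
  proof (rule eq_matI)
    fix i j assume "i < dim_row (W * mat_diag N (\<lambda>k. cnj (f k)) * madj W)" "j < dim_col (W * mat_diag N (\<lambda>k. cnj (f k)) * madj W)"
    then have ij: "i < N" "j < N" using Wc(1) by auto
    have "W * mat_diag N f * madj W \<in> carrier_mat N N" using Wc(1,2) Dc by simp
    then have "madj (W * mat_diag N f * madj W) $$ (i,j) = cnj ((W * mat_diag N f * madj W) $$ (j,i))"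
      using ij by (metis carrier_matD madj_index)
    then show "madj (W * mat_diag N f * madj W) $$ (i,j) = (W * mat_diag N (\<lambda>k. cnj (f k)) * madj W) $$ (i,j)"
      using ij by (simp only: entry) (simp add: ac_simps)
  qed (use Wc(1) in auto)
  have Gc: "G s \<in> carrier_mat N N" for s using Wc(1,2) Dc by (simp add: G_def)
  have Hc: "H \<in> carrier_mat N N" using Wc(1,2) Dc by (simp add: H_def)
  have Gadd: "G (s + t) = G s * G t" for s t
  proof -
    have "G s * G t = W * (mat_diag N (\<lambda>i. cis (s * \<theta> i)) * mat_diag N (\<lambda>i. cis (t * \<theta> i))) * madj W"
      unfolding G_def using mult_cancel_mid[of "W * mat_diag N (\<lambda>i. cis (s * \<theta> i))" N N "madj W" W "mat_diag N (\<lambda>i. cis (t * \<theta> i)) * madj W" N] Wc Dc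
      by (simp add: assoc_mult_mat[of _ N N _ N _ N] del: mat_diag_diag)
    then show ?thesis by (simp add: G_def cis_mult distrib_right)
  qed
  have G0: "G 0 = 1\<^sub>m N"
  proof -
    have "mat_diag N (\<lambda>i. 1) = (1\<^sub>m N :: complex mat)" by (auto simp: mat_diag_def intro!: eq_matI)
    then show ?thesis using Wc by (simp add: G_def)
  qed
  have G1: "G 1 = U" by (simp add: G_def UW)
  have Gadj: "madj (G s) = G (- s)" for s
    unfolding G_def herm by (simp add: cis_cnj)
  have Gu: "unitary_mat N (G s)" for s
    using Gadd[of s "- s"] Gadd[of "- s" s] Gc by (simp add: unitary_mat_def Gadj G0)
  have Gpow: "G s ^\<^sub>m k = G (real k * s)" for s k
    by (induction k) (use Gc[of s] in \<open>auto simp: G0 distrib_right Gadd[symmetric] add.commute\<close>)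
  have dG: "mat_deriv N G (\<i> \<cdot>\<^sub>m H) 0"
    unfolding mat_deriv_def
  proof (intro allI impI)
    fix i j assume ij: "i < N" "j < N"
    have "((\<lambda>s. \<Sum>k<N. W $$ (i,k) * cis (s * \<theta> k) * cnj (W $$ (j,k))) has_vector_derivative
        (\<Sum>k<N. W $$ (i,k) * (\<i> * complex_of_real (\<theta> k)) * cnj (W $$ (j,k)))) (at 0)"
    proof (intro has_vector_derivative_sum has_vector_derivative_mult_left has_vector_derivative_mult_right)
      fix k
      show "((\<lambda>s. cis (s * \<theta> k)) has_vector_derivative \<i> * complex_of_real (\<theta> k)) (at 0)"
        unfolding has_vector_derivative_complex_iff
        by (auto intro!: derivative_eq_intros simp flip: has_real_derivative_iff_has_vector_derivative)
    qed
    moreover have "(\<i> \<cdot>\<^sub>m H) $$ (i,j) = (\<Sum>k<N. W $$ (i,k) * (\<i> * complex_of_real (\<theta> k)) * cnj (W $$ (j,k)))"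
    proof -
      have "(\<i> \<cdot>\<^sub>m H) $$ (i,j) = \<i> * H $$ (i,j)" using Hc ij by simp
      also have "\<dots> = (\<Sum>k<N. W $$ (i,k) * (\<i> * complex_of_real (\<theta> k)) * cnj (W $$ (j,k)))"
        unfolding H_def entry[OF ij] by (simp add: sum_distrib_left ac_simps)
      finally show ?thesis .
    qed
    moreover have "(\<lambda>s. G s $$ (i,j)) = (\<lambda>s. \<Sum>k<N. W $$ (i,k) * cis (s * \<theta> k) * cnj (W $$ (j,k)))"
      unfolding G_def entry[OF ij] ..
    ultimately show "((\<lambda>s. G s $$ (i,j)) has_vector_derivative (\<i> \<cdot>\<^sub>m H) $$ (i,j)) (at 0)" by simp
  qed
  have Hherm: "madj H = H"
    unfolding H_def herm by simp
  have "(\<Sum>i<N. H $$ (i,i)) = (\<Sum>i<N. \<Sum>k<N. W $$ (i,k) * complex_of_real (\<theta> k) * cnj (W $$ (i,k)))"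
    by (simp add: H_def entry)
  also have "\<dots> = (\<Sum>k<N. complex_of_real (\<theta> k) * (\<Sum>i<N. cnj (W $$ (i,k)) * W $$ (i,k)))"
    by (subst sum.swap) (simp add: sum_distrib_left ac_simps)
  also have "\<dots> = (\<Sum>k<N. complex_of_real (\<theta> k))"
  proof (intro sum.cong refl)
    fix k assume "k \<in> {..<N}"
    then have k: "k < N" by simp
    have "(madj W * W) $$ (k,k) = (\<Sum>i<N. cnj (W $$ (i,k)) * W $$ (i,k))"
      using Wc(1) k by (subst mult_index[OF Wc(2,1)]) auto
    then show "complex_of_real (\<theta> k) * (\<Sum>i<N. cnj (W $$ (i,k)) * W $$ (i,k)) = complex_of_real (\<theta> k)"
      using Wc(4) k by simp
  qed
  also have "\<dots> = 0" unfolding of_real_sum[symmetric] th by simp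
  finally have "(\<Sum>i<2^n. H $$ (i,i)) = 0" by (simp add: N)
  then obtain a where a: "\<And>i j. i < N \<Longrightarrow> j < N \<Longrightarrow> H $$ (i,j) = (\<Sum>P\<in>Paulis n. complex_of_real (a P) * P $$ (i,j))"
    using hermitian_traceless_pauli[of H n] Hc Hherm unfolding N by blast
  \<comment> \<open>One rotation per string, multiplied in arbitrary order: the order does not
    affect the derivative at \<open>0\<close>, where all factors are the identity.\<close>
  have prod: "\<exists>F. (\<forall>s. F s \<in> fixer v) \<and> F 0 = 1\<^sub>m N \<and>
      mat_deriv N F (mat_lincomb N S (\<lambda>P. \<i> * complex_of_real (a P)) (\<lambda>P. P)) 0"
    if "finite S" "S \<subseteq> Paulis n" for S
    using that
  proof (induction S rule: finite_induct)
    case empty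
    have "mat_lincomb N {} (\<lambda>P. \<i> * complex_of_real (a P)) (\<lambda>P. P) = 0\<^sub>m N N"
      by (auto simp: mat_lincomb_def intro!: eq_matI)
    then show ?case
      using mat_deriv_const[of N "1\<^sub>m N" 0] fixer_one[OF v] by (intro exI[of _ "\<lambda>_. 1\<^sub>m N"]) auto
  next
    case (insert P S)
    let ?L = "mat_lincomb N S (\<lambda>P. \<i> * complex_of_real (a P)) (\<lambda>P. P)"
    obtain F where F: "\<And>s. F s \<in> fixer v" "F 0 = 1\<^sub>m N" "mat_deriv N F ?L 0"
      using insert by auto
    have P: "P \<in> Paulis n" using insert by simp
    obtain Q where Q: "anticomm N P Q" using partner[OF P] by blast
    have Fc: "F s \<in> carrier_mat N N" for s using F(1)[of s] by (auto simp: fixer_def dest: SU_D(1))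
    let ?R = "\<lambda>s. rot N P (2 * s * a P)"
    have "mat_deriv N (\<lambda>s. ?R s * F s) (?R 0 * ?L + ((\<i> * complex_of_real (a P)) \<cdot>\<^sub>m P) * F 0) 0"
      using Pc[OF P] Fc F(3) by (intro mat_deriv_mult rot_deriv) auto
    moreover have "?R 0 * ?L + ((\<i> * complex_of_real (a P)) \<cdot>\<^sub>m P) * F 0
        = mat_lincomb N (insert P S) (\<lambda>P. \<i> * complex_of_real (a P)) (\<lambda>P. P)"
      using Pc[OF P] insert.hyps rot_zero[OF Q] F(2)
      by (simp add: left_mult_one_mat[of _ N N] right_mult_one_mat[of _ N N])
        (auto simp: mat_lincomb_def intro!: eq_matI)
    ultimately show ?case
      using F rot_fix[OF P] fixer_mult[OF v] rot_zero[OF Q]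
      by (intro exI[of _ "\<lambda>s. ?R s * F s"]) auto
  qed
  obtain F where F: "\<And>s. F s \<in> fixer v" "F 0 = 1\<^sub>m N"
    "mat_deriv N F (mat_lincomb N (Paulis n) (\<lambda>P. \<i> * complex_of_real (a P)) (\<lambda>P. P)) 0"
    using prod[OF finite_Paulis order_refl] by blast
  have FS: "F s \<in> SU N" for s using F(1)[of s] by (simp add: fixer_def)
  have "mat_lincomb N (Paulis n) (\<lambda>P. \<i> * complex_of_real (a P)) (\<lambda>P. P) = \<i> \<cdot>\<^sub>m H"
    using Hc by (intro eq_matI) (auto simp: mat_lincomb_def a sum_distrib_left ac_simps)
  then have dF: "mat_deriv N F (\<i> \<cdot>\<^sub>m H) 0" using F(3) by simp
  define \<delta> where "\<delta> k = (\<Sum>i<N. \<Sum>j<N. cmod ((F (1 / real k) - G (1 / real k)) $$ (i,j)))" for k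
  have lim0: "(\<lambda>k. real k * \<delta> k) \<longlonglongrightarrow> 0"
    unfolding \<delta>_def by (rule mat_deriv_diff_quotient[OF dF dG]) (use F(2) G0 Gc FS SU_D(1) in auto)
  show ?thesis
  proof (rule fixer_closed[OF v _ U])
    show "F (1 / real k) ^\<^sub>m k \<in> fixer v" for k by (rule fixer_pow[OF v F(1)])
    fix i j assume ij: "i < N" "j < N"
    \<comment> \<open>The error of the \<open>k\<close>-th Trotter approximation, read off column
      \<open>j\<close> and row \<open>i\<close>, with \<open>G (1/k)\<close> raised to the power
      \<open>k\<close> equal to \<open>U\<close>.\<close>
    have le: "cmod ((F (1 / real k) ^\<^sub>m k) $$ (i,j) - U $$ (i,j)) \<le> real k * \<delta> k" if k: "k > 0" for k
    proof -
      let ?A = "F (1 / real k)" and ?B = "G (1 / real k)"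
      have AB: "?A - ?B \<in> carrier_mat N N" by (rule minus_carrier_mat[OF Gc])
      have BU: "?B ^\<^sub>m k = U" using k by (simp add: Gpow G1)
      have Ac: "?A ^\<^sub>m k \<in> carrier_mat N N" using SU_D(1)[OF FS] by simp
      have e: "vnorm (unit_vec N j :: complex vec) = 1"
        using ij by (simp add: vnorm_unit_vec)
      have "vnorm ((?A ^\<^sub>m k) *\<^sub>v unit_vec N j - (?B ^\<^sub>m k) *\<^sub>v unit_vec N j) \<le> real k * \<delta> k * vnorm (unit_vec N j)"
        unfolding \<delta>_def
        by (rule unitary_pow_diff[OF SU_D(2)[OF FS] Gu vnorm_mult_mat_vec_le[OF AB]]) auto
      moreover have "cmod (((?A ^\<^sub>m k) *\<^sub>v unit_vec N j - U *\<^sub>v unit_vec N j) $ i)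
          \<le> vnorm ((?A ^\<^sub>m k) *\<^sub>v unit_vec N j - U *\<^sub>v unit_vec N j)"
        using Ac SU_D(1)[OF U] ij by (intro cmod_index_le_vnorm) auto
      moreover have "((?A ^\<^sub>m k) *\<^sub>v unit_vec N j - U *\<^sub>v unit_vec N j) $ i = (?A ^\<^sub>m k) $$ (i,j) - U $$ (i,j)"
        using carrier_matD[OF Ac] carrier_matD[OF SU_D(1)[OF U]] ij by (simp add: scalar_prod_right_unit)
      ultimately show ?thesis by (simp add: e BU)
    qed
    have "(\<lambda>k. (F (1 / real k) ^\<^sub>m k) $$ (i,j) - U $$ (i,j)) \<longlonglongrightarrow> 0"
      by (rule Lim_null_comparison[OF _ lim0]) (use le in \<open>auto intro!: eventually_sequentiallyI[of 1]\<close>)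
    then show "(\<lambda>k. (F (1 / real k) ^\<^sub>m k) $$ (i,j)) \<longlonglongrightarrow> U $$ (i,j)"
      by (simp add: LIM_zero_iff)
  qed
qed

end

section \<open>Haar averages and the Casimir operator\<close>

lemma haar_SU_D:
  assumes "haar_SU N \<mu>"
  shows "prob_space \<mu>" "space \<mu> = SU N" "sets \<mu> = SU_sets N"
    "\<And>V A. V \<in> SU N \<Longrightarrow> A \<in> sets \<mu> \<Longrightarrow> emeasure \<mu> ((\<lambda>U. V * U) ` A) = emeasure \<mu> A"
  using assms by (auto simp: haar_SU_def)

lemma haar_entry_measurable:
  assumes "haar_SU N \<mu>" "i < N" "j < N"
  shows "(\<lambda>U. U $$ (i,j)) \<in> borel_measurable \<mu>"
proof (rule borel_measurableI)
  fix B :: "complex set" assume "open B"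
  moreover have "(\<lambda>U. U $$ (i,j)) -` B \<inter> space \<mu> = {U \<in> SU N. U $$ (i,j) \<in> B}"
    using haar_SU_D(2)[OF assms(1)] by auto
  ultimately show "(\<lambda>U. U $$ (i,j)) -` B \<inter> space \<mu> \<in> sets \<mu>"
    using assms by (auto simp: haar_SU_D(3)[OF assms(1)] SU_sets_def intro!: sigma_sets.Basic)
qed

lemma haar_translate_measurable:
  assumes h: "haar_SU N \<mu>" and V: "V \<in> SU N"
  shows "(\<lambda>U. V * U) \<in> measurable \<mu> \<mu>"
proof (rule measurable_sigma_sets)
  show "sets \<mu> = sigma_sets (SU N) {{U \<in> SU N. U $$ (i,j) \<in> B} | i j B. i < N \<and> j < N \<and> open B}"
    using haar_SU_D(3)[OF h] by (simp add: SU_sets_def)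
  show "(\<lambda>U. V * U) \<in> space \<mu> \<rightarrow> SU N"
    using haar_SU_D(2)[OF h] V by (auto intro: mult_SU)
  fix A assume "A \<in> {{U \<in> SU N. U $$ (i,j) \<in> B} | i j B. i < N \<and> j < N \<and> open B}"
  then obtain i j B where A: "A = {U \<in> SU N. U $$ (i,j) \<in> B}" and ij: "i < N" "j < N" and B: "open B" by blast
  have "(\<lambda>U. V * U) -` A \<inter> space \<mu> = (\<lambda>U. \<Sum>k<N. V $$ (i,k) * U $$ (k,j)) -` B \<inter> space \<mu>"
    using V ij mult_index[OF SU_D(1)[OF V] SU_D(1) ij] by (auto simp: haar_SU_D(2)[OF h] A mult_SU simp del: index_mult_mat(1))
  moreover have "(\<lambda>U. \<Sum>k<N. V $$ (i,k) * U $$ (k,j)) \<in> borel_measurable \<mu>"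
    using ij by (intro borel_measurable_sum borel_measurable_times borel_measurable_const haar_entry_measurable[OF h]) auto
  ultimately show "(\<lambda>U. V * U) -` A \<inter> space \<mu> \<in> sets \<mu>"
    using B by (simp add: measurable_sets borel_open)
qed auto

text \<open>\<open>haar_SU\<close> states invariance for images, whereas \<open>distr\<close>
  concerns preimages. The preimage under multiplication by \<open>V\<close> is the image under
  multiplication by \<open>madj V\<close>.\<close>

lemma haar_translate:
  assumes h: "haar_SU N \<mu>" and V: "V \<in> SU N"
  shows "distr \<mu> \<mu> (\<lambda>U. V * U) = \<mu>"
proof (rule measure_eqI)
  fix A assume "A \<in> sets (distr \<mu> \<mu> (\<lambda>U. V * U))"
  then have A: "A \<in> sets \<mu>" by simp
  have sub: "A \<subseteq> SU N" using sets.sets_into_space[OF A] haar_SU_D(2)[OF h] by simp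
  note Vc = unitary_matD[OF SU_D(2)[OF V]]
  have cancel: "V * (madj V * U) = U" "madj V * (V * U) = U" if "U \<in> SU N" for U
    using SU_D(1)[OF that] assoc_mult_mat[OF Vc(1,2) SU_D(1)[OF that]] assoc_mult_mat[OF Vc(2,1) SU_D(1)[OF that]]
    by (simp_all add: Vc(3,4))
  have "(\<lambda>U. V * U) -` A \<inter> space \<mu> = (\<lambda>U. madj V * U) ` A"
  proof (intro subset_antisym subsetI)
    fix U assume "U \<in> (\<lambda>U. V * U) -` A \<inter> space \<mu>"
    then show "U \<in> (\<lambda>U. madj V * U) ` A"
      using cancel(2)[of U] haar_SU_D(2)[OF h] by (intro image_eqI[of _ _ "V * U"]) auto
  next
    fix U assume "U \<in> (\<lambda>U. madj V * U) ` A"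
    then show "U \<in> (\<lambda>U. V * U) -` A \<inter> space \<mu>"
      using cancel(1) sub haar_SU_D(2)[OF h] madj_SU[OF V] by (auto intro!: mult_SU)
  qed
  then show "emeasure (distr \<mu> \<mu> (\<lambda>U. V * U)) A = emeasure \<mu> A"
    using emeasure_distr[OF haar_translate_measurable[OF h V] A] haar_SU_D(4)[OF h madj_SU[OF V] A] by simp
qed simp

lemma haar_integral_translate:
  fixes f :: "complex mat \<Rightarrow> complex"
  assumes h: "haar_SU N \<mu>" and V: "V \<in> SU N" and f: "f \<in> borel_measurable \<mu>"
  shows "integral\<^sup>L \<mu> (\<lambda>U. f (V * U)) = integral\<^sup>L \<mu> f"
  using integral_distr[OF haar_translate_measurable[OF h V] f] by (simp add: haar_translate[OF h V])

lemma ip_cauchy_schwarz: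
  assumes "v \<in> carrier_vec d" "w \<in> carrier_vec d"
  shows "cmod (ip v w) \<le> vnorm v * vnorm w"
proof -
  have "cmod (ip v w) \<le> (\<Sum>i<d. \<bar>cmod (v $ i)\<bar> * \<bar>cmod (w $ i)\<bar>)"
    using assms unfolding ip_def by (auto intro!: order.trans[OF norm_sum] simp: norm_mult)
  also have "\<dots> \<le> L2_set (\<lambda>i. cmod (v $ i)) {..<d} * L2_set (\<lambda>i. cmod (w $ i)) {..<d}"
    by (rule L2_set_mult_ineq)
  finally show ?thesis using assms by (simp add: vnorm_L2)
qed

lemma mat_eqI_vec:
  assumes "A \<in> carrier_mat d d" "B \<in> carrier_mat d d" "\<And>v. v \<in> carrier_vec d \<Longrightarrow> A *\<^sub>v v = B *\<^sub>v v"
  shows "A = (B :: complex mat)"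
proof (rule eq_matI)
  fix i j assume "i < dim_row B" "j < dim_col B"
  then have ij: "i < d" "j < d" using assms by auto
  have "(A *\<^sub>v unit_vec d j) $ i = (B *\<^sub>v unit_vec d j) $ i"
    using assms(3)[of "unit_vec d j"] by simp
  then show "A $$ (i,j) = B $$ (i,j)"
    using ij carrier_matD[OF assms(1)] carrier_matD[OF assms(2)] by (simp add: scalar_prod_right_unit)
qed (use assms in auto)

lemma uminus_mult_vec:
  "A \<in> carrier_mat d d \<Longrightarrow> v \<in> carrier_vec d \<Longrightarrow> (- A) *\<^sub>v v = (-1) \<cdot>\<^sub>v (A *\<^sub>v v)" for A :: "complex mat"
  by (intro eq_vecI) (auto simp: scalar_prod_def sum_negf)

lemma unitary_entry_le_1:
  assumes U: "unitary_mat d U" and ij: "i < d" "j < d"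
  shows "cmod (U $$ (i,j)) \<le> 1"
proof -
  note Uc = unitary_matD(1)[OF U]
  have e: "vnorm (unit_vec d j :: complex vec) = 1"
    using ij by (simp add: vnorm_unit_vec)
  have "cmod ((U *\<^sub>v unit_vec d j) $ i) \<le> vnorm (U *\<^sub>v unit_vec d j)"
    using Uc ij by (intro cmod_index_le_vnorm) auto
  then show ?thesis
    using unitary_vnorm[OF U, of "unit_vec d j"] Uc ij by (simp add: e scalar_prod_right_unit)
qed

context su_rep
begin

text \<open>The sigma-algebra is generated by single matrix entries, so measurability of a
  continuous function of all entries has to pass through a product space. There the preimage of
  \<open>B\<close> becomes the preimage of one open set.\<close>

lemma rho_measurable:
  assumes h: "haar_SU N \<mu>" and ij: "i < d" "j < d"
  shows "(\<lambda>U. \<rho> U $$ (i,j)) \<in> borel_measurable \<mu>"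
proof (rule borel_measurableI)
  fix B :: "complex set" assume B: "open B"
  \<comment> \<open>Matrices become functions on pairs of indices, extended by \<open>0\<close>. The
    index type is countable, so measurability of the coordinates gives measurability into the
    product.\<close>
  define E :: "complex mat \<Rightarrow> nat \<times> nat \<Rightarrow> complex" where
    "E U p = (if fst p < N \<and> snd p < N then U $$ p else 0)" for U p
  have "(\<lambda>U. E U p) \<in> borel_measurable \<mu>" for p
    using haar_entry_measurable[OF h, of "fst p" "snd p"] by (cases "fst p < N \<and> snd p < N") (auto simp: E_def)
  then have Em: "E \<in> borel_measurable \<mu>"
    by (rule measurable_coordinatewise_then_product)
  define dist_to where "dist_to U x = (\<Sum>i<N. \<Sum>j<N. cmod (U $$ (i,j) - x (i,j)))" for U :: "complex mat" and x :: "nat \<times> nat \<Rightarrow> complex"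
  have ex: "\<exists>\<delta>>0. \<forall>V\<in>SU N. dist_to U (E V) < \<delta> \<longrightarrow> \<rho> V $$ (i,j) \<in> B"
    if U: "U \<in> SU N" "\<rho> U $$ (i,j) \<in> B" for U
  proof -
    obtain e where e: "e > 0" "ball (\<rho> U $$ (i,j)) e \<subseteq> B"
      using B U(2) by (auto simp: open_contains_ball)
    obtain \<delta> where \<delta>: "\<delta> > 0" "\<forall>V\<in>SU N. (\<Sum>i<N. \<Sum>j<N. cmod (U $$ (i,j) - V $$ (i,j))) < \<delta> \<longrightarrow>
           (\<forall>i<d. \<forall>j<d. cmod (\<rho> U $$ (i,j) - \<rho> V $$ (i,j)) < e)"
      using rho_entry_continuous[OF U(1) e(1)] by blast
    have "dist_to U (E V) = (\<Sum>i<N. \<Sum>j<N. cmod (U $$ (i,j) - V $$ (i,j)))" for V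
      by (simp add: dist_to_def E_def)
    then have "\<rho> V $$ (i,j) \<in> B" if "V \<in> SU N" "dist_to U (E V) < \<delta>" for V
      using \<delta>(2) that ij e(2) by (auto simp: dist_norm subset_iff)
    then show ?thesis using \<delta>(1) by blast
  qed
  then obtain \<delta> where \<delta>: "\<And>U. U \<in> SU N \<Longrightarrow> \<rho> U $$ (i,j) \<in> B \<Longrightarrow> \<delta> U > 0"
    "\<And>U V. U \<in> SU N \<Longrightarrow> \<rho> U $$ (i,j) \<in> B \<Longrightarrow> V \<in> SU N \<Longrightarrow> dist_to U (E V) < \<delta> U \<Longrightarrow> \<rho> V $$ (i,j) \<in> B"
    by metis
  \<comment> \<open>An arbitrary union of neighbourhoods is open, and the radii
    \<open>\<delta> U\<close> were chosen so that no element of \<open>SU N\<close> outside the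
    preimage of \<open>B\<close> enters it.\<close>
  define G where "G = (\<Union>U\<in>{U \<in> SU N. \<rho> U $$ (i,j) \<in> B}. {x. dist_to U x < \<delta> U})"
  have cont: "continuous_on UNIV (\<lambda>x. dist_to U x)" for U
    unfolding dist_to_def by (intro continuous_intros continuous_on_product_coordinates)
  have "open G"
    unfolding G_def by (intro open_UN ballI open_Collect_less cont continuous_on_const)
  moreover have "(\<lambda>U. \<rho> U $$ (i,j)) -` B \<inter> space \<mu> = E -` G \<inter> space \<mu>"
  proof (intro subset_antisym subsetI)
    fix U assume "U \<in> (\<lambda>U. \<rho> U $$ (i,j)) -` B \<inter> space \<mu>"
    then have U: "U \<in> SU N" "\<rho> U $$ (i,j) \<in> B" using haar_SU_D(2)[OF h] by auto
    have "dist_to U (E U) = 0" by (simp add: dist_to_def E_def)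
    then show "U \<in> E -` G \<inter> space \<mu>"
      using U \<delta>(1)[OF U] haar_SU_D(2)[OF h] by (auto simp: G_def)
  next
    fix V assume "V \<in> E -` G \<inter> space \<mu>"
    then show "V \<in> (\<lambda>U. \<rho> U $$ (i,j)) -` B \<inter> space \<mu>"
      using \<delta>(2) haar_SU_D(2)[OF h] by (auto simp: G_def)
  qed
  ultimately show "(\<lambda>U. \<rho> U $$ (i,j)) -` B \<inter> space \<mu> \<in> sets \<mu>"
    using Em by (simp add: measurable_sets borel_open)
qed

lemma rho_integrable:
  assumes h: "haar_SU N \<mu>" and ij: "i < d" "j < d"
  shows "integrable \<mu> (\<lambda>U. \<rho> U $$ (i,j))"
proof -
  interpret prob_space \<mu> by (rule haar_SU_D(1)[OF h])
  show ?thesis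
    by (rule integrable_const_bound[of _ 1])
      (use haar_SU_D(2)[OF h] rho_unitary unitary_entry_le_1 ij rho_measurable[OF h ij] in \<open>auto intro!: AE_I2 unitary_entry_le_1[of d]\<close>)
qed

lemma haar_mean_carrier [simp]: "mat_expect d \<mu> \<rho> \<in> carrier_mat d d"
  by (simp add: mat_expect_def)

lemma rho_haar_mean:
  assumes h: "haar_SU N \<mu>" and V: "V \<in> SU N"
  shows "\<rho> V * mat_expect d \<mu> \<rho> = mat_expect d \<mu> \<rho>"
proof (rule eq_matI)
  fix i j assume "i < dim_row (mat_expect d \<mu> \<rho>)" "j < dim_col (mat_expect d \<mu> \<rho>)"
  then have ij: "i < d" "j < d" by (auto simp: mat_expect_def)
  have "(\<rho> V * mat_expect d \<mu> \<rho>) $$ (i,j) = (\<Sum>k<d. \<rho> V $$ (i,k) * (\<integral>U. \<rho> U $$ (k,j) \<partial>\<mu>))"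
    using ij by (subst mult_index[OF rho_carrier[OF V] haar_mean_carrier]) (auto simp: mat_expect_def)
  also have "\<dots> = (\<integral>U. (\<Sum>k<d. \<rho> V $$ (i,k) * \<rho> U $$ (k,j)) \<partial>\<mu>)"
    using rho_integrable[OF h] ij by (subst Bochner_Integration.integral_sum) auto
  also have "\<dots> = (\<integral>U. \<rho> (V * U) $$ (i,j) \<partial>\<mu>)"
  proof (rule Bochner_Integration.integral_cong)
    fix U assume "U \<in> space \<mu>"
    then have U: "U \<in> SU N" using haar_SU_D(2)[OF h] by simp
    show "(\<Sum>k<d. \<rho> V $$ (i,k) * \<rho> U $$ (k,j)) = \<rho> (V * U) $$ (i,j)"
      unfolding rho_mult[OF V U] by (rule mult_index[OF rho_carrier[OF V] rho_carrier[OF U] ij, symmetric])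
  qed simp
  also have "\<dots> = (\<integral>U. \<rho> U $$ (i,j) \<partial>\<mu>)"
    by (rule haar_integral_translate[OF h V rho_measurable[OF h ij]])
  finally show "(\<rho> V * mat_expect d \<mu> \<rho>) $$ (i,j) = mat_expect d \<mu> \<rho> $$ (i,j)"
    using ij by (simp add: mat_expect_def)
qed (use rho_carrier[OF V] in \<open>auto simp: mat_expect_def\<close>)

text \<open>A vector fixed by a unitary matrix is fixed by its adjoint, so the integrand is
  constant. The adjoint form is the one in which \<open>averaged_projections_bound\<close>
  recognises the Haar mean as a projection.\<close>

lemma haar_mean_fix:
  assumes h: "haar_SU N \<mu>" and v: "v \<in> carrier_vec d" and inv: "\<And>U. U \<in> SU N \<Longrightarrow> \<rho> U *\<^sub>v v = v"
  shows "madj (mat_expect d \<mu> \<rho>) *\<^sub>v v = v"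
proof (rule eq_vecI)
  interpret prob_space \<mu> by (rule haar_SU_D(1)[OF h])
  fix i assume "i < dim_vec v"
  then have i: "i < d" using v by simp
  let ?T = "mat_expect d \<mu> \<rho>"
  have "(madj ?T *\<^sub>v v) $ i = (\<Sum>k<d. cnj (\<integral>U. \<rho> U $$ (k,i) \<partial>\<mu>) * v $ k)"
    using i v by (subst mult_vec_index[of _ d d]) (auto simp: mat_expect_def)
  also have "\<dots> = (\<Sum>k<d. (\<integral>U. cnj (\<rho> U $$ (k,i)) * v $ k \<partial>\<mu>))"
    by (simp add: integral_cnj)
  also have "\<dots> = (\<integral>U. (\<Sum>k<d. cnj (\<rho> U $$ (k,i)) * v $ k) \<partial>\<mu>)"
    using rho_integrable[OF h] i by (subst Bochner_Integration.integral_sum) auto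
  also have "\<dots> = (\<integral>U. v $ i \<partial>\<mu>)"
  proof (rule Bochner_Integration.integral_cong)
    fix U assume "U \<in> space \<mu>"
    then have U: "U \<in> SU N" using haar_SU_D(2)[OF h] by simp
    note Uc = unitary_matD[OF rho_unitary[OF U]]
    have "madj (\<rho> U) *\<^sub>v v = v"
      using inv[OF U] assoc_mult_mat_vec[OF Uc(2,1) v] Uc(4) v by simp
    then have "v $ i = (madj (\<rho> U) *\<^sub>v v) $ i" by simp
    also have "\<dots> = (\<Sum>k<d. madj (\<rho> U) $$ (i,k) * v $ k)"
      by (rule mult_vec_index[OF Uc(2) v i])
    also have "\<dots> = (\<Sum>k<d. cnj (\<rho> U $$ (k,i)) * v $ k)"
      using Uc(1) i by (intro sum.cong refl) auto
    finally show "(\<Sum>k<d. cnj (\<rho> U $$ (k,i)) * v $ k) = v $ i" by simp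
  qed simp
  also have "\<dots> = v $ i" by (simp add: prob_space)
  finally show "(madj ?T *\<^sub>v v) $ i = v $ i" .
qed (use v in \<open>simp add: mat_expect_def\<close>)

text \<open>By left invariance of the mean, \<open>rhot P s * mat_expect d \<mu> \<rho>\<close> is
  constant in \<open>s\<close>.\<close>

lemma drho_haar_mean:
  assumes h: "haar_SU N \<mu>" and P: "anticomm N P Q"
  shows "drho P * mat_expect d \<mu> \<rho> = 0\<^sub>m d d"
proof -
  let ?T = "mat_expect d \<mu> \<rho>"
  have "mat_deriv d (\<lambda>s. rhot P s * ?T) (drho P * ?T) 0"
    using rhot_carrier[OF P] by (intro mat_deriv_mult_const rhot_deriv0[OF P]) auto
  moreover have "(\<lambda>s. rhot P s * ?T) = (\<lambda>s. ?T)"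
    using rho_haar_mean[OF h rot_SU[OF P]] by (simp add: rhot_def)
  ultimately have "mat_deriv d (\<lambda>s. ?T) (drho P * ?T) 0" by simp
  then show ?thesis using mat_deriv_const by (rule mat_deriv_unique) auto
qed

end

section \<open>The Casimir operator commutes with Pauli rotations\<close>

locale pauli_rep = su_rep N d \<rho> for N d \<rho> +
  fixes n :: nat
  assumes N_eq: "N = 2^n" and n_pos: "n \<ge> 1"
begin

lemma partner: "P \<in> Paulis n \<Longrightarrow> \<exists>Q\<in>Paulis n. anticomm N P Q"
  using Paulis_partner N_eq by blast

text \<open>Up to scale the quadratic Casimir element of su(N), since the Pauli operators form an
  orthogonal basis with vectors of equal length.\<close>

definition casimir :: "complex mat" where
  "casimir = mat d d (\<lambda>(i,j). - (\<Sum>P\<in>Paulis n. (drho P * drho P) $$ (i,j)))"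

lemma casimir_carrier [simp]: "casimir \<in> carrier_mat d d"
  by (simp add: casimir_def)

lemma casimir_form:
  assumes v: "v \<in> carrier_vec d" and w: "w \<in> carrier_vec d"
  shows "ip (casimir *\<^sub>v v) w = (\<Sum>P\<in>Paulis n. ip (drho P *\<^sub>v v) (drho P *\<^sub>v w))"
proof -
  have cv: "(casimir *\<^sub>v v) $ i = - (\<Sum>P\<in>Paulis n. (drho P *\<^sub>v (drho P *\<^sub>v v)) $ i)" if i: "i < d" for i
  proof -
    have "(casimir *\<^sub>v v) $ i = (\<Sum>k<d. - (\<Sum>P\<in>Paulis n. (drho P * drho P) $$ (i,k)) * v $ k)"
      using i by (subst mult_vec_index[OF casimir_carrier v]) (auto simp: casimir_def)
    also have "\<dots> = - (\<Sum>k<d. \<Sum>P\<in>Paulis n. (drho P * drho P) $$ (i,k) * v $ k)"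
      by (simp add: sum_distrib_right sum_negf)
    also have "\<dots> = - (\<Sum>P\<in>Paulis n. \<Sum>k<d. (drho P * drho P) $$ (i,k) * v $ k)"
      by (subst sum.swap) simp
    also have "\<dots> = - (\<Sum>P\<in>Paulis n. (drho P *\<^sub>v (drho P *\<^sub>v v)) $ i)"
      using i v assoc_mult_mat_vec[OF drho_carrier drho_carrier v]
      by (simp add: mult_vec_index[of "drho P * drho P" d d v i for P, symmetric] del: index_mult_mat(1) index_mult_mat_vec)
    finally show ?thesis .
  qed
  have "ip (casimir *\<^sub>v v) w = - (\<Sum>i<d. \<Sum>P\<in>Paulis n. (drho P *\<^sub>v (drho P *\<^sub>v v)) $ i * cnj (w $ i))"
    unfolding ip_def using w by (simp add: cv sum_negf sum_distrib_right del: index_mult_mat_vec)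
  also have "\<dots> = - (\<Sum>P\<in>Paulis n. ip (drho P *\<^sub>v (drho P *\<^sub>v v)) w)"
    using w by (subst sum.swap) (simp add: ip_def)
  also have "\<dots> = (\<Sum>P\<in>Paulis n. ip (drho P *\<^sub>v v) (drho P *\<^sub>v w))"
    unfolding sum_negf[symmetric]
  proof (intro sum.cong refl)
    fix P assume "P \<in> Paulis n"
    then obtain Q where "anticomm N P Q" using partner by blast
    then show "- ip (drho P *\<^sub>v (drho P *\<^sub>v v)) w = ip (drho P *\<^sub>v v) (drho P *\<^sub>v w)"
      using drho_ip[of P Q "drho P *\<^sub>v v" w] v w by simp
  qed
  finally show ?thesis .
qed

lemma sum_third:
  assumes Q: "Q \<in> Paulis n"
  shows "(\<Sum>P\<in>{P \<in> Paulis n. anticomm N P Q}. f (pauli_third n Q P)) = (\<Sum>P\<in>{P \<in> Paulis n. anticomm N P Q}. f P)"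
  by (rule sum.reindex_bij_witness[of _ "pauli_third n Q" "pauli_third n Q"])
    (use pauli_third Q pauli_third_involution N_eq in auto)

text \<open>Up to a common sign, the map \<open>P \<mapsto> \<i> Q P\<close> is a quarter turn on
  the pair of \<open>P\<close> and its third string. The opposite signs in the two equations are
  what makes the cross terms in \<open>casimir_rhot\<close> cancel.\<close>

lemma drho_third:
  assumes "P \<in> Paulis n" "Q \<in> Paulis n" "anticomm N P Q"
  defines "S \<equiv> pauli_third n Q P"
  shows "drho (\<i> \<cdot>\<^sub>m (Q * P)) = drho S \<and> drho (\<i> \<cdot>\<^sub>m (Q * S)) = - drho P
    \<or> drho (\<i> \<cdot>\<^sub>m (Q * P)) = - drho S \<and> drho (\<i> \<cdot>\<^sub>m (Q * S)) = drho P"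
proof -
  define R where "R = \<i> \<cdot>\<^sub>m (Q * P)"
  have a: "anticomm (2^n) P Q" using assms(3) N_eq by simp
  note S = pauli_third[OF assms(1,2) a, folded S_def R_def]
  have aS: "anticomm N S Q" using S(3) N_eq by simp
  note t = quat_table[OF assms(3) R_def]
  have QR: "\<i> \<cdot>\<^sub>m (Q * R) = - P" unfolding t by (simp add: smult_smult_mat neg_smult_mat)
  from S(2) show ?thesis
  proof
    assume "R = S"
    then show ?thesis using QR drho_uminus[OF assms(3)] by (simp add: R_def)
  next
    assume RS: "R = - S"
    then have "S = - R" by (auto intro!: eq_matI)
    then have "\<i> \<cdot>\<^sub>m (Q * S) = \<i> \<cdot>\<^sub>m (- (Q * R))"
      using anticommD(2)[OF assms(3)] t(1) by simp
    also have "\<dots> = P" unfolding t by (simp add: neg_smult_mat smult_smult_mat)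
    finally show ?thesis using RS drho_uminus[OF aS] unfolding R_def[symmetric] by simp
  qed
qed

text \<open>Conjugation by a rotation about \<open>Q\<close> fixes \<open>drho P\<close> if
  \<open>P\<close> commutes with \<open>Q\<close>, and otherwise turns \<open>drho P\<close> and the
  derivative of the third string within their plane. Such a turn preserves the sum of the squares
  over each pair.\<close>

lemma casimir_rhot:
  assumes Q: "Q \<in> Paulis n"
  shows "rhot Q \<phi> * casimir = casimir * rhot Q \<phi>"
proof -
  obtain Q' where Q': "anticomm N Q Q'" using partner[OF Q] by blast
  define U where "U = rhot Q \<phi>"
  define U' where "U' = rhot Q (- \<phi>)"
  have Uc: "U \<in> carrier_mat d d" "U' \<in> carrier_mat d d" using rhot_carrier[OF Q'] by (auto simp: U_def U'_def)
  have uU': "unitary_mat d U'" unfolding U'_def by (rule rhot_unitary[OF Q'])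
  have adj: "madj U = U'" unfolding U_def U'_def by (rule rhot_madj[OF Q'])
  have UU': "U * U' = 1\<^sub>m d" unfolding U_def U'_def by (rule rhot_inverse(1)[OF Q'])
  let ?A = "{P \<in> Paulis n. anticomm N P Q}"
  have key: "(\<Sum>P\<in>Paulis n. ip (drho P *\<^sub>v (U *\<^sub>v v)) (drho P *\<^sub>v (U *\<^sub>v w))) = (\<Sum>P\<in>Paulis n. ip (drho P *\<^sub>v v) (drho P *\<^sub>v w))"
    if v: "v \<in> carrier_vec d" and w: "w \<in> carrier_vec d" for v w
  proof -
    define c s where "c = complex_of_real (cos \<phi>)" "s = complex_of_real (sin \<phi>)"
    have cs: "c * c + s * s = 1" "cnj c = c" "cnj s = s"
      by (auto simp: c_s_def) (metis of_real_1 of_real_add of_real_mult sin_cos_squared_add3)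
    define r where "r P = drho (\<i> \<cdot>\<^sub>m (Q * P))" for P
    define a where "a P = ip (drho P *\<^sub>v v) (drho P *\<^sub>v w)" for P
    \<comment> \<open>The cross term of the turned generator
      \<open>c \<cdot>\<^sub>m drho P + (- s) \<cdot>\<^sub>m r P\<close>.\<close>
    define h where "h P = ip (drho P *\<^sub>v v) (r P *\<^sub>v w) + ip (r P *\<^sub>v v) (drho P *\<^sub>v w)" for P
    have rc: "r P \<in> carrier_mat d d" for P by (simp add: r_def)
    have conj: "ip (drho P *\<^sub>v (U *\<^sub>v v)) (drho P *\<^sub>v (U *\<^sub>v w)) = ip ((U' * drho P * U) *\<^sub>v v) ((U' * drho P * U) *\<^sub>v w)" for P
    proof -
      have "(U' * drho P * U) *\<^sub>v x = U' *\<^sub>v (drho P *\<^sub>v (U *\<^sub>v x))" if "x \<in> carrier_vec d" for x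
        using Uc that by (simp add: assoc_mult_mat_vec[of _ d d _ d])
      then show ?thesis using unitary_ip[OF uU'] v w Uc by simp
    qed
    have anti: "ip (drho P *\<^sub>v (U *\<^sub>v v)) (drho P *\<^sub>v (U *\<^sub>v w)) = c * c * a P + s * s * a (pauli_third n Q P) - c * s * h P"
      if P: "P \<in> ?A" for P
    proof -
      have aP: "anticomm N P Q" "P \<in> Paulis n" using P by auto
      have M: "U' * drho P * U = c \<cdot>\<^sub>m drho P + (- s) \<cdot>\<^sub>m r P"
        using drho_conj[OF aP(1), of "- \<phi>"] by (simp add: U_def U'_def c_s_def r_def)
      have Mv: "(U' * drho P * U) *\<^sub>v x = c \<cdot>\<^sub>v (drho P *\<^sub>v x) + (- s) \<cdot>\<^sub>v (r P *\<^sub>v x)" if x: "x \<in> carrier_vec d" for x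
      proof -
        have sm: "(z \<cdot>\<^sub>m A) *\<^sub>v x = z \<cdot>\<^sub>v (A *\<^sub>v x)" if "A \<in> carrier_mat d d" for z and A :: "complex mat"
          using that x by (intro eq_vecI) (auto simp: scalar_prod_def sum_distrib_left ac_simps)
        have "(c \<cdot>\<^sub>m drho P + (- s) \<cdot>\<^sub>m r P) *\<^sub>v x = (c \<cdot>\<^sub>m drho P) *\<^sub>v x + ((- s) \<cdot>\<^sub>m r P) *\<^sub>v x"
          using x rc by (intro add_mult_distrib_mat_vec[of _ d d]) auto
        then show ?thesis unfolding M by (simp only: sm[OF drho_carrier] sm[OF rc])
      qed
      have rr: "ip (r P *\<^sub>v v) (r P *\<^sub>v w) = a (pauli_third n Q P)"
        using drho_third[OF aP(2) Q aP(1)] v w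
        by (auto simp: r_def a_def uminus_mult_vec[of _ d] ip_smult_left[of _ d] ip_smult_right[of _ d])
      have vs: "drho P *\<^sub>v v \<in> carrier_vec d" "r P *\<^sub>v v \<in> carrier_vec d" "drho P *\<^sub>v w \<in> carrier_vec d" "r P *\<^sub>v w \<in> carrier_vec d"
        using v w rc by auto
      have "ip (c \<cdot>\<^sub>v (drho P *\<^sub>v v) + (- s) \<cdot>\<^sub>v (r P *\<^sub>v v)) (c \<cdot>\<^sub>v (drho P *\<^sub>v w) + (- s) \<cdot>\<^sub>v (r P *\<^sub>v w))
          = c * c * ip (drho P *\<^sub>v v) (drho P *\<^sub>v w) + s * s * ip (r P *\<^sub>v v) (r P *\<^sub>v w) - c * s * h P"
        using vs cs(2,3)
        by (simp add: ip_add_left[of _ d] ip_add_right[of _ d] ip_smult_left[of _ d] ip_smult_right[of _ d] h_def)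
          (simp add: algebra_simps)
      then show ?thesis unfolding conj Mv[OF v] Mv[OF w] rr a_def .
    qed
    have comm: "ip (drho P *\<^sub>v (U *\<^sub>v v)) (drho P *\<^sub>v (U *\<^sub>v w)) = a P" if P: "P \<in> Paulis n - ?A" for P
    proof -
      obtain P' where P': "anticomm N P P'" using partner P by blast
      have "Q * P = P * Q"
        using pauli_all_commute[OF PaulisD(1) PaulisD(1), of P n Q] P Q N_eq by auto
      then have cm: "U' * drho P = drho P * U'"
        unfolding U'_def by (rule drho_commute[OF P' Q'])
      have "U' * drho P * U = drho P * (U' * U)"
        unfolding cm using Uc by (simp add: assoc_mult_mat[of _ d d _ d _ d])
      also have "U' * U = 1\<^sub>m d" unfolding U_def U'_def by (rule rhot_inverse(2)[OF Q'])
      finally have "U' * drho P * U = drho P" by (simp add: right_mult_one_mat[of _ d d])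
      then show ?thesis by (simp add: conj a_def)
    qed
    have h_anti: "h (pauli_third n Q P) = - h P" if P: "P \<in> ?A" for P
    proof -
      have aP: "anticomm N P Q" "P \<in> Paulis n" using P by auto
      let ?S = "pauli_third n Q P"
      have "r P = drho ?S \<and> r ?S = - drho P \<or> r P = - drho ?S \<and> r ?S = drho P"
        using drho_third[OF aP(2) Q aP(1)] by (simp add: r_def)
      then show ?thesis
        using v w by (auto simp: h_def uminus_mult_vec[of _ d] ip_smult_left[of _ d] ip_smult_right[of _ d])
    qed
    have fin: "finite ?A" using finite_Paulis by simp
    \<comment> \<open>The cross terms are odd under the involution \<open>pauli_third n Q\<close>,
      so their sum equals its own negative.\<close>
    have "(\<Sum>P\<in>?A. h P) = (\<Sum>P\<in>?A. h (pauli_third n Q P))" using sum_third[OF Q, of h] by simp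
    also have "\<dots> = - (\<Sum>P\<in>?A. h P)" by (simp add: h_anti sum_negf)
    finally have h0: "(\<Sum>P\<in>?A. h P) = 0" by simp
    have "(\<Sum>P\<in>Paulis n. ip (drho P *\<^sub>v (U *\<^sub>v v)) (drho P *\<^sub>v (U *\<^sub>v w)))
        = (\<Sum>P\<in>Paulis n - ?A. a P) + (\<Sum>P\<in>?A. c * c * a P + s * s * a (pauli_third n Q P) - c * s * h P)"
      using comm anti by (subst sum.subset_diff[of ?A]) (auto simp: finite_Paulis)
    also have "(\<Sum>P\<in>?A. c * c * a P + s * s * a (pauli_third n Q P) - c * s * h P)
        = c * c * (\<Sum>P\<in>?A. a P) + s * s * (\<Sum>P\<in>?A. a (pauli_third n Q P)) - c * s * (\<Sum>P\<in>?A. h P)"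
      by (simp add: sum.distrib sum_subtractf sum_distrib_left)
    also have "\<dots> = (c * c + s * s) * (\<Sum>P\<in>?A. a P)"
      unfolding h0 sum_third[OF Q] by (simp add: algebra_simps)
    also have "(\<Sum>P\<in>Paulis n - ?A. a P) + (c * c + s * s) * (\<Sum>P\<in>?A. a P) = (\<Sum>P\<in>Paulis n. a P)"
      unfolding cs(1) using sum.subset_diff[of ?A "Paulis n" a] by (simp add: finite_Paulis)
    finally show ?thesis by (simp add: a_def)
  qed
  have "U * casimir = casimir * U"
  proof (rule mat_eqI_vec[of _ d])
    fix v :: "complex vec" assume v: "v \<in> carrier_vec d"
    have "U *\<^sub>v (casimir *\<^sub>v v) = casimir *\<^sub>v (U *\<^sub>v v)"
    proof (rule vec_eqI_ip)
      fix w :: "complex vec" assume w: "w \<in> carrier_vec d"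
      have "U *\<^sub>v (U' *\<^sub>v w) = w"
        using assoc_mult_mat_vec[OF Uc w] UU' w by simp
      then have "ip (casimir *\<^sub>v (U *\<^sub>v v)) w = ip (casimir *\<^sub>v (U *\<^sub>v v)) (U *\<^sub>v (U' *\<^sub>v w))" by simp
      also have "\<dots> = ip (casimir *\<^sub>v v) (U' *\<^sub>v w)"
        using v w Uc key[of v "U' *\<^sub>v w"] by (simp add: casimir_form)
      also have "\<dots> = ip (U *\<^sub>v (casimir *\<^sub>v v)) w"
        using ip_madj[OF Uc(1) _ w, of "casimir *\<^sub>v v"] v adj by simp
      finally show "ip (U *\<^sub>v (casimir *\<^sub>v v)) w = ip (casimir *\<^sub>v (U *\<^sub>v v)) w" by simp
    qed (use Uc v in auto)
    then show "(U * casimir) *\<^sub>v v = (casimir * U) *\<^sub>v v"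
      using Uc v by (simp add: assoc_mult_mat_vec[of _ d d _ d])
  qed (use Uc in auto)
  then show ?thesis by (simp add: U_def)
qed

lemma casimir_drho:
  assumes Q: "Q \<in> Paulis n"
  shows "drho Q * casimir = casimir * drho Q"
proof -
  obtain Q' where Q': "anticomm N Q Q'" using partner[OF Q] by blast
  note c = rhot_carrier[OF Q']
  have "mat_deriv d (\<lambda>s. rhot Q s * casimir) (drho Q * casimir) 0"
    using c by (intro mat_deriv_mult_const rhot_deriv0[OF Q']) auto
  moreover have "mat_deriv d (\<lambda>s. casimir * rhot Q s) (casimir * drho Q) 0"
    using c by (intro mat_deriv_const_mult rhot_deriv0[OF Q']) auto
  ultimately show ?thesis
    unfolding casimir_rhot[OF Q] by (rule mat_deriv_unique) auto
qed

end

section \<open>The spectral gap of averaged Pauli rotations\<close>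

context pauli_rep
begin

section \<open>Averages over a full period\<close>

definition rot_mean :: "real \<Rightarrow> complex mat \<Rightarrow> complex mat" where
  "rot_mean L P = mat d d (\<lambda>(i,j). (1 / complex_of_real (2 * L)) * integral {-L..L} (\<lambda>\<theta>. rhot P \<theta> $$ (i,j)))"

lemma rot_mean_carrier [simp]: "rot_mean L P \<in> carrier_mat d d"
  by (simp add: rot_mean_def)

context
  fixes P Q :: "complex mat" and L :: real
  assumes PQ: "anticomm N P Q" and L: "L > 0" and per: "rhot P L = rhot P (- L)"
begin

lemma rhot_integrable: "i < d \<Longrightarrow> j < d \<Longrightarrow> (\<lambda>\<theta>. rhot P \<theta> $$ (i,j)) integrable_on {-L..L}"
  by (intro integrable_continuous_real continuous_on_subset[OF rhot_cont[OF PQ]]) auto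

lemma rot_mean_mult_left:
  assumes A: "A \<in> carrier_mat d d" and ij: "i < d" "j < d"
  shows "(A * rot_mean L P) $$ (i,j) = (1 / complex_of_real (2 * L)) * integral {-L..L} (\<lambda>\<theta>. (A * rhot P \<theta>) $$ (i,j))"
proof -
  have "integral {-L..L} (\<lambda>\<theta>. (A * rhot P \<theta>) $$ (i,j)) = integral {-L..L} (\<lambda>\<theta>. \<Sum>k<d. A $$ (i,k) * rhot P \<theta> $$ (k,j))"
    by (simp only: mult_index[OF A rhot_carrier[OF PQ] ij])
  also have "\<dots> = (\<Sum>k<d. A $$ (i,k) * integral {-L..L} (\<lambda>\<theta>. rhot P \<theta> $$ (k,j)))"
    using ij rhot_integrable by (subst Henstock_Kurzweil_Integration.integral_sum) (auto intro!: integrable_on_mult_right)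
  finally show ?thesis
    unfolding mult_index[OF A rot_mean_carrier ij]
    using ij by (simp add: rot_mean_def sum_distrib_left ac_simps)
qed

lemma rot_mean_mult_right:
  assumes A: "A \<in> carrier_mat d d" and ij: "i < d" "j < d"
  shows "(rot_mean L P * A) $$ (i,j) = (1 / complex_of_real (2 * L)) * integral {-L..L} (\<lambda>\<theta>. (rhot P \<theta> * A) $$ (i,j))"
proof -
  have "integral {-L..L} (\<lambda>\<theta>. (rhot P \<theta> * A) $$ (i,j)) = integral {-L..L} (\<lambda>\<theta>. \<Sum>k<d. rhot P \<theta> $$ (i,k) * A $$ (k,j))"
    by (simp only: mult_index[OF rhot_carrier[OF PQ] A ij])
  also have "\<dots> = (\<Sum>k<d. integral {-L..L} (\<lambda>\<theta>. rhot P \<theta> $$ (i,k)) * A $$ (k,j))"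
    using ij rhot_integrable by (subst Henstock_Kurzweil_Integration.integral_sum) (auto intro!: integrable_on_mult_left)
  finally show ?thesis
    unfolding mult_index[OF rot_mean_carrier A ij]
    using ij by (simp add: rot_mean_def sum_distrib_left ac_simps)
qed

lemma rot_mean_commute:
  assumes A: "A \<in> carrier_mat d d" and comm: "\<And>\<theta>. rhot P \<theta> * A = A * rhot P \<theta>"
  shows "rot_mean L P * A = A * rot_mean L P"
  by (rule eq_matI)
    (use A carrier_matD[OF rot_mean_carrier] in \<open>auto simp: rot_mean_mult_left[OF A] rot_mean_mult_right[OF A] comm simp del: index_mult_mat(1)\<close>)

text \<open>The integrand is the derivative of \<open>rhot P\<close>, so the integral is the
  difference of the two end values. This is where the interval has to be a full period.\<close>

lemma drho_rot_mean: "drho P * rot_mean L P = 0\<^sub>m d d"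
proof (rule eq_matI)
  fix i j assume "i < dim_row (0\<^sub>m d d)" "j < dim_col (0\<^sub>m d d)"
  then have ij: "i < d" "j < d" by auto
  have "((\<lambda>\<theta>. (drho P * rhot P \<theta>) $$ (i,j)) has_integral (rhot P L $$ (i,j) - rhot P (- L) $$ (i,j))) {-L..L}"
    using L by (intro fundamental_theorem_of_calculus has_vector_derivative_at_within[OF mat_derivD[OF rhot_deriv(2)[OF PQ] ij]]) auto
  then have "integral {-L..L} (\<lambda>\<theta>. (drho P * rhot P \<theta>) $$ (i,j)) = 0"
    by (simp add: per integral_unique del: index_mult_mat(1))
  then show "(drho P * rot_mean L P) $$ (i,j) = 0\<^sub>m d d $$ (i,j)"
    using ij unfolding rot_mean_mult_left[OF drho_carrier ij] by simp
qed (use carrier_matD[OF rot_mean_carrier] carrier_matD[OF drho_carrier] in auto)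

lemma rot_mean_fix:
  assumes v: "v \<in> carrier_vec d" and k: "drho P *\<^sub>v v = 0\<^sub>v d"
  shows "rot_mean L P *\<^sub>v v = v"
proof (rule eq_vecI)
  fix i assume "i < dim_vec v"
  then have i: "i < d" using v by simp
  have fixv: "rhot P \<theta> *\<^sub>v v = v" for \<theta>
    using rhot_carrier[OF PQ] rhot_deriv(1)[OF PQ] rhot_zero[OF PQ] drho_carrier v k
    by (rule one_param_group_fixes)
  have row: "(\<Sum>k<d. rhot P \<theta> $$ (i,k) * v $ k) = v $ i" for \<theta>
    using mult_vec_index[OF rhot_carrier[OF PQ] v i, of \<theta>] fixv[of \<theta>] by simp
  have "(rot_mean L P *\<^sub>v v) $ i = (\<Sum>k<d. (1 / complex_of_real (2 * L)) * integral {-L..L} (\<lambda>\<theta>. rhot P \<theta> $$ (i,k)) * v $ k)"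
    using i by (subst mult_vec_index[OF rot_mean_carrier v]) (auto simp: rot_mean_def)
  also have "\<dots> = (1 / complex_of_real (2 * L)) * (\<Sum>k<d. integral {-L..L} (\<lambda>\<theta>. rhot P \<theta> $$ (i,k) * v $ k))"
    by (simp add: sum_distrib_left ac_simps)
  also have "(\<Sum>k<d. integral {-L..L} (\<lambda>\<theta>. rhot P \<theta> $$ (i,k) * v $ k)) = integral {-L..L} (\<lambda>\<theta>. \<Sum>k<d. rhot P \<theta> $$ (i,k) * v $ k)"
    using i rhot_integrable by (subst Henstock_Kurzweil_Integration.integral_sum) (auto intro!: integrable_on_mult_left)
  also have "\<dots> = of_real (2 * L) * v $ i"
    unfolding row using L by (simp add: scaleR_conv_of_real)
  finally show "(rot_mean L P *\<^sub>v v) $ i = v $ i" using L by simp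
qed (use v carrier_matD[OF rot_mean_carrier] in auto)

text \<open>The mean maps into the kernel of \<open>drho P\<close> and fixes this kernel.\<close>

lemma rot_mean_idem: "rot_mean L P * rot_mean L P = rot_mean L P"
proof (rule mat_eqI_vec[of _ d])
  fix v :: "complex vec" assume v: "v \<in> carrier_vec d"
  have "drho P *\<^sub>v (rot_mean L P *\<^sub>v v) = (drho P * rot_mean L P) *\<^sub>v v"
    using v by (simp add: assoc_mult_mat_vec[of _ d d _ d])
  also have "\<dots> = 0\<^sub>v d" using v by (auto simp: drho_rot_mean)
  finally show "(rot_mean L P * rot_mean L P) *\<^sub>v v = rot_mean L P *\<^sub>v v"
    using v rot_mean_fix[of "rot_mean L P *\<^sub>v v"] by (simp add: assoc_mult_mat_vec[of _ d d _ d])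
qed auto

lemma rot_mean_madj: "madj (rot_mean L P) = rot_mean L P"
proof (rule eq_matI)
  fix i j assume "i < dim_row (rot_mean L P)" "j < dim_col (rot_mean L P)"
  then have ij: "i < d" "j < d" by (auto simp: rot_mean_def)
  have "cnj (integral {-L..L} (\<lambda>\<theta>. rhot P \<theta> $$ (j,i))) = integral {-L..L} (\<lambda>\<theta>. cnj (rhot P \<theta> $$ (j,i)))"
    by (simp add: Henstock_Kurzweil_Integration.integral_cnj)
  also have "\<dots> = integral {-L..L} (\<lambda>\<theta>. rhot P (- \<theta>) $$ (i,j))"
    using ij carrier_matD[OF rhot_carrier[OF PQ]] by (simp add: rhot_madj[OF PQ, symmetric])
  also have "\<dots> = integral {-L..L} (\<lambda>\<theta>. rhot P \<theta> $$ (i,j))"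
    using Henstock_Kurzweil_Integration.integral_reflect_real[of L "-L" "\<lambda>\<theta>. rhot P \<theta> $$ (i,j)"] by simp
  finally show "madj (rot_mean L P) $$ (i,j) = rot_mean L P $$ (i,j)"
    using ij carrier_matD[OF rot_mean_carrier] by (simp add: rot_mean_def)
qed (auto simp: rot_mean_def)

end

text \<open>The common part of both bounds, obtained from \<open>averaged_projections_bound\<close>
  with the Casimir operator. They differ in the representation, the half period \<open>L\<close> and
  the gap \<open>g\<close>.\<close>

lemma pauli_average_bound:
  assumes h: "haar_SU N \<mu>" and L: "L > 0"
    and per: "\<And>P. P \<in> Paulis n \<Longrightarrow> rhot P L = rhot P (- L)"
    and gap: "\<And>P v. P \<in> Paulis n \<Longrightarrow> v \<in> carrier_vec d \<Longrightarrow>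
        g * (vnorm (drho P *\<^sub>v v))\<^sup>2 \<le> (\<Sum>Q\<in>Paulis n. (vnorm (drho Q *\<^sub>v v))\<^sup>2)"
    and g: "g \<le> card (Paulis n)"
  shows "op_norm (theta_pauli_expect d (- L) L (Paulis n) (\<lambda>\<theta> P. rhot P \<theta>) - mat_expect d \<mu> \<rho>)
    \<le> 1 - g / card (Paulis n)"
proof -
  let ?T = "mat_expect d \<mu> \<rho>"
  let ?S = "theta_pauli_expect d (- L) L (Paulis n) (\<lambda>\<theta> P. rhot P \<theta>)"
  let ?M = "?S - ?T"
  have ne: "Paulis n \<noteq> {}" using Paulis_nonempty n_pos by blast
  have Sc: "?S \<in> carrier_mat d d" by (simp add: theta_pauli_expect_def)
  have Mc: "?M \<in> carrier_mat d d" by (rule minus_carrier_mat) simp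
  have S_entry: "?S $$ (i,j) = (\<Sum>P\<in>Paulis n. rot_mean L P $$ (i,j)) / of_nat (card (Paulis n))"
    if ij: "i < d" "j < d" for i j
  proof -
    have int: "(\<lambda>\<theta>. rhot P \<theta> $$ (i,j)) integrable_on {-L..L}" if P: "P \<in> Paulis n" for P
    proof -
      obtain Q where "anticomm N P Q" using partner[OF P] by blast
      from rhot_integrable[OF this L per[OF P] ij] show ?thesis .
    qed
    have "integral {-L..L} (\<lambda>\<theta>. (1 / of_nat (card (Paulis n))) * (\<Sum>P\<in>Paulis n. rhot P \<theta> $$ (i,j)))
        = (1 / of_nat (card (Paulis n))) * (\<Sum>P\<in>Paulis n. integral {-L..L} (\<lambda>\<theta>. rhot P \<theta> $$ (i,j)))"
      using int finite_Paulis by (simp add: Henstock_Kurzweil_Integration.integral_sum)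
    then show ?thesis
      using ij by (simp add: theta_pauli_expect_def rot_mean_def sum_distrib_left sum_divide_distrib ac_simps)
  qed
  have form: "ip (?M *\<^sub>v v) w = (\<Sum>P\<in>Paulis n. ip (rot_mean L P *\<^sub>v v) w) / of_nat (card (Paulis n)) - ip (?T *\<^sub>v v) w"
    if v: "v \<in> carrier_vec d" and w: "w \<in> carrier_vec d" for v w
  proof -
    have "(?S *\<^sub>v v) $ i = (\<Sum>P\<in>Paulis n. (rot_mean L P *\<^sub>v v) $ i) / of_nat (card (Paulis n))" if i: "i < d" for i
    proof -
      have "(?S *\<^sub>v v) $ i = (\<Sum>k<d. (\<Sum>P\<in>Paulis n. rot_mean L P $$ (i,k)) / of_nat (card (Paulis n)) * v $ k)"
        unfolding mult_vec_index[OF Sc v i] using i by (intro sum.cong refl) (simp add: S_entry)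
      also have "\<dots> = (\<Sum>k<d. \<Sum>P\<in>Paulis n. rot_mean L P $$ (i,k) * v $ k) / of_nat (card (Paulis n))"
        by (simp add: sum_distrib_right sum_divide_distrib)
      also have "(\<Sum>k<d. \<Sum>P\<in>Paulis n. rot_mean L P $$ (i,k) * v $ k) = (\<Sum>P\<in>Paulis n. (rot_mean L P *\<^sub>v v) $ i)"
        by (subst sum.swap) (simp only: mult_vec_index[OF rot_mean_carrier v i])
      finally show ?thesis .
    qed
    then have "ip (?S *\<^sub>v v) w = (\<Sum>i<d. (\<Sum>P\<in>Paulis n. (rot_mean L P *\<^sub>v v) $ i) / of_nat (card (Paulis n)) * cnj (w $ i))"
      unfolding ip_def using w by (intro sum.cong) auto
    also have "\<dots> = (\<Sum>i<d. \<Sum>P\<in>Paulis n. (rot_mean L P *\<^sub>v v) $ i * cnj (w $ i)) / of_nat (card (Paulis n))"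
      by (simp add: sum_distrib_right sum_divide_distrib)
    also have "(\<Sum>i<d. \<Sum>P\<in>Paulis n. (rot_mean L P *\<^sub>v v) $ i * cnj (w $ i)) = (\<Sum>P\<in>Paulis n. ip (rot_mean L P *\<^sub>v v) w)"
      using w by (subst sum.swap) (simp add: ip_def)
    finally have "ip (?S *\<^sub>v v) w = (\<Sum>P\<in>Paulis n. ip (rot_mean L P *\<^sub>v v) w) / of_nat (card (Paulis n))" .
    moreover have "?M *\<^sub>v v = ?S *\<^sub>v v - ?T *\<^sub>v v"
      using Sc v by (intro minus_mult_distrib_mat_vec) auto
    ultimately show ?thesis using Sc v w by (simp add: ip_diff_left[of _ d])
  qed
  have bound: "vnorm (?M *\<^sub>v v) \<le> (1 - g / card (Paulis n)) * vnorm v" if v: "v \<in> carrier_vec d" for v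
  proof (rule averaged_projections_bound[where X = drho and Pi = "rot_mean L" and C = casimir and T = ?T and d = d])
    fix P assume P: "P \<in> Paulis n"
    obtain Q where Q: "anticomm N P Q" using partner[OF P] by blast
    note ctx = Q L per[OF P]
    show "rot_mean L P * casimir = casimir * rot_mean L P"
      by (rule rot_mean_commute[OF ctx casimir_carrier casimir_rhot[OF P]])
    show "madj (rot_mean L P) = rot_mean L P" by (rule rot_mean_madj[OF ctx])
    show "rot_mean L P * rot_mean L P = rot_mean L P" by (rule rot_mean_idem[OF ctx])
    show "drho P * rot_mean L P = 0\<^sub>m d d" by (rule drho_rot_mean[OF ctx])
    show "drho P * ?T = 0\<^sub>m d d" by (rule drho_haar_mean[OF h Q])
    fix v :: "complex vec" assume v: "v \<in> carrier_vec d"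
    show "drho P *\<^sub>v v = 0\<^sub>v d \<Longrightarrow> rot_mean L P *\<^sub>v v = v" by (rule rot_mean_fix[OF ctx v])
    show "g * (vnorm (drho P *\<^sub>v v))\<^sup>2 \<le> Re (ip (casimir *\<^sub>v v) v)"
      using gap[OF P v] by (simp add: casimir_form[OF v v] ip_self)
  next
    fix v :: "complex vec" assume v: "v \<in> carrier_vec d" and "\<And>P. P \<in> Paulis n \<Longrightarrow> drho P *\<^sub>v v = 0\<^sub>v d"
    then show "madj ?T *\<^sub>v v = v"
      using SU_in_fixer[OF N_eq v] by (intro haar_mean_fix[OF h v]) (auto simp: fixer_def)
  qed (use Mc v form casimir_form g ne finite_Paulis in auto)
  have "0 \<le> 1 - g / card (Paulis n)"
    using g ne finite_Paulis by (simp add: card_gt_0_iff divide_le_eq_1)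
  then show ?thesis using op_norm_le[OF Mc _ bound] by blast
qed

text \<open>An uncertainty relation. For a triple \<open>P\<close>, \<open>Q\<close>,
  \<open>R\<close>, the commutator of \<open>drho Q\<close> and \<open>drho R\<close> is
  \<open>drho P\<close> up to sign. Hence Cauchy-Schwarz bounds the expectation of
  \<open>drho P\<close> in \<open>v\<close> by the sum of the squared norms of
  \<open>drho Q *\<^sub>v v\<close> and \<open>drho R *\<^sub>v v\<close>.\<close>

lemma drho_su2_bound:
  assumes P: "P \<in> Paulis n" and v: "v \<in> carrier_vec d"
  shows "(vnorm (drho P *\<^sub>v v))\<^sup>2 + card {Q \<in> Paulis n. anticomm N P Q} / 2 * cmod (ip (drho P *\<^sub>v v) v)
    \<le> (\<Sum>Q\<in>Paulis n. (vnorm (drho Q *\<^sub>v v))\<^sup>2)"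
proof -
  let ?A = "{Q \<in> Paulis n. anticomm N Q P}"
  let ?f = "\<lambda>Q. (vnorm (drho Q *\<^sub>v v))\<^sup>2"
  have A_eq: "{Q \<in> Paulis n. anticomm N P Q} = ?A" using anticomm_sym by blast
  have pair: "cmod (ip (drho P *\<^sub>v v) v) \<le> ?f Q + ?f (pauli_third n P Q)" if Q: "Q \<in> ?A" for Q
  proof -
    have QP: "anticomm N Q P" "Q \<in> Paulis n" using Q by auto
    define R where "R = \<i> \<cdot>\<^sub>m (P * Q)"
    note t = quat_table[OF QP(1) R_def]
    have aQR: "anticomm N Q R" unfolding R_def by (rule anticomm_third(2)[OF QP(1)])
    have aRQ: "anticomm N R Q" by (rule anticomm_sym[OF aQR])
    have aPQ: "anticomm N P Q" by (rule anticomm_sym[OF QP(1)])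
    have "\<i> \<cdot>\<^sub>m (R * Q) = - P"
      unfolding t by (simp add: smult_smult_mat neg_smult_mat)
    then have com: "drho R * drho Q = drho Q * drho R + (- drho P)"
      using drho_commutator[OF aQR] drho_uminus[OF aPQ] by simp
    have vs: "drho P *\<^sub>v v \<in> carrier_vec d" "drho Q *\<^sub>v v \<in> carrier_vec d" "drho R *\<^sub>v v \<in> carrier_vec d" using v by auto
    have "drho R *\<^sub>v (drho Q *\<^sub>v v) = (drho R * drho Q) *\<^sub>v v"
      using v by (simp add: assoc_mult_mat_vec[of _ d d _ d])
    also have "\<dots> = (drho Q * drho R) *\<^sub>v v + (- drho P) *\<^sub>v v"
      unfolding com using v by (intro add_mult_distrib_mat_vec[of _ d d]) auto
    also have "\<dots> = drho Q *\<^sub>v (drho R *\<^sub>v v) + (-1) \<cdot>\<^sub>v (drho P *\<^sub>v v)"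
      using v by (simp add: assoc_mult_mat_vec[of _ d d _ d] uminus_mult_vec[of _ d])
    finally have "ip (drho R *\<^sub>v (drho Q *\<^sub>v v)) v = ip (drho Q *\<^sub>v (drho R *\<^sub>v v)) v - ip (drho P *\<^sub>v v) v"
      using v vs by (simp add: ip_add_left[of _ d] ip_smult_left[of _ d])
    then have "ip (drho P *\<^sub>v v) v = ip (drho Q *\<^sub>v v) (drho R *\<^sub>v v) - ip (drho R *\<^sub>v v) (drho Q *\<^sub>v v)"
      using drho_ip[OF aRQ vs(2) v] drho_ip[OF aQR vs(3) v] by (simp add: algebra_simps)
    then have "cmod (ip (drho P *\<^sub>v v) v) \<le> cmod (ip (drho Q *\<^sub>v v) (drho R *\<^sub>v v)) + cmod (ip (drho R *\<^sub>v v) (drho Q *\<^sub>v v))"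
      by (simp add: norm_triangle_ineq4)
    also have "\<dots> \<le> 2 * vnorm (drho Q *\<^sub>v v) * vnorm (drho R *\<^sub>v v)"
      using ip_cauchy_schwarz[OF vs(2,3)] ip_cauchy_schwarz[OF vs(3,2)]
      by (simp only: mult.commute[of "vnorm (drho R *\<^sub>v v)"] mult.assoc)
    also have "\<dots> \<le> ?f Q + ?f R" by (rule sum_squares_bound)
    also have "?f R = ?f (pauli_third n P Q)"
    proof -
      have "drho R *\<^sub>v v = drho (pauli_third n P Q) *\<^sub>v v \<or> drho R *\<^sub>v v = (-1) \<cdot>\<^sub>v (drho (pauli_third n P Q) *\<^sub>v v)"
        using drho_third[OF QP(2) P QP(1)] v by (auto simp: R_def uminus_mult_vec[of _ d])
      then show ?thesis by (auto simp: vnorm_smult)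
    qed
    finally show ?thesis .
  qed
  \<comment> \<open>Summing over all \<open>Q\<close> counts every anticommuting string twice, once
    as itself and once as a third string; this is the origin of the factor 1/2.\<close>
  have "card ?A * cmod (ip (drho P *\<^sub>v v) v) \<le> (\<Sum>Q\<in>?A. ?f Q + ?f (pauli_third n P Q))"
    using sum_mono[of ?A "\<lambda>_. cmod (ip (drho P *\<^sub>v v) v)", OF pair] by simp
  also have "\<dots> = 2 * (\<Sum>Q\<in>?A. ?f Q)"
    using sum_third[OF P, of ?f] by (simp add: sum.distrib)
  finally have 1: "card ?A / 2 * cmod (ip (drho P *\<^sub>v v) v) \<le> (\<Sum>Q\<in>?A. ?f Q)" by simp
  have "P \<notin> ?A"
  proof
    assume "P \<in> ?A"
    then have "anticomm N P P" by simp
    then have "1\<^sub>m N = - (1\<^sub>m N :: complex mat)" by (auto simp: anticomm_def)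
    from arg_cong[OF this, of "\<lambda>M. M $$ (0,0)"] show False using N_eq by simp
  qed
  then have "?f P + (\<Sum>Q\<in>?A. ?f Q) = (\<Sum>Q\<in>insert P ?A. ?f Q)"
    using finite_Paulis[of n] by simp
  also have "\<dots> \<le> (\<Sum>Q\<in>Paulis n. ?f Q)"
    using P by (intro sum_mono2 finite_Paulis) auto
  finally show ?thesis using 1 by (simp add: A_eq)
qed

text \<open>With \<open>a\<close> anticommuting strings and \<open>drho P\<close> having eigenvalue
  \<open>\<i> * k\<close>, \<open>drho_su2_bound\<close> gives
  \<open>k^2 + a * \<bar>k\<bar> / 2\<close>, and \<open>\<bar>k\<bar> \<le> t\<close> turns the
  linear term into at least \<open>a * k^2 / (2 * t)\<close>. Arbitrary vectors are split along the
  eigenspaces of \<open>drho P\<close>.\<close>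

lemma drho_gap:
  assumes P: "P \<in> Paulis n" and t: "t > 0" and v: "v \<in> carrier_vec d"
    and spec: "\<And>w k. w \<in> carrier_vec d \<Longrightarrow> w \<noteq> 0\<^sub>v d \<Longrightarrow> drho P *\<^sub>v w = (\<i> * complex_of_real k) \<cdot>\<^sub>v w \<Longrightarrow> \<bar>k\<bar> \<le> t"
  defines "g \<equiv> 1 + real (card {Q \<in> Paulis n. anticomm N P Q}) / (2 * t)"
  shows "g * (vnorm (drho P *\<^sub>v v))\<^sup>2 \<le> (\<Sum>Q\<in>Paulis n. (vnorm (drho Q *\<^sub>v v))\<^sup>2)"
proof -
  obtain P' where P': "anticomm N P P'" using partner[OF P] by blast
  let ?D = "drho P"
  let ?S = "\<lambda>v. \<Sum>Q\<in>Paulis n. (vnorm (drho Q *\<^sub>v v))\<^sup>2"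
  define a where "a = real (card {Q \<in> Paulis n. anticomm N P Q})"
  have "?D * madj ?D = madj ?D * ?D"
    unfolding drho_madj[OF P'] using uminus_mult_left_mat[of ?D ?D] uminus_mult_right_mat[of ?D ?D] carrier_matD[OF drho_carrier] by simp
  then obtain E \<Lambda> where "spectral_resolution d ?D E \<Lambda>"
    using spectral_resolution_exists[OF drho_carrier] by blast
  then interpret spectral_resolution d ?D E \<Lambda> .
  have S_form: "?S x = Re (ip (casimir *\<^sub>v x) x)" if "x \<in> carrier_vec d" for x
    by (simp add: casimir_form[OF that that] ip_self)
  have eig: "g * (vnorm (?D *\<^sub>v w))\<^sup>2 \<le> ?S w" if w: "w = E c *\<^sub>v v" for w c
  proof (cases "vnorm w = 0")
    case True
    have "?D *\<^sub>v w = c \<cdot>\<^sub>v w" using proj_eigen[OF v] w by simp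
    then show ?thesis using True by (simp add: vnorm_smult sum_nonneg)
  next
    case False
    have wc: "w \<in> carrier_vec d" using w v by simp
    have Dw: "?D *\<^sub>v w = c \<cdot>\<^sub>v w" using proj_eigen[OF v] w by simp
    have ipw: "ip (?D *\<^sub>v w) w = c * of_real ((vnorm w)\<^sup>2)"
      using wc by (simp add: Dw ip_smult_left[of _ d] ip_self del: of_real_power)
    have "ip (?D *\<^sub>v w) w = - (cnj c * of_real ((vnorm w)\<^sup>2))"
      using drho_ip[OF P' wc wc] wc by (simp add: Dw ip_smult_right[of _ d] ip_self del: of_real_power)
    \<comment> \<open>\<open>drho P\<close> is skew-Hermitian, so its eigenvalues are purely
      imaginary.\<close>
    then have "(c + cnj c) * of_real ((vnorm w)\<^sup>2) = 0"
      using ipw by (simp add: distrib_right)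
    then have "c + cnj c = 0" using False by simp
    then have c: "c = \<i> * complex_of_real (Im c)" by (simp add: complex_eq_iff)
    define k where "k = \<bar>Im c\<bar>"
    have "w \<noteq> 0\<^sub>v d" using False by auto
    then have kt: "k \<le> t" using spec[OF wc, of "Im c"] Dw c by (simp add: k_def)
    have cm: "cmod c = k" by (subst c) (simp add: norm_mult k_def)
    have k0: "k \<ge> 0" by (simp add: k_def)
    have "(k\<^sup>2 + a / 2 * k) * (vnorm w)\<^sup>2 \<le> ?S w"
    proof -
      have "(vnorm (?D *\<^sub>v w))\<^sup>2 = k\<^sup>2 * (vnorm w)\<^sup>2" by (simp add: Dw vnorm_smult cm power_mult_distrib)
      moreover have "cmod (ip (?D *\<^sub>v w) w) = k * (vnorm w)\<^sup>2"
        unfolding ipw by (simp add: norm_mult cm del: of_real_power)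
      ultimately show ?thesis using drho_su2_bound[OF P wc] by (simp add: a_def algebra_simps)
    qed
    moreover have "g * k\<^sup>2 \<le> k\<^sup>2 + a / 2 * k"
    proof -
      have "k * k \<le> k * t" using k0 kt by (intro mult_left_mono)
      then have "k * k / t \<le> k" using t by (simp add: pos_divide_le_eq)
      then have "a / 2 * (k * k / t) \<le> a / 2 * k" by (intro mult_left_mono) (auto simp: a_def)
      then show ?thesis unfolding g_def a_def[symmetric] by (simp add: algebra_simps power2_eq_square)
    qed
    ultimately have "g * k\<^sup>2 * (vnorm w)\<^sup>2 \<le> ?S w"
      by (meson mult_right_mono order_trans zero_le_power2)
    then show ?thesis by (simp add: Dw vnorm_smult cm power_mult_distrib mult.assoc)
  qed
  have "g * (vnorm (?D *\<^sub>v v))\<^sup>2 = (\<Sum>c\<in>\<Lambda>. g * (vnorm (?D *\<^sub>v (E c *\<^sub>v v)))\<^sup>2)"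
    using vnorm_decomp[of "?D *\<^sub>v v"] proj_commute_vec[OF drho_carrier refl v] v by (simp add: sum_distrib_left)
  also have "\<dots> \<le> (\<Sum>c\<in>\<Lambda>. ?S (E c *\<^sub>v v))"
    by (rule sum_mono) (rule eig[OF refl])
  also have "\<dots> = (\<Sum>c\<in>\<Lambda>. Re (ip (casimir *\<^sub>v (E c *\<^sub>v v)) (E c *\<^sub>v v)))"
    using v by (intro sum.cong refl S_form) simp
  \<comment> \<open>The Casimir operator preserves the eigenspaces of \<open>drho P\<close>, so its
    form has no cross terms between them.\<close>
  also have "\<dots> = Re (\<Sum>c\<in>\<Lambda>. ip (E c *\<^sub>v (casimir *\<^sub>v v)) (E c *\<^sub>v v))"
    using proj_commute_vec[OF casimir_carrier casimir_drho[OF P, symmetric] v] by simp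
  also have "\<dots> = ?S v"
    using ip_decomp[of "casimir *\<^sub>v v" v] v by (simp add: S_form)
  finally show ?thesis .
qed

end

section \<open>Tensor powers and the main theorem\<close>

lemma mconj_carrier [simp]: "A \<in> carrier_mat a b \<Longrightarrow> mconj A \<in> carrier_mat a b"
  by (simp add: mconj_def)

lemma mconj_index [simp]: "i < dim_row A \<Longrightarrow> j < dim_col A \<Longrightarrow> mconj A $$ (i,j) = cnj (A $$ (i,j))"
  by (simp add: mconj_def)

lemma mconj_mult:
  assumes "A \<in> carrier_mat d d" "B \<in> carrier_mat d d"
  shows "mconj (A * B) = mconj A * mconj B"
proof (rule eq_matI)
  fix i j assume "i < dim_row (mconj A * mconj B)" "j < dim_col (mconj A * mconj B)"
  then have ij: "i < d" "j < d" using assms by (auto simp: mconj_def)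
  have "mconj (A * B) $$ (i,j) = cnj ((A * B) $$ (i,j))"
    using ij assms by (subst mconj_index) auto
  also have "\<dots> = (\<Sum>k<d. mconj A $$ (i,k) * mconj B $$ (k,j))"
    unfolding mult_index[OF assms ij] using assms ij by simp
  also have "\<dots> = (mconj A * mconj B) $$ (i,j)"
    using assms ij by (intro mult_index[symmetric]) auto
  finally show "mconj (A * B) $$ (i,j) = (mconj A * mconj B) $$ (i,j)" .
qed (use assms in \<open>auto simp: mconj_def\<close>)

lemma mconj_one [simp]: "mconj (1\<^sub>m d) = 1\<^sub>m d"
  by (auto intro!: eq_matI simp: mconj_def)

lemma madj_mconj: "madj (mconj A) = mconj (madj A)"
  by (auto intro!: eq_matI simp: madj_def mconj_def)

lemma unitary_mconj: "unitary_mat d U \<Longrightarrow> unitary_mat d (mconj U)"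
  by (auto simp: unitary_mat_def madj_mconj simp flip: mconj_mult[of _ d])

lemma unitary_kron:
  assumes "unitary_mat a U" "unitary_mat b V"
  shows "unitary_mat (a * b) (kron U V)"
proof -
  note U = unitary_matD[OF assms(1)] and V = unitary_matD[OF assms(2)]
  show ?thesis
    using U(1) V(1) kron_mult[OF U(1,2) V(1,2)] kron_mult[OF U(2,1) V(2,1)]
    by (simp add: unitary_mat_def kron_madj U(3,4) V(3,4) kron_one)
qed

lemma kron_pow_carrier [simp]: "A \<in> carrier_mat m m \<Longrightarrow> kron_pow A t \<in> carrier_mat (m ^ t) (m ^ t)"
  by (induction t) auto

lemma kron_pow_mult:
  assumes "A \<in> carrier_mat m m" "B \<in> carrier_mat m m"
  shows "kron_pow (A * B) t = kron_pow A t * kron_pow B t"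
  by (induction t) (auto simp: kron_mult[OF assms kron_pow_carrier[OF assms(1)] kron_pow_carrier[OF assms(2)]])

lemma unitary_kron_pow: "unitary_mat m U \<Longrightarrow> unitary_mat (m ^ t) (kron_pow U t)"
  by (induction t) (auto simp: unitary_mat_one unitary_kron)

lemma prod_diff_le:
  fixes a b c e :: complex
  assumes "cmod a \<le> 1" "cmod e \<le> 1" "cmod (a - c) \<le> x" "cmod (b - e) \<le> y"
  shows "cmod (a * b - c * e) \<le> x + y"
proof -
  have "a * b - c * e = a * (b - e) + (a - c) * e" by (simp add: algebra_simps)
  then have "cmod (a * b - c * e) \<le> cmod a * cmod (b - e) + cmod (a - c) * cmod e"
    by (metis norm_mult norm_triangle_ineq)
  also have "\<dots> \<le> 1 * y + x * 1"
    using assms by (intro add_mono mult_mono) (auto intro: order.trans[OF norm_ge_zero])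
  finally show ?thesis by simp
qed

lemma kron_entries_diff:
  assumes "A \<in> carrier_mat a a" "A' \<in> carrier_mat a a" "B \<in> carrier_mat b b" "B' \<in> carrier_mat b b"
    and "\<And>i j. i < a \<Longrightarrow> j < a \<Longrightarrow> cmod (A $$ (i,j)) \<le> 1" "\<And>i j. i < b \<Longrightarrow> j < b \<Longrightarrow> cmod (B' $$ (i,j)) \<le> 1"
    and "\<And>i j. i < a \<Longrightarrow> j < a \<Longrightarrow> cmod (A $$ (i,j) - A' $$ (i,j)) \<le> x"
    and "\<And>i j. i < b \<Longrightarrow> j < b \<Longrightarrow> cmod (B $$ (i,j) - B' $$ (i,j)) \<le> y"
    and ij: "i < a * b" "j < a * b"
  shows "cmod (kron A B $$ (i,j) - kron A' B' $$ (i,j)) \<le> x + y"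
proof -
  have "i div b < a" "j div b < a" "i mod b < b" "j mod b < b"
    using ij by (auto simp: less_mult_imp_div_less mod_less_of_less_mult)
  then show ?thesis
    using assms by (simp add: kron_index[of _ a a _ b b] prod_diff_le)
qed

text \<open>Entries of unitary matrices have modulus at most \<open>1\<close>, so exchanging one
  tensor factor at a time costs at most \<open>x\<close> each.\<close>

lemma kron_pow_entries_diff:
  assumes U: "unitary_mat m U" and V: "unitary_mat m V"
    and le: "\<And>i j. i < m \<Longrightarrow> j < m \<Longrightarrow> cmod (U $$ (i,j) - V $$ (i,j)) \<le> x"
    and ij: "i < m ^ t" "j < m ^ t"
  shows "cmod (kron_pow U t $$ (i,j) - kron_pow V t $$ (i,j)) \<le> real t * x"
  using ij
proof (induction t arbitrary: i j)
  case (Suc t)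
  have "cmod (kron U (kron_pow U t) $$ (i,j) - kron V (kron_pow V t) $$ (i,j)) \<le> x + real t * x"
    using Suc.prems unitary_matD(1)[OF U] unitary_matD(1)[OF V] unitary_matD(1)[OF unitary_kron_pow[OF U]] unitary_matD(1)[OF unitary_kron_pow[OF V]]
      unitary_entry_le_1[OF U] unitary_entry_le_1[OF unitary_kron_pow[OF V]]
    by (intro kron_entries_diff[where a = m and b = "m ^ t"] le Suc.IH) auto
  then show ?case by (simp add: algebra_simps)
qed simp

lemma tensor_rep: "unitary_rep N (N ^ (2 * t)) (\<lambda>U. kron_pow (kron U (mconj U)) t)"
proof -
  have dim: "N ^ (2 * t) = (N * N) ^ t" by (simp add: power_mult power2_eq_square)
  let ?d = "(N * N) ^ t"
  let ?\<rho> = "\<lambda>U. kron_pow (kron U (mconj U)) t"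
  have uK: "unitary_mat (N * N) (kron U (mconj U))" if "U \<in> SU N" for U
    using SU_D(2)[OF that] by (intro unitary_kron unitary_mconj)
  have u: "unitary_mat ?d (?\<rho> U)" if "U \<in> SU N" for U
    by (rule unitary_kron_pow[OF uK[OF that]])
  show ?thesis
    unfolding unitary_rep_def dim
  proof (intro conjI ballI allI impI u)
    fix U V assume UV: "U \<in> SU N" "V \<in> SU N"
    note c = SU_D(1)[OF UV(1)] SU_D(1)[OF UV(2)]
    show "?\<rho> (U * V) = ?\<rho> U * ?\<rho> V"
      using c kron_pow_mult[of "kron U (mconj U)" "N * N" "kron V (mconj V)" t]
      by (simp add: mconj_mult[OF c] kron_mult[OF c mconj_carrier[OF c(1)] mconj_carrier[OF c(2)]])
  next
    fix U and e :: real assume U: "U \<in> SU N" and e: "e > 0"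
    \<comment> \<open>A Lipschitz constant: there are \<open>?d * ?d\<close> entries, each varying
      by at most \<open>2 * t\<close> times the distance of the arguments. The \<open>+ 1\<close>
      makes \<open>c\<close> positive and the final inequality strict.\<close>
    define c where "c = real ?d * (real ?d * (real t * 2)) + 1"
    have c: "c > 0" by (simp add: c_def add_nonneg_pos)
    show "\<exists>\<delta>>0. \<forall>V\<in>SU N. op_norm (U - V) < \<delta> \<longrightarrow> op_norm (?\<rho> U - ?\<rho> V) < e"
    proof (intro exI[of _ "e / c"] conjI ballI impI)
      show "e / c > 0" using e c by simp
      fix V assume V: "V \<in> SU N" and small: "op_norm (U - V) < e / c"
      let ?x = "op_norm (U - V)"
      note Uc = SU_D(1)[OF U] and Vc = SU_D(1)[OF V]
      have UV: "U - V \<in> carrier_mat N N" by (rule minus_carrier_mat[OF Vc])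
      have d1: "cmod (U $$ (i,j) - V $$ (i,j)) \<le> ?x" if "i < N" "j < N" for i j
        using cmod_index_le_op_norm[OF UV that] that Uc Vc by simp
      have d1': "cmod (mconj U $$ (i,j) - mconj V $$ (i,j)) \<le> ?x" if "i < N" "j < N" for i j
        using d1[OF that] that Uc Vc by (simp flip: complex_cnj_diff)
      have d2: "cmod (kron U (mconj U) $$ (i,j) - kron V (mconj V) $$ (i,j)) \<le> ?x + ?x" if "i < N * N" "j < N * N" for i j
        using that Uc Vc unitary_entry_le_1[OF SU_D(2)[OF U]] unitary_entry_le_1[OF unitary_mconj[OF SU_D(2)[OF V]]]
        by (intro kron_entries_diff[where a = N and b = N] d1 d1') auto
      have d3: "cmod (?\<rho> U $$ (i,j) - ?\<rho> V $$ (i,j)) \<le> real t * (?x + ?x)" if "i < ?d" "j < ?d" for i j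
        using that by (intro kron_pow_entries_diff[OF uK[OF U] uK[OF V]] d2)
      note c3 = unitary_matD(1)[OF u[OF U]] unitary_matD(1)[OF u[OF V]]
      have "op_norm (?\<rho> U - ?\<rho> V) \<le> (\<Sum>i<?d. \<Sum>j<?d. cmod ((?\<rho> U - ?\<rho> V) $$ (i,j)))"
        by (rule op_norm_le_sum[OF minus_carrier_mat[OF c3(2)]])
      also have "\<dots> \<le> (\<Sum>i<?d. \<Sum>j<?d. real t * (?x + ?x))"
        using d3 carrier_matD[OF c3(1)] carrier_matD[OF c3(2)] by (intro sum_mono) simp
      also have "\<dots> = (c - 1) * ?x" by (simp add: c_def algebra_simps)
      also have "\<dots> \<le> (c - 1) * (e / c)"
        using small by (intro mult_left_mono) (auto simp: c_def)
      also have "\<dots> < e" using c e by (simp add: field_simps)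
      finally show "op_norm (?\<rho> U - ?\<rho> V) < e" .
    qed
  qed
qed

section \<open>The exponential of an involution\<close>

lemma involution_pow:
  fixes A :: "complex mat"
  assumes A: "A \<in> carrier_mat N N" "A * A = 1\<^sub>m N"
  shows "(x \<cdot>\<^sub>m A) ^\<^sub>m k = (x ^ k) \<cdot>\<^sub>m (if even k then 1\<^sub>m N else A)"
proof (induction k)
  case 0
  then show ?case using A by simp
next
  case (Suc k)
  let ?B = "if even k then 1\<^sub>m N else A"
  have B: "?B \<in> carrier_mat N N" using A by simp
  have BA: "?B * A = (if even (Suc k) then 1\<^sub>m N else A)" using A by simp
  have "(x ^ k \<cdot>\<^sub>m ?B) * (x \<cdot>\<^sub>m A) = x ^ k \<cdot>\<^sub>m (?B * (x \<cdot>\<^sub>m A))"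
    by (rule mult_smult_assoc_mat[OF B smult_carrier_mat[OF A(1)]])
  also have "?B * (x \<cdot>\<^sub>m A) = x \<cdot>\<^sub>m (?B * A)" by (rule mult_smult_distrib[OF B A(1)])
  finally show ?case by (simp only: pow_mat.simps Suc BA smult_smult_mat) (simp add: mult.commute)
qed

text \<open>An involution acts as \<open>1\<close> and \<open>-1\<close> on the ranges of
  \<open>(1 + A) / 2\<close> and \<open>(1 - A) / 2\<close>, so the matrix series splits into two
  scalar exponential series.\<close>

lemma mexp_involution:
  assumes A: "A \<in> carrier_mat N N" "A * A = 1\<^sub>m N" and ij: "i < N" "j < N"
  shows "mexp (x \<cdot>\<^sub>m A) $$ (i,j) = exp x * ((1\<^sub>m N $$ (i,j) + A $$ (i,j)) / 2) + exp (- x) * ((1\<^sub>m N $$ (i,j) - A $$ (i,j)) / 2)"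
proof -
  let ?o = "1\<^sub>m N $$ (i,j) :: complex" and ?a = "A $$ (i,j)"
  have e: "(\<lambda>k. y ^ k / of_nat (fact k)) sums exp y" for y :: complex
    using exp_converges[of y] by (simp add: scaleR_conv_of_real divide_inverse mult.commute)
  have "(\<lambda>k. (x ^ k / of_nat (fact k)) * ((?o + ?a) / 2) + ((- x) ^ k / of_nat (fact k)) * ((?o - ?a) / 2))
      sums (exp x * ((?o + ?a) / 2) + exp (- x) * ((?o - ?a) / 2))"
    by (intro sums_add sums_mult2 e)
  moreover have "(x ^ k / of_nat (fact k)) * ((?o + ?a) / 2) + ((- x) ^ k / of_nat (fact k)) * ((?o - ?a) / 2)
      = ((x \<cdot>\<^sub>m A) ^\<^sub>m k) $$ (i,j) / of_nat (fact k)" for k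
    using A ij by (cases "even k") (simp_all add: involution_pow[OF A] field_simps)
  ultimately have "(\<lambda>k. ((x \<cdot>\<^sub>m A) ^\<^sub>m k) $$ (i,j) / of_nat (fact k)) sums (exp x * ((?o + ?a) / 2) + exp (- x) * ((?o - ?a) / 2))"
    by simp
  then have "(\<Sum>k. ((x \<cdot>\<^sub>m A) ^\<^sub>m k) $$ (i,j) / of_nat (fact k)) = exp x * ((?o + ?a) / 2) + exp (- x) * ((?o - ?a) / 2)"
    by (rule sums_unique[symmetric])
  moreover have "mexp (x \<cdot>\<^sub>m A) $$ (i,j) = (\<Sum>k. ((x \<cdot>\<^sub>m A) ^\<^sub>m k) $$ (i,j) / of_nat (fact k))"
    using A ij by (simp add: mexp_def)
  ultimately show ?thesis by simp
qed

lemma exp_i_half: "exp (\<i> * complex_of_real y) = complex_of_real (cos y) + \<i> * complex_of_real (sin y)" "exp (- (\<i> * complex_of_real y)) = complex_of_real (cos y) - \<i> * complex_of_real (sin y)"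
proof -
  show "exp (\<i> * complex_of_real y) = complex_of_real (cos y) + \<i> * complex_of_real (sin y)"
    by (simp add: exp_Euler flip: cos_of_real sin_of_real)
  show "exp (- (\<i> * complex_of_real y)) = complex_of_real (cos y) - \<i> * complex_of_real (sin y)"
    using exp_Euler[of "- complex_of_real y"] by (simp flip: cos_of_real sin_of_real)
qed

lemma mexp_rot:
  assumes P: "P \<in> carrier_mat N N" "P * P = 1\<^sub>m N"
  shows "mexp ((\<i> * of_real (\<theta>/2)) \<cdot>\<^sub>m P) = rot N P \<theta>"
    "mexp ((- \<i> * of_real (\<theta>/2)) \<cdot>\<^sub>m mconj P) = mconj (rot N P \<theta>)"
proof -
  have dim: "dim_row (mexp (x \<cdot>\<^sub>m A)) = N" "dim_col (mexp (x \<cdot>\<^sub>m A)) = N" if "A \<in> carrier_mat N N" for x A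
    using that by (auto simp: mexp_def)
  have neg: "exp (- (- \<i> * complex_of_real y)) = exp (\<i> * complex_of_real y)"
    "exp (- \<i> * complex_of_real y) = exp (- (\<i> * complex_of_real y))" for y by simp_all
  show "mexp ((\<i> * of_real (\<theta>/2)) \<cdot>\<^sub>m P) = rot N P \<theta>"
  proof (rule eq_matI)
    fix i j assume "i < dim_row (rot N P \<theta>)" "j < dim_col (rot N P \<theta>)"
    then have ij: "i < N" "j < N" using P by (auto simp: rot_def)
    show "mexp ((\<i> * of_real (\<theta>/2)) \<cdot>\<^sub>m P) $$ (i,j) = rot N P \<theta> $$ (i,j)"
      unfolding mexp_involution[OF P ij] exp_i_half using P ij
      by (simp add: rot_def) (simp add: field_simps)
  qed (use P dim in \<open>auto simp: rot_def\<close>)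
  have Pc: "mconj P \<in> carrier_mat N N" "mconj P * mconj P = 1\<^sub>m N"
    using P mconj_mult[OF P(1,1)] by auto
  show "mexp ((- \<i> * of_real (\<theta>/2)) \<cdot>\<^sub>m mconj P) = mconj (rot N P \<theta>)"
  proof (rule eq_matI)
    fix i j assume "i < dim_row (mconj (rot N P \<theta>))" "j < dim_col (mconj (rot N P \<theta>))"
    then have ij: "i < N" "j < N" using P by (auto simp: rot_def mconj_def)
    show "mexp ((- \<i> * of_real (\<theta>/2)) \<cdot>\<^sub>m mconj P) $$ (i,j) = mconj (rot N P \<theta>) $$ (i,j)"
      unfolding mexp_involution[OF Pc ij] neg exp_i_half using P ij
      by (simp add: rot_def) (simp add: field_simps)
  qed (use P dim[OF Pc(1)] in \<open>auto simp: rot_def mconj_def\<close>)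
qed

text \<open>Trigonometric polynomials with integer frequencies from \<open>- t\<close> to
  \<open>t\<close>. The factor \<open>cis (- (s * real t))\<close> shifts the frequencies to the
  range from \<open>0\<close> to \<open>2 * t\<close>, where ordinary polynomials can be
  used.\<close>

definition trig_poly :: "nat \<Rightarrow> (real \<Rightarrow> complex) \<Rightarrow> bool" where
  "trig_poly t f \<longleftrightarrow> (\<exists>p. degree p \<le> 2 * t \<and> (\<forall>s. f s = cis (- (s * real t)) * poly p (cis s)))"

lemma trig_poly_mult:
  assumes "trig_poly a f" "trig_poly b g"
  shows "trig_poly (a + b) (\<lambda>s. f s * g s)"
proof -
  obtain p q where "degree p \<le> 2 * a" "\<And>s. f s = cis (- (s * real a)) * poly p (cis s)"
    "degree q \<le> 2 * b" "\<And>s. g s = cis (- (s * real b)) * poly q (cis s)"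
    using assms unfolding trig_poly_def by blast
  moreover have "cis (- (s * real (a + b))) = cis (- (s * real a)) * cis (- (s * real b))" for s
    by (simp add: cis_mult algebra_simps)
  ultimately show ?thesis
    unfolding trig_poly_def
    by (intro exI[of _ "p * q"]) (auto intro: order.trans[OF degree_mult_le])
qed

lemma trig_poly_cmult: "trig_poly t f \<Longrightarrow> trig_poly t (\<lambda>s. f s * c)"
  unfolding trig_poly_def
proof (elim exE conjE)
  fix p assume "degree p \<le> 2 * t" "\<forall>s. f s = cis (- (s * real t)) * poly p (cis s)"
  then show "\<exists>p. degree p \<le> 2 * t \<and> (\<forall>s. f s * c = cis (- (s * real t)) * poly p (cis s))"
    by (intro exI[of _ "Polynomial.smult c p"]) (auto intro: order.trans[OF degree_smult_le])
qed

lemma trig_poly_sum: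
  assumes "finite A" "\<And>k. k \<in> A \<Longrightarrow> trig_poly t (f k)"
  shows "trig_poly t (\<lambda>s. \<Sum>k\<in>A. f k s)"
  using assms
proof (induction A rule: finite_induct)
  case empty
  show ?case unfolding trig_poly_def by (intro exI[of _ 0]) auto
next
  case (insert k A)
  obtain p q where "degree p \<le> 2 * t" "\<And>s. f k s = cis (- (s * real t)) * poly p (cis s)"
    "degree q \<le> 2 * t" "\<And>s. (\<Sum>k\<in>A. f k s) = cis (- (s * real t)) * poly q (cis s)"
    using insert unfolding trig_poly_def by (metis insertCI)
  then show ?case
    using insert.hyps unfolding trig_poly_def
    by (intro exI[of _ "p + q"]) (auto simp: distrib_left intro: degree_add_le)
qed

text \<open>Both factors have frequencies \<open>1/2\<close> and \<open>-1/2\<close>, which combine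
  to \<open>-1\<close>, \<open>0\<close> and \<open>1\<close>.\<close>

lemma rot_kron_trig_poly:
  assumes P: "P \<in> carrier_mat N N" and ij: "i < N * N" "j < N * N"
  shows "trig_poly 1 (\<lambda>s. kron (rot N P s) (mconj (rot N P s)) $$ (i,j))"
proof -
  have ij': "i div N < N" "j div N < N" "i mod N < N" "j mod N < N"
    using ij by (auto simp: less_mult_imp_div_less mod_less_of_less_mult)
  define a b where "a = (1\<^sub>m N :: complex mat) $$ (i div N, j div N)" "b = P $$ (i div N, j div N)"
  define c e where "c = (1\<^sub>m N :: complex mat) $$ (i mod N, j mod N)" "e = cnj (P $$ (i mod N, j mod N))"
  note defs = a_b_def c_e_def
  \<comment> \<open>With \<open>u = cis (s/2)\<close> and \<open>w = cis (- (s/2))\<close>, the two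
    factors are \<open>(u (a + b) + w (a - b)) / 2\<close> and
    \<open>(u (c - e) + w (c + e)) / 2\<close>. The coefficients of \<open>p\<close> are those of
    \<open>w^2\<close>, \<open>u w = 1\<close> and \<open>u^2\<close> in their product.\<close>
  define p where "p = [:(a - b) * (c + e) / 4, ((a + b) * (c + e) + (a - b) * (c - e)) / 4, (a + b) * (c - e) / 4:]"
  have "kron (rot N P s) (mconj (rot N P s)) $$ (i,j) = cis (- (s * real 1)) * poly p (cis s)" for s
  proof -
    define C S where "C = complex_of_real (cos (s/2))" "S = \<i> * complex_of_real (sin (s/2))"
    have cc: "cnj c = c" by (auto simp: c_e_def ij')
    have "kron (rot N P s) (mconj (rot N P s)) $$ (i,j) = (C * a + S * b) * (C * c - S * e)"
      using P ij ij' by (subst kron_index[of _ N N _ N N]) (auto simp: rot_def defs C_S_def)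
    moreover have "cis s = (C + S) * (C + S)" "cis (- s) = (C - S) * (C - S)" "(C + S) * (C - S) = 1"
    proof -
      have 1: "C + S = cis (s/2)" "C - S = cis (- (s/2))" by (auto simp: C_S_def complex_eq_iff)
      show "cis s = (C + S) * (C + S)" "cis (- s) = (C - S) * (C - S)" "(C + S) * (C - S) = 1"
        unfolding 1 by (simp_all add: cis_mult)
    qed
    moreover have "(C * a + S * b) * (C * c - S * e) = (C - S) * (C - S) * poly p ((C + S) * (C + S))"
    proof -
      let ?u = "C + S" and ?w = "C - S"
      have uw: "?u * ?w = 1" by fact
      have "4 * ((C * a + S * b) * (C * c - S * e)) = (?u * (a + b) + ?w * (a - b)) * (?u * (c - e) + ?w * (c + e))"
        by (simp add: algebra_simps)
      also have "\<dots> = ?w * ?w * ((a - b) * (c + e)) + ?u * ?w * ((a + b) * (c + e) + (a - b) * (c - e)) + ?u * ?u * ((a + b) * (c - e))"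
        by (simp add: algebra_simps)
      also have "\<dots> = ?w * ?w * ((a - b) * (c + e)) + (?u * ?w) * (?u * ?w) * ((a + b) * (c + e) + (a - b) * (c - e)) + (?u * ?w) * (?u * ?w) * (?u * ?u) * ((a + b) * (c - e))"
        unfolding uw by simp
      also have "\<dots> = 4 * (?w * ?w * poly p (?u * ?u))"
        by (simp add: p_def) (simp add: field_simps)
      finally show ?thesis by simp
    qed
    ultimately show ?thesis by simp
  qed
  moreover have "degree p \<le> 2 * 1" by (simp add: p_def)
  ultimately show ?thesis unfolding trig_poly_def by blast
qed

lemma kron_pow_trig_poly:
  assumes F: "\<And>s. F s \<in> carrier_mat m m" and "\<And>i j. i < m \<Longrightarrow> j < m \<Longrightarrow> trig_poly 1 (\<lambda>s. F s $$ (i,j))"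
    and "i < m ^ t" "j < m ^ t"
  shows "trig_poly t (\<lambda>s. kron_pow (F s) t $$ (i,j))"
  using assms(3,4)
proof (induction t arbitrary: i j)
  case 0
  then show ?case unfolding trig_poly_def by (intro exI[of _ "[:1:]"]) simp
next
  case (Suc t)
  have ij: "i div m ^ t < m" "j div m ^ t < m" "i mod m ^ t < m ^ t" "j mod m ^ t < m ^ t"
    using Suc.prems by (auto simp: less_mult_imp_div_less mod_less_of_less_mult)
  have "trig_poly (1 + t) (\<lambda>s. F s $$ (i div m ^ t, j div m ^ t) * kron_pow (F s) t $$ (i mod m ^ t, j mod m ^ t))"
    by (rule trig_poly_mult[OF assms(2)[OF ij(1,2)] Suc.IH[OF ij(3,4)]])
  then show ?case
    using Suc.prems by (simp add: kron_index[OF F kron_pow_carrier[OF F]])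
qed

lemma infinite_unit_circle: "infinite {z. \<exists>s. z = cis s}"
proof
  assume "finite {z. \<exists>s. z = cis s}"
  moreover have "inj_on cis {0..pi}"
    by (rule inj_onI) (auto simp: complex_eq_iff intro: cos_inj_pi)
  moreover have "cis ` {0..pi} \<subseteq> {z. \<exists>s. z = cis s}" by auto
  ultimately have "finite {0..pi}" by (meson finite_imageD finite_subset)
  then show False using pi_gt_zero by (simp add: infinite_Icc)
qed

lemma poly_zero_on_circle:
  assumes "\<And>s. poly p (cis s) = 0"
  shows "p = 0"
proof (rule ccontr)
  assume "p \<noteq> 0"
  then have "finite {z. poly p z = 0}" by (rule poly_roots_finite)
  then have "finite {z. \<exists>s. z = cis s}" by (rule rev_finite_subset) (use assms in auto)
  then show False using infinite_unit_circle by contradiction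
qed

text \<open>Comparing \<open>s = 0\<close> with \<open>s = 2 * pi\<close> shows that
  \<open>k\<close> is an integer. Then the power \<open>k + t\<close> of the variable agrees on the
  unit circle with a polynomial of degree at most \<open>2 * t\<close>, and a polynomial is
  determined by its values on this infinite set.\<close>

lemma trig_poly_character:
  assumes "trig_poly t (\<lambda>s. cis (s * k))"
  shows "\<bar>k\<bar> \<le> real t"
proof -
  obtain p where p: "degree p \<le> 2 * t" and eq: "\<And>s. cis (s * k) = cis (- (s * real t)) * poly p (cis s)"
    using assms unfolding trig_poly_def by blast
  have "cis (2 * pi * k) = cis (0 * k)"
    using eq[of "2 * pi"] eq[of 0] cis_multiple_2pi[of "- real t"] cis_multiple_2pi[of 1] by (simp add: mult.commute)
  then have "cos (2 * pi * k) = 1" by (simp add: complex_eq_iff)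
  then obtain m :: int where m: "2 * pi * k = real_of_int m * 2 * pi" using cos_one_2pi_int by blast
  then have k: "k = real_of_int m" by simp
  have pc: "poly p (cis s) = cis (s * (k + real t))" for s
  proof -
    have "cis (s * real t) * cis (s * k) = (cis (s * real t) * cis (- (s * real t))) * poly p (cis s)"
      using eq[of s] by simp
    then show ?thesis by (simp add: cis_mult algebra_simps)
  qed
  have "k \<le> real t"
  proof (rule ccontr)
    assume "\<not> k \<le> real t"
    then have gt: "m > int t" by (simp add: k)
    define r where "r = nat (m + int t)"
    have r: "real r = k + real t" "r > 2 * t" using gt by (auto simp: r_def k)
    have "monom 1 r - p = 0"
      by (rule poly_zero_on_circle) (simp add: poly_monom pc Complex.DeMoivre mult.commute r(1)[symmetric])
    then have "degree p = r" by (metis degree_monom_eq eq_iff_diff_eq_0 one_neq_zero)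
    then show False using p r by simp
  qed
  moreover have "- k \<le> real t"
  proof (rule ccontr)
    assume "\<not> - k \<le> real t"
    then have gt: "- m > int t" by (simp add: k)
    \<comment> \<open>If \<open>k + t\<close> were negative, multiplying \<open>p\<close> by the
      power \<open>r\<close> would give the constant \<open>1\<close>, although this product
      vanishes at \<open>0\<close>.\<close>
    define r where "r = nat (- (m + int t))"
    have r: "real r = - (k + real t)" "r > 0" using gt by (auto simp: r_def k)
    have "monom 1 r * p - 1 = 0"
    proof (rule poly_zero_on_circle)
      fix s
      have "s * real r = - (s * (k + real t))" unfolding r(1) by (simp add: algebra_simps)
      then have "cis s ^ r = cis (- (s * (k + real t)))"
        by (simp only: Complex.DeMoivre mult.commute[of "real r"])
      then show "poly (monom 1 r * p - 1) (cis s) = 0" by (simp add: poly_monom pc cis_mult)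
    qed
    then have "poly (monom 1 r * p - 1) 0 = 0" by simp
    then show False using r(2) by (simp add: poly_monom zero_power)
  qed
  ultimately show ?thesis by auto
qed

text \<open>The derivative of \<open>cis (- (s * k))\<close> times the component vanishes, so this
  product keeps its value at \<open>s = 0\<close>.\<close>

lemma (in su_rep) rhot_eigenvector:
  assumes P: "anticomm N P Q" and w: "w \<in> carrier_vec d" and ev: "drho P *\<^sub>v w = (\<i> * complex_of_real k) \<cdot>\<^sub>v w"
    and i: "i < d"
  shows "(rhot P s *\<^sub>v w) $ i = cis (s * k) * w $ i"
proof -
  define F where "F s = (\<Sum>j<d. rhot P s $$ (i,j) * w $ j)" for s
  have F: "(rhot P s *\<^sub>v w) $ i = F s" for s
    unfolding F_def by (rule mult_vec_index[OF rhot_carrier[OF P] w i])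
  have dF: "(F has_vector_derivative \<i> * complex_of_real k * F s) (at s)" for s
  proof -
    have "(F has_vector_derivative (\<Sum>j<d. (rhot P s * drho P) $$ (i,j) * w $ j)) (at s)"
      unfolding F_def using i
      by (intro has_vector_derivative_sum has_vector_derivative_mult_left mat_derivD[OF rhot_deriv(1)[OF P]]) auto
    moreover have "(\<Sum>j<d. (rhot P s * drho P) $$ (i,j) * w $ j) = ((rhot P s * drho P) *\<^sub>v w) $ i"
      using rhot_carrier[OF P] w i by (intro mult_vec_index[symmetric]) auto
    moreover have "(rhot P s * drho P) *\<^sub>v w = (\<i> * complex_of_real k) \<cdot>\<^sub>v (rhot P s *\<^sub>v w)"
      using assoc_mult_mat_vec[OF rhot_carrier[OF P] drho_carrier w] ev mult_mat_vec[OF rhot_carrier[OF P] w] by simp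
    moreover have "((\<i> * complex_of_real k) \<cdot>\<^sub>v (rhot P s *\<^sub>v w)) $ i = \<i> * complex_of_real k * F s"
      using carrier_matD[OF rhot_carrier[OF P]] i F by simp
    ultimately show ?thesis by simp
  qed
  have cis_d: "((\<lambda>s. cis (- (s * k))) has_vector_derivative - (\<i> * complex_of_real k) * cis (- (s * k))) (at s)" for s
    unfolding has_vector_derivative_complex_iff
    by (auto intro!: derivative_eq_intros simp flip: has_real_derivative_iff_has_vector_derivative)
  have "((\<lambda>s. cis (- (s * k)) * F s) has_vector_derivative 0) (at s within UNIV)" for s
    using has_vector_derivative_mult[OF cis_d dF, of s] by (simp add: ac_simps)
  then obtain c where c: "\<And>s. cis (- (s * k)) * F s = c"
    using has_vector_derivative_zero_constant[of UNIV "\<lambda>s. cis (- (s * k)) * F s"] by auto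
  have "F 0 = w $ i" using F[of 0] w by (simp add: rhot_zero[OF P])
  then have "c = w $ i" using c[of 0] by simp
  then have "cis (s * k) * (cis (- (s * k)) * F s) = cis (s * k) * w $ i" using c by simp
  then show ?thesis unfolding F by (simp add: cis_mult flip: mult.assoc)
qed

section \<open>The two norm bounds\<close>

lemma theta_pauli_expect_cong:
  assumes "\<And>\<theta> P. P \<in> S \<Longrightarrow> f \<theta> P = g \<theta> P"
  shows "theta_pauli_expect d a b S f = theta_pauli_expect d a b S g"
  unfolding theta_pauli_expect_def using assms by simp

text \<open>With \<open>K = card (Paulis n)\<close> this secures
  \<open>1 + (K + 1) / 4 \<le> K\<close>, the condition that the gap does not exceed
  \<open>K\<close>; it holds from \<open>K = 5/3\<close> on.\<close>

lemma two_le_card_Paulis: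
  assumes "n \<ge> 1"
  shows "2 \<le> card (Paulis n)"
proof -
  obtain P where P: "P \<in> Paulis n" using Paulis_nonempty[OF assms] by blast
  obtain Q where Q: "Q \<in> Paulis n" "anticomm (2^n) P Q" using Paulis_partner[OF P] by blast
  have "P \<noteq> Q"
  proof
    assume "P = Q"
    then have "1\<^sub>m (2^n) = - (1\<^sub>m (2^n) :: complex mat)" using Q(2) by (auto simp: anticomm_def)
    from arg_cong[OF this, of "\<lambda>M. M $$ (0,0)"] show False by simp
  qed
  then have "card {P, Q} = 2" by simp
  then show ?thesis using card_mono[OF finite_Paulis, of "{P, Q}" n] P Q by simp
qed

lemma card_Paulis_le: "real (card (Paulis n)) \<le> 4 ^ n - 1"
proof -
  have "real (card (Paulis n) + 1) \<le> real (4 ^ n)"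
    using card_Paulis[of n] by (simp only: of_nat_le_iff)
  then show ?thesis by simp
qed

lemma tensor_average_bound:
  assumes n: "n \<ge> 1" and t: "t \<ge> 1" and h: "haar_SU (2^n) \<mu>"
  shows "op_norm
           (theta_pauli_expect ((2^n)^(2*t)) (-pi) pi (Paulis n)
              (\<lambda>\<theta> P. kron_pow (kron (mexp ((\<i> * of_real (\<theta>/2)) \<cdot>\<^sub>m P))
                                     (mexp ((- \<i> * of_real (\<theta>/2)) \<cdot>\<^sub>m mconj P))) t)
            - mat_expect ((2^n)^(2*t)) \<mu> (\<lambda>U. kron_pow (kron U (mconj U)) t))
         \<le> 1 - 1 / (4 * real t) - 1 / (4^n - 1)"
proof -
  let ?N = "2^n :: nat"
  let ?\<rho> = "\<lambda>U. kron_pow (kron U (mconj U)) t"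
  define K where "K = real (card (Paulis n))"
  interpret pauli_rep ?N "?N ^ (2 * t)" ?\<rho> n
    using tensor_rep[of ?N t] n by unfold_locales auto
  have K2: "K \<ge> 2" using two_le_card_Paulis[OF n] by (simp add: K_def)
  \<comment> \<open>The rotations by \<open>pi\<close> and \<open>- pi\<close> are
    \<open>\<i> P\<close> and \<open>- \<i> P\<close>. The sign appears in both Kronecker factors
    and cancels.\<close>
  have per: "rhot P pi = rhot P (- pi)" if P: "P \<in> Paulis n" for P
  proof -
    have Pc: "P \<in> carrier_mat ?N ?N" using partner[OF P] by (auto simp: anticomm_def)
    have "kron (rot ?N P pi) (mconj (rot ?N P pi)) = kron (rot ?N P (- pi)) (mconj (rot ?N P (- pi)))"
      using Pc by (intro eq_matI)
        (auto simp: kron_def rot_def mconj_def less_mult_imp_div_less mod_less_of_less_mult)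
    then show ?thesis by (simp add: rhot_def)
  qed
  \<comment> \<open>A component of the rotated eigenvector is \<open>cis (s * k)\<close> times a
    nonzero constant, and also a combination of entries of \<open>rhot P s\<close>, which are
    trigonometric polynomials of degree at most \<open>t\<close>.\<close>
  have spec: "\<bar>k\<bar> \<le> real t"
    if P: "P \<in> Paulis n" and w: "w \<in> carrier_vec (?N ^ (2 * t))" "w \<noteq> 0\<^sub>v (?N ^ (2 * t))"
      and ev: "drho P *\<^sub>v w = (\<i> * complex_of_real k) \<cdot>\<^sub>v w" for P w k
  proof -
    obtain Q where Q: "anticomm ?N P Q" using partner[OF P] by blast
    obtain i where i: "i < ?N ^ (2 * t)" "w $ i \<noteq> 0"
      using w by (metis carrier_vecD eq_vecI index_zero_vec)
    have dim: "?N ^ (2 * t) = (?N * ?N) ^ t" by (simp add: power_mult power2_eq_square)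
    note Pc = anticommD(1)[OF Q]
    have ent: "trig_poly t (\<lambda>s. rhot P s $$ (i,j))" if "j < ?N ^ (2 * t)" for j
      unfolding rhot_def
      by (rule kron_pow_trig_poly[where m = "?N * ?N"])
        (use Pc rot_kron_trig_poly[OF Pc] i that dim in auto)
    have "trig_poly t (\<lambda>s. \<Sum>j<?N ^ (2 * t). rhot P s $$ (i,j) * w $ j)"
      by (intro trig_poly_sum trig_poly_cmult ent) auto
    moreover have "(\<Sum>j<?N ^ (2 * t). rhot P s $$ (i,j) * w $ j) = cis (s * k) * w $ i" for s
      using rhot_eigenvector[OF Q w(1) ev i(1)] mult_vec_index[OF rhot_carrier[OF Q] w(1) i(1), of s] by simp
    ultimately have "trig_poly t (\<lambda>s. cis (s * k) * w $ i)" by simp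
    from trig_poly_cmult[OF this, of "1 / w $ i"] have "trig_poly t (\<lambda>s. cis (s * k))"
      using i(2) by simp
    then show ?thesis by (rule trig_poly_character)
  qed
  \<comment> \<open>The value \<open>1 + a / (2 * t)\<close> of \<open>drho_gap\<close> at
    \<open>a = (K + 1) / 2\<close>, the lower bound from \<open>card_anticomm\<close>.\<close>
  define g where "g = 1 + (K + 1) / (4 * real t)"
  have gap: "g * (vnorm (drho P *\<^sub>v v))\<^sup>2 \<le> (\<Sum>Q\<in>Paulis n. (vnorm (drho Q *\<^sub>v v))\<^sup>2)"
    if P: "P \<in> Paulis n" and v: "v \<in> carrier_vec (?N ^ (2 * t))" for P v
  proof -
    let ?a = "real (card {Q \<in> Paulis n. anticomm ?N P Q})"
    have "real (card (Paulis n) + 1) \<le> real (2 * card {Q \<in> Paulis n. anticomm ?N P Q})"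
      using card_anticomm[OF P] by (simp only: of_nat_le_iff)
    then have "K + 1 \<le> 2 * ?a" by (simp add: K_def)
    then have "(K + 1) / (4 * real t) \<le> 2 * ?a / (4 * real t)" by (rule divide_right_mono) simp
    then have "g \<le> 1 + ?a / (2 * real t)" by (simp add: g_def)
    then have "g * (vnorm (drho P *\<^sub>v v))\<^sup>2 \<le> (1 + ?a / (2 * real t)) * (vnorm (drho P *\<^sub>v v))\<^sup>2"
      by (rule mult_right_mono) simp
    also have "\<dots> \<le> (\<Sum>Q\<in>Paulis n. (vnorm (drho Q *\<^sub>v v))\<^sup>2)"
      using t by (intro drho_gap P v spec[OF P]) auto
    finally show ?thesis .
  qed
  have "(K + 1) / (4 * real t) \<le> (K + 1) / 4"
    using K2 t by (intro divide_left_mono) auto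
  moreover have "1 + (K + 1) / 4 \<le> K" using K2 by (simp add: field_simps)
  ultimately have gK: "g \<le> K" unfolding g_def by linarith
  have eq: "theta_pauli_expect (?N^(2*t)) (-pi) pi (Paulis n)
              (\<lambda>\<theta> P. kron_pow (kron (mexp ((\<i> * of_real (\<theta>/2)) \<cdot>\<^sub>m P))
                                     (mexp ((- \<i> * of_real (\<theta>/2)) \<cdot>\<^sub>m mconj P))) t)
      = theta_pauli_expect (?N^(2*t)) (-pi) pi (Paulis n) (\<lambda>\<theta> P. rhot P \<theta>)"
  proof (rule theta_pauli_expect_cong)
    fix \<theta> P assume P: "P \<in> Paulis n"
    note pp = pauli_all_props[OF PaulisD(1)[OF P]]
    show "kron_pow (kron (mexp ((\<i> * of_real (\<theta>/2)) \<cdot>\<^sub>m P)) (mexp ((- \<i> * of_real (\<theta>/2)) \<cdot>\<^sub>m mconj P))) t = rhot P \<theta>"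
      unfolding mexp_rot[OF pp(1,2)] rhot_def ..
  qed
  have "op_norm (theta_pauli_expect (?N^(2*t)) (-pi) pi (Paulis n) (\<lambda>\<theta> P. rhot P \<theta>) - mat_expect (?N^(2*t)) \<mu> ?\<rho>)
      \<le> 1 - g / card (Paulis n)"
    using gK by (intro pauli_average_bound h per gap) (auto simp: K_def)
  \<comment> \<open>The first summand uses \<open>(K + 1) / K \<ge> 1\<close>, the second
    \<open>K \<le> 4^n - 1\<close>.\<close>
  moreover have "1 / (4 * real t) + 1 / (4^n - 1) \<le> g / K"
  proof -
    have "1 / (4^n - 1) \<le> 1 / K"
      using card_Paulis_le[of n] K2 by (intro divide_left_mono) (auto simp: K_def)
    moreover have "1 / (4 * real t) \<le> (K + 1) / (4 * real t) / K"
      using K2 t by (simp add: field_simps)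
    ultimately show ?thesis by (simp add: g_def add_divide_distrib)
  qed
  ultimately show ?thesis unfolding eq K_def by linarith
qed

lemma representation_average_bound:
  assumes n: "n \<ge> 1" and h: "haar_SU (2^n) \<mu>" and rep: "unitary_rep (2^n) d \<rho>"
  shows "op_norm
             (theta_pauli_expect d (-2*pi) (2*pi) (Paulis n)
                (\<lambda>\<theta> P. \<rho> (mexp ((\<i> * of_real (\<theta>/2)) \<cdot>\<^sub>m P)))
              - mat_expect d \<mu> \<rho>)
           \<le> 1 - 1 / (4^n - 1)"
proof -
  let ?N = "2^n :: nat"
  define K where "K = real (card (Paulis n))"
  interpret pauli_rep ?N d \<rho> n
    using rep n by unfold_locales auto
  have K2: "K \<ge> 2" using two_le_card_Paulis[OF n] by (simp add: K_def)
  have eq: "theta_pauli_expect d (-2*pi) (2*pi) (Paulis n) (\<lambda>\<theta> P. \<rho> (mexp ((\<i> * of_real (\<theta>/2)) \<cdot>\<^sub>m P)))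
      = theta_pauli_expect d (- (2*pi)) (2*pi) (Paulis n) (\<lambda>\<theta> P. rhot P \<theta>)"
  proof -
    have "theta_pauli_expect d (-2*pi) (2*pi) (Paulis n) (\<lambda>\<theta> P. \<rho> (mexp ((\<i> * of_real (\<theta>/2)) \<cdot>\<^sub>m P)))
      = theta_pauli_expect d (-2*pi) (2*pi) (Paulis n) (\<lambda>\<theta> P. rhot P \<theta>)"
    proof (rule theta_pauli_expect_cong)
      fix \<theta> P assume P: "P \<in> Paulis n"
      note pp = pauli_all_props[OF PaulisD(1)[OF P]]
      show "\<rho> (mexp ((\<i> * of_real (\<theta>/2)) \<cdot>\<^sub>m P)) = rhot P \<theta>"
        unfolding mexp_rot[OF pp(1,2)] rhot_def ..
    qed
    then show ?thesis by simp
  qed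
  have "op_norm (theta_pauli_expect d (- (2*pi)) (2*pi) (Paulis n) (\<lambda>\<theta> P. rhot P \<theta>) - mat_expect d \<mu> \<rho>)
      \<le> 1 - 1 / card (Paulis n)"
  proof (rule pauli_average_bound[OF h])
    fix P assume P: "P \<in> Paulis n"
    \<comment> \<open>Both rotations are minus the identity matrix.\<close>
    show "rhot P (2 * pi) = rhot P (- (2 * pi))" by (simp add: rhot_def rot_def)
    fix v :: "complex vec"
    \<comment> \<open>The gap \<open>1\<close> is trivial: \<open>P\<close> itself is one of the
      summands on the right.\<close>
    show "1 * (vnorm (drho P *\<^sub>v v))\<^sup>2 \<le> (\<Sum>Q\<in>Paulis n. (vnorm (drho Q *\<^sub>v v))\<^sup>2)"
      using member_le_sum[OF P, of "\<lambda>Q. (vnorm (drho Q *\<^sub>v v))\<^sup>2"] finite_Paulis by simp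
  qed (use K2 in \<open>auto simp: K_def\<close>)
  moreover have "1 / (4^n - 1) \<le> 1 / K"
    using card_Paulis_le[of n] K2 by (intro divide_left_mono) (auto simp: K_def)
  ultimately show ?thesis unfolding eq K_def by linarith
qed

theorem theorem1p1:
  fixes n t :: nat and \<mu> :: "complex mat measure"
  assumes "n \<ge> 1" and "t \<ge> 1"
    and "haar_SU (2^n) \<mu>"
  shows "(op_norm
           (theta_pauli_expect ((2^n)^(2*t)) (-pi) pi (Paulis n)
              (\<lambda>\<theta> P. kron_pow (kron (mexp ((\<i> * of_real (\<theta>/2)) \<cdot>\<^sub>m P))
                                     (mexp ((- \<i> * of_real (\<theta>/2)) \<cdot>\<^sub>m mconj P))) t)
            - mat_expect ((2^n)^(2*t)) \<mu> (\<lambda>U. kron_pow (kron U (mconj U)) t))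
         \<le> 1 - 1 / (4 * real t) - 1 / (4^n - 1)) \<and>
         (\<forall>d \<rho>. unitary_rep (2^n) d \<rho> \<longrightarrow>
           op_norm
             (theta_pauli_expect d (-2*pi) (2*pi) (Paulis n)
                (\<lambda>\<theta> P. \<rho> (mexp ((\<i> * of_real (\<theta>/2)) \<cdot>\<^sub>m P)))
              - mat_expect d \<mu> \<rho>)
           \<le> 1 - 1 / (4^n - 1))"
  using tensor_average_bound[OF assms] representation_average_bound[OF assms(1,3)] by blast

end
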